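(* Let $G$ be a compact topological group acting on a measurable space $(Y,\mathcal{Y})$ via $(g,y)\mapsto A'(g,y)=g\cdot y$, let $(\Omega,\mathcal{F},\mathbf{P})$ be a probability space with $\{\omega\}\in\mathcal{F}$ for all $\omega$, and consider the action on $X_0=\Omega\times Y$ given by $g\cdot(\omega,y)=(\omega,g\cdot y)$. Let $S,Z$ be $Y$-indexed stochastic processes (not necessarily with $G$-invariant laws) such that for every $x_0\in X_0$ the maps $g\mapsto S(g\cdot x_0)$, $g\mapsto Z(g\cdot x_0)$ are in $L^2(G)$, and let $\mu$ be a $\sigma$-finite positive $G$-invariant measure on $(Y,\mathcal{Y})$. Suppose that for every $\omega^*\in\Omega$ the maps $(g,y)\mapsto Z(\omega^*,g\cdot y)$ and $(g,y)\mapsto S(\omega^*,g\cdot y)$ belong to $L^2(dg\times\mu(dy))$, and that for every $(\omega^*,g^* )\in\Omega\times G$ the maps $y\mapsto Z(\omega^*,g^*\cdot y)$ and $y\mapsto S(\omega^*,g^*\cdot y)$ belong to $L^2(\mu)$. Then: 1. For every $(\omega^*,g^* )\in\Omega\times G$ and $[\pi]\neq[\sigma]$ in $\widehat G$, $\int_Y S_{X_0}^\pi[g^*](\omega^*,y)\,\overline{Z_{X_0}^\sigma[g^*](\omega^*,y)}\,\mu(dy)=0$. 2. For every $\omega^*\in\Omega$, $S(\omega^*,y)=\sum_{[\pi]\in\widehat G}S^\pi(\omega^*,y)$ and $Z(\omega^*,y)=\sum_{[\pi]\in\widehat G}Z^\pi(\omega^*,y)$, where the series are orthogonal and convergent in $L^2(\mu(dy))$,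 and therefore $\langle S(\omega^*,\cdot),Z(\omega^*,\cdot)\rangle_{L^2(\mu)}=\sum_{[\pi]\in\widehat G}\langle S^\pi(\omega^*,\cdot),Z^\pi(\omega^*,\cdot)\rangle_{L^2(\mu)}$. 3. If moreover $Z\in L^2(\mathbf{P}(d\omega)\times\mu(dy))$, then $Z^\pi\in L^2(\mathbf{P}(d\omega)\times\mu(dy))$ for every $[\pi]\in\widehat G$, and $Z=\sum_{[\pi]\in\widehat G}Z^\pi$, where the series is orthogonal and convergent in $L^2(\mathbf{P}(d\omega)\times\mu(dy))$.
   Context: $G$ is a compact Hausdorff topological group with a countable basis, Borel $\sigma$-field $\mathcal{G}$, Haar measure $dg$ with $\int_G dg=1$. $\widehat G$ is the set of equivalence classes $[\pi]$ of irreducible (finite-dimensional, unitary) representations of $G$, $d_\pi$ the dimension, $\chi_\pi(g)=\mathrm{Trace}\,\pi(g)$ the character, $e$ the identity. An action of $G$ on $(Y,\mathcal{Y})$ is a $\mathcal{G}\otimes\mathcal{Y}$-measurable map with $(gh)\cdot y=g\cdot(h\cdot y)$; $\mu$ is $G$-invariant if $\int f(y)\mu(dy)=\int f(g\cdot y)\mu(dy)$ for all $f\in L^1(\mu)$, $g\in G$. A $Y$-indexed stochastic process is an $\mathcal{F}\otimes\mathcal{Y}$-measurable map $\Omega\times Y\to\mathbb{C}$. Notation: $Z_*^\pi(g,x_0)=d_\pi\int_G\chi_\pi(h)Z((h^{-1}g)\cdot x_0)\,dh$, $Z_{X_0}^\pi[g](x_0)=Z_*^\pi(g,x_0)$, $Z^\pi(x_0)=Z_*^\pi(e,x_0)=d_\pi\int_G\chi_\pi(g)Z(g^{-1}\cdot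 x_0)\,dg$; same for $S$. *)

theory Defs
  imports "HOL-Probability.Probability" "Jordan_Normal_Form.Matrix"
begin

text \<open>The group G is a type 'g carrying a topology (Hausdorff, second countable, as type
classes in the theorem) together with explicit multiplication, inverse and identity.\<close>

definition compact_group :: "('g::topological_space \<Rightarrow> 'g \<Rightarrow> 'g) \<Rightarrow> ('g \<Rightarrow> 'g) \<Rightarrow> 'g \<Rightarrow> bool" where
  "compact_group mul ginv e \<longleftrightarrow>
     (\<forall>a b c. mul (mul a b) c = mul a (mul b c)) \<and>
     (\<forall>a. mul e a = a \<and> mul a e = a) \<and>
     (\<forall>a. mul (ginv a) a = e \<and> mul a (ginv a) = e) \<and>
     continuous_on UNIV (\<lambda>p. mul (fst p) (snd p)) \<and>
     continuous_on UNIV ginv \<and>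
     compact (UNIV :: 'g set)"

definition normalized_haar :: "('g::topological_space \<Rightarrow> 'g \<Rightarrow> 'g) \<Rightarrow> 'g measure \<Rightarrow> bool" where
  "normalized_haar mul H \<longleftrightarrow>
     sets H = sets borel \<and> prob_space H \<and>
     (\<forall>g. \<forall>A\<in>sets borel. emeasure H ((mul g) ` A) = emeasure H A)"

definition mat_adj :: "complex mat \<Rightarrow> complex mat" where
  "mat_adj A = mat (dim_col A) (dim_row A) (\<lambda>(i,j). cnj (A $$ (j,i)))"

definition mat_trace :: "complex mat \<Rightarrow> complex" where
  "mat_trace A = (\<Sum>i<dim_row A. A $$ (i,i))"

definition unitary_rep :: "('g::topological_space \<Rightarrow> 'g \<Rightarrow> 'g) \<Rightarrow> nat \<Rightarrow> ('g \<Rightarrow> complex mat) \<Rightarrow> bool" where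
  "unitary_rep mul d \<pi> \<longleftrightarrow>
     (\<forall>g. \<pi> g \<in> carrier_mat d d \<and> \<pi> g * mat_adj (\<pi> g) = 1\<^sub>m d) \<and>
     (\<forall>g h. \<pi> (mul g h) = \<pi> g * \<pi> h) \<and>
     (\<forall>i<d. \<forall>j<d. continuous_on UNIV (\<lambda>g. \<pi> g $$ (i,j)))"

definition invariant_subspace :: "nat \<Rightarrow> ('g \<Rightarrow> complex mat) \<Rightarrow> complex vec set \<Rightarrow> bool" where
  "invariant_subspace d \<pi> W \<longleftrightarrow>
     W \<subseteq> carrier_vec d \<and> 0\<^sub>v d \<in> W \<and>
     (\<forall>v\<in>W. \<forall>w\<in>W. v + w \<in> W) \<and>
     (\<forall>a. \<forall>v\<in>W. a \<cdot>\<^sub>v v \<in> W) \<and>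
     (\<forall>g. \<forall>v\<in>W. \<pi> g *\<^sub>v v \<in> W)"

definition irreducible_rep :: "nat \<Rightarrow> ('g \<Rightarrow> complex mat) \<Rightarrow> bool" where
  "irreducible_rep d \<pi> \<longleftrightarrow> d > 0 \<and>
     (\<forall>W. invariant_subspace d \<pi> W \<longrightarrow> W = {0\<^sub>v d} \<or> W = carrier_vec d)"

definition irreps :: "('g::topological_space \<Rightarrow> 'g \<Rightarrow> 'g) \<Rightarrow> (nat \<times> ('g \<Rightarrow> complex mat)) set" where
  "irreps mul = {(d, \<pi>). unitary_rep mul d \<pi> \<and> irreducible_rep d \<pi>}"

definition rep_equiv :: "('g::topological_space \<Rightarrow> 'g \<Rightarrow> 'g) \<Rightarrow> ((nat \<times> ('g \<Rightarrow> complex mat)) \<times> (nat \<times> ('g \<Rightarrow> complex mat))) set" where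
  "rep_equiv mul = {((d1, \<pi>1), (d2, \<pi>2)).
      (d1, \<pi>1) \<in> irreps mul \<and> (d2, \<pi>2) \<in> irreps mul \<and> d1 = d2 \<and>
      (\<exists>T\<in>carrier_mat d1 d1. invertible_mat T \<and> (\<forall>g. T * \<pi>1 g = \<pi>2 g * T))}"

definition unitary_dual :: "('g::topological_space \<Rightarrow> 'g \<Rightarrow> 'g) \<Rightarrow> (nat \<times> ('g \<Rightarrow> complex mat)) set set" where
  "unitary_dual mul = irreps mul // rep_equiv mul"

definition rep_of :: "(nat \<times> ('g \<Rightarrow> complex mat)) set \<Rightarrow> nat \<times> ('g \<Rightarrow> complex mat)" where
  "rep_of c = (SOME p. p \<in> c)"

definition dim_cls :: "(nat \<times> ('g \<Rightarrow> complex mat)) set \<Rightarrow> nat" where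
  "dim_cls c = fst (rep_of c)"

definition char_cls :: "(nat \<times> ('g \<Rightarrow> complex mat)) set \<Rightarrow> 'g \<Rightarrow> complex" where
  "char_cls c g = mat_trace (snd (rep_of c) g)"

definition measurable_action :: "('g \<Rightarrow> 'g \<Rightarrow> 'g) \<Rightarrow> 'g measure \<Rightarrow> ('g \<Rightarrow> 'y \<Rightarrow> 'y) \<Rightarrow> 'y measure \<Rightarrow> bool" where
  "measurable_action mul H act M \<longleftrightarrow>
     (\<lambda>(g, y). act g y) \<in> measurable (H \<Otimes>\<^sub>M M) M \<and>
     (\<forall>g h. \<forall>y\<in>space M. act (mul g h) y = act g (act h y))"

definition invariant_measure :: "('g \<Rightarrow> 'y \<Rightarrow> 'y) \<Rightarrow> 'y measure \<Rightarrow> bool" where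
  "invariant_measure act M \<longleftrightarrow>
     (\<forall>f :: 'y \<Rightarrow> complex. integrable M f \<longrightarrow>
        (\<forall>g. (\<integral>y. f y \<partial>M) = (\<integral>y. f (act g y) \<partial>M)))"

definition square_integrable :: "'a measure \<Rightarrow> ('a \<Rightarrow> complex) \<Rightarrow> bool" where
  "square_integrable M f \<longleftrightarrow> f \<in> borel_measurable M \<and> integrable M (\<lambda>x. (cmod (f x))\<^sup>2)"

definition proj_star ::
  "('g \<Rightarrow> 'g \<Rightarrow> 'g) \<Rightarrow> ('g \<Rightarrow> 'g) \<Rightarrow> 'g measure \<Rightarrow> ('g \<Rightarrow> 'y \<Rightarrow> 'y) \<Rightarrow>
   (nat \<times> ('g \<Rightarrow> complex mat)) set \<Rightarrow> ('w \<Rightarrow> 'y \<Rightarrow> complex) \<Rightarrow> 'g \<Rightarrow> 'w \<Rightarrow> 'y \<Rightarrow> complex" where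
  "proj_star mul ginv H act c Z g \<omega> y =
     of_nat (dim_cls c) * (\<integral>h. char_cls c h * Z \<omega> (act (mul (ginv h) g) y) \<partial>H)"

end

theory Submission
  imports Defs "Jordan_Normal_Form.Spectral_Radius"
begin

text \<open>For \<open>f\<close> in \<open>L\<^sup>2\<close> of an invariant measure, the coefficient \<open>\<phi>(g) = \<langle>f \<circ> g, f\<rangle>\<close> is a continuous function on \<open>G\<close>,
  and \<open>d\<^sub>\<pi> \<chi>\<^sub>\<pi> * \<phi>\<close> is the coefficient of the isotypic component \<open>f\<^sup>\<pi>\<close>. Schur orthogonality makes the operators
  \<open>f \<mapsto> f\<^sup>\<pi>\<close> mutually orthogonal projections, so by Bessel's inequality the coefficients of the finite partial sums of
  \<open>\<Sum>f\<^sup>\<pi>\<close> converge uniformly to a continuous function with the same isotypic components as \<open>\<phi>\<close>. By the Peter-Weyl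
  theorem it is \<open>\<phi>\<close>, and evaluation at \<open>e\<close> gives \<open>\<parallel>f\<parallel>\<^sup>2 = \<Sum>\<parallel>f\<^sup>\<pi>\<parallel>\<^sup>2\<close>. Applied to \<open>(Y, \<mu>)\<close> this gives the expansions in
  \<open>L\<^sup>2(\<mu>)\<close>, and applied to \<open>(\<Omega> \<times> Y, P \<times> \<mu>)\<close> the expansion in \<open>L\<^sup>2(P \<times> \<mu>)\<close>.

  For Peter-Weyl, let \<open>\<phi>\<close> be a nonzero continuous function annihilated by all characters. The normalised convolution
  powers of \<open>\<phi> * \<phi>\<^sup>*\<close> converge to an idempotent \<open>p\<close>, also annihilated by all characters. The functions
  reproduced by \<open>p\<close> form a finite-dimensional translation invariant space, and a minimal invariant subspace of it
  carries an irreducible representation whose character does not annihilate it, a contradiction.\<close>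

section \<open>Square integrable functions\<close>

text \<open>An \<open>L\<^sup>2(\<mu>)\<close>-limit has no value at a point, so the convergence
  question is moved from the space, which carries only a measure, to the compact group. Since the
  coefficient of \<open>u\<close> against \<open>f\<close> is bounded by
  \<open>\<parallel>u\<parallel> \<parallel>f\<parallel>\<close> at every group element, norm
  convergence of partial sums becomes uniform convergence on \<open>G\<close>; this preserves
  continuity and gives evaluation at \<open>e\<close> a meaning. Once
  \<open>\<parallel>f\<parallel>\<^sup>2 = \<Sum>\<parallel>f\<^sup>\<pi>\<parallel>\<^sup>2\<close>
  is known, the expansion follows: the squared distance from \<open>f\<close> to a finite partial
  sum is exactly the missing part of this series.

  Continuity of the coefficients is the measure-theoretic obstacle. It is obtained first for left
  translation on \<open>L\<^sup>2(G)\<close>, starting from indicators of open sets, and then for an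
  arbitrary action by averaging over orbits.

  In the Peter-Weyl step \<open>\<phi> * \<phi>\<^sup>*\<close> is taken because it is self-adjoint
  and has the value \<open>\<parallel>\<phi>\<parallel>\<^sup>2\<close> at \<open>e\<close>. The
  idempotent obtained from it acts as a reproducing kernel, and this is what forces finite
  dimension.\<close>

definition l2_inner :: "'a measure \<Rightarrow> ('a \<Rightarrow> complex) \<Rightarrow> ('a \<Rightarrow> complex) \<Rightarrow> complex" where
  "l2_inner M f g = (\<integral>x. f x * cnj (g x) \<partial>M)"

definition l2_sq :: "'a measure \<Rightarrow> ('a \<Rightarrow> complex) \<Rightarrow> real" where
  "l2_sq M f = (\<integral>x. (cmod (f x))\<^sup>2 \<partial>M)"

lemma L2_measurable[measurable_dest]:
  "square_integrable M f \<Longrightarrow> f \<in> borel_measurable M"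
  by (simp add: square_integrable_def)

lemma borel_measurable_cnj[measurable]: "cnj \<in> borel_measurable borel"
  by (intro borel_measurable_continuous_onI continuous_intros)

lemma cmod_mult_le_squares: "cmod (a * b) \<le> (cmod a)\<^sup>2 + (cmod b)\<^sup>2"
proof -
  have "0 \<le> (cmod a - cmod b)\<^sup>2" by simp
  then have "2 * (cmod a * cmod b) \<le> (cmod a)\<^sup>2 + (cmod b)\<^sup>2"
    by (simp add: power2_eq_square algebra_simps)
  moreover have "0 \<le> cmod a * cmod b" by simp
  ultimately show ?thesis unfolding norm_mult by linarith
qed

lemma cmod_add_squares: "(cmod (a + b))\<^sup>2 \<le> 2 * (cmod a)\<^sup>2 + 2 * (cmod b)\<^sup>2"
proof -
  have "(cmod (a + b))\<^sup>2 \<le> (cmod a + cmod b)\<^sup>2"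
    by (simp add: norm_triangle_ineq power_mono)
  also have "\<dots> \<le> 2 * (cmod a)\<^sup>2 + 2 * (cmod b)\<^sup>2"
    using sum_squares_bound[of "cmod a" "cmod b"] by (simp add: power2_sum)
  finally show ?thesis .
qed

lemma integrable_l2_inner:
  assumes "square_integrable M f" "square_integrable M g"
  shows "integrable M (\<lambda>x. f x * cnj (g x))"
proof (rule Bochner_Integration.integrable_bound)
  show "integrable M (\<lambda>x. (cmod (f x))\<^sup>2 + (cmod (g x))\<^sup>2)"
    using assms by (auto simp: square_integrable_def)
  show "(\<lambda>x. f x * cnj (g x)) \<in> borel_measurable M"
    using assms by measurable
  show "AE x in M. norm (f x * cnj (g x)) \<le> norm ((cmod (f x))\<^sup>2 + (cmod (g x))\<^sup>2)"
    using cmod_mult_le_squares[of "f _" "cnj (g _)"] by (auto simp: abs_of_nonneg)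
qed

lemma L2_add:
  assumes "square_integrable M f" "square_integrable M g"
  shows "square_integrable M (\<lambda>x. f x + g x)"
proof -
  have [measurable]: "f \<in> borel_measurable M" "g \<in> borel_measurable M"
    using assms by (auto simp: square_integrable_def)
  have "integrable M (\<lambda>x. (cmod (f x + g x))\<^sup>2)"
  proof (rule Bochner_Integration.integrable_bound)
    show "integrable M (\<lambda>x. 2 * (cmod (f x))\<^sup>2 + 2 * (cmod (g x))\<^sup>2)"
      using assms by (auto simp: square_integrable_def)
    show "AE x in M. norm ((cmod (f x + g x))\<^sup>2) \<le> norm (2 * (cmod (f x))\<^sup>2 + 2 * (cmod (g x))\<^sup>2)"
      using cmod_add_squares[of "f _" "g _"] by (auto simp: abs_of_nonneg)
  qed measurable
  then show ?thesis by (simp add: square_integrable_def)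
qed

lemma L2_scale:
  assumes "square_integrable M f"
  shows "square_integrable M (\<lambda>x. a * f x)"
  using assms by (auto simp: square_integrable_def norm_mult power_mult_distrib)

lemma L2_zero: "square_integrable M (\<lambda>x. 0)"
  by (simp add: square_integrable_def)

lemma L2_diff:
  assumes "square_integrable M f" "square_integrable M g"
  shows "square_integrable M (\<lambda>x. f x - g x)"
  using L2_add[OF assms(1) L2_scale[OF assms(2), of "-1"]] by simp

lemma L2_sum:
  assumes "\<And>i. i \<in> I \<Longrightarrow> square_integrable M (f i)"
  shows "square_integrable M (\<lambda>x. \<Sum>i\<in>I. f i x)"
  using assms
  by (induction I rule: infinite_finite_induct)
    (auto simp: L2_zero intro!: L2_add)

lemma l2_inner_cong: "(\<And>x. x \<in> space M \<Longrightarrow> f x = f' x) \<Longrightarrow> (\<And>x. x \<in> space M \<Longrightarrow> g x = g' x)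
    \<Longrightarrow> l2_inner M f g = l2_inner M f' g'"
  unfolding l2_inner_def by (rule Bochner_Integration.integral_cong) auto

lemma l2_inner_cong_AE:
  assumes "square_integrable M f" "square_integrable M g" "f' \<in> borel_measurable M"
    "g' \<in> borel_measurable M" "AE x in M. f x = f' x" "AE x in M. g x = g' x"
  shows "l2_inner M f g = l2_inner M f' g'"
  unfolding l2_inner_def
proof (rule integral_cong_AE)
  show "AE x in M. f x * cnj (g x) = f' x * cnj (g' x)" using assms(5,6) by eventually_elim auto
qed (use assms in \<open>auto simp: square_integrable_def\<close>)

lemma l2_inner_cnj: "cnj (l2_inner M f g) = l2_inner M g f"
  unfolding l2_inner_def by (subst Bochner_Integration.integral_cnj[symmetric]) (simp add: mult.commute)

lemma l2_inner_self: "l2_inner M f f = of_real (l2_sq M f)"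
  unfolding l2_inner_def l2_sq_def
  by (simp add: complex_norm_square del: of_real_power flip: integral_complex_of_real)

lemma l2_inner_add_left:
  assumes "square_integrable M f" "square_integrable M f'" "square_integrable M g"
  shows "l2_inner M (\<lambda>x. f x + f' x) g = l2_inner M f g + l2_inner M f' g"
  unfolding l2_inner_def using assms by (simp add: algebra_simps integrable_l2_inner)

lemma l2_inner_diff_left:
  assumes "square_integrable M f" "square_integrable M f'" "square_integrable M g"
  shows "l2_inner M (\<lambda>x. f x - f' x) g = l2_inner M f g - l2_inner M f' g"
  unfolding l2_inner_def using assms by (simp add: algebra_simps integrable_l2_inner)

lemma l2_inner_scale_left: "l2_inner M (\<lambda>x. a * f x) g = a * l2_inner M f g"
  unfolding l2_inner_def by (simp add: mult.assoc)

lemma l2_inner_sum_left: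
  assumes "\<And>i. i \<in> I \<Longrightarrow> square_integrable M (f i)" "square_integrable M g"
  shows "l2_inner M (\<lambda>x. \<Sum>i\<in>I. f i x) g = (\<Sum>i\<in>I. l2_inner M (f i) g)"
  unfolding l2_inner_def using assms
  by (simp add: sum_distrib_right integrable_l2_inner)

lemma l2_inner_diff_right:
  assumes "square_integrable M f" "square_integrable M f'" "square_integrable M g"
  shows "l2_inner M g (\<lambda>x. f x - f' x) = l2_inner M g f - l2_inner M g f'"
  unfolding l2_inner_def using assms by (simp add: algebra_simps integrable_l2_inner)

lemma l2_inner_scale_right: "l2_inner M f (\<lambda>x. a * g x) = cnj a * l2_inner M f g"
  using l2_inner_scale_left[of M a g f] by (metis complex_cnj_mult l2_inner_cnj)

lemma l2_inner_sum_right: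
  assumes "\<And>i. i \<in> I \<Longrightarrow> square_integrable M (f i)" "square_integrable M g"
  shows "l2_inner M g (\<lambda>x. \<Sum>i\<in>I. f i x) = (\<Sum>i\<in>I. l2_inner M g (f i))"
  unfolding l2_inner_def using assms
  by (simp add: sum_distrib_left integrable_l2_inner)

lemma l2_sq_nonneg: "0 \<le> l2_sq M f"
  unfolding l2_sq_def by simp

lemma l2_sq_diff_expand:
  assumes "square_integrable M f" "square_integrable M g"
  shows "l2_sq M (\<lambda>x. f x - g x) = l2_sq M f + l2_sq M g - 2 * Re (l2_inner M f g)"
proof -
  have "complex_of_real (l2_sq M (\<lambda>x. f x - g x))
      = l2_inner M f f - l2_inner M g f - (l2_inner M f g - l2_inner M g g)"
    using assms by (simp add: L2_diff l2_inner_diff_left l2_inner_diff_right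
        flip: l2_inner_self)
  also have "\<dots> = of_real (l2_sq M f + l2_sq M g) - (l2_inner M f g + cnj (l2_inner M f g))"
    by (simp add: l2_inner_self l2_inner_cnj)
  also have "\<dots> = of_real (l2_sq M f + l2_sq M g - 2 * Re (l2_inner M f g))"
    by (simp add: complex_add_cnj)
  finally show ?thesis by (simp only: of_real_eq_iff)
qed

lemma l2_Cauchy_Schwarz_abs:
  assumes "square_integrable M f" "square_integrable M g"
  shows "(\<integral>x. cmod (f x) * cmod (g x) \<partial>M)\<^sup>2 \<le> l2_sq M f * l2_sq M g"
proof -
  have [measurable]: "f \<in> borel_measurable M" "g \<in> borel_measurable M"
    using assms by (auto simp: square_integrable_def)
  let ?b = "\<integral>x. cmod (f x) * cmod (g x) \<partial>M"
  have int: "integrable M (\<lambda>x. cmod (f x) * cmod (g x))"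
    using integrable_norm[OF integrable_l2_inner[OF assms]] by (simp add: norm_mult)
  \<comment> \<open>With absolute values everything is real, and Cauchy-Schwarz is the discriminant
    condition of this quadratic in \<open>t\<close>.\<close>
  have quad: "0 \<le> l2_sq M f + t\<^sup>2 * l2_sq M g - 2 * t * ?b" for t
  proof -
    have "0 \<le> (\<integral>x. (cmod (f x) - t * cmod (g x))\<^sup>2 \<partial>M)" by simp
    also have "\<dots> = (\<integral>x. (cmod (f x))\<^sup>2 + t\<^sup>2 * (cmod (g x))\<^sup>2 - 2 * t * (cmod (f x) * cmod (g x)) \<partial>M)"
      by (simp add: power2_eq_square algebra_simps)
    also have "\<dots> = l2_sq M f + t\<^sup>2 * l2_sq M g - 2 * t * ?b"
      unfolding l2_sq_def using assms int by (simp add: square_integrable_def)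
    finally show ?thesis .
  qed
  show ?thesis
  proof (cases "l2_sq M g = 0")
    case True
    have "?b = 0"
    proof (rule ccontr)
      assume "?b \<noteq> 0"
      \<comment> \<open>With \<open>l2_sq M g = 0\<close> the quadratic is affine in
        \<open>t\<close>, and this \<open>t\<close> gives it the value -1.\<close>
      then show False using quad[of "(l2_sq M f + 1) / (2 * ?b)"] True by simp
    qed
    then show ?thesis using True by simp
  next
    case False
    then have pos: "l2_sq M g > 0" using l2_sq_nonneg[of M g] by simp
    have "(?b / l2_sq M g)\<^sup>2 * l2_sq M g = ?b\<^sup>2 / l2_sq M g"
      "2 * (?b / l2_sq M g) * ?b = 2 * (?b\<^sup>2 / l2_sq M g)"
      using False by (simp_all add: power2_eq_square)
    with quad[of "?b / l2_sq M g"] have "0 \<le> l2_sq M f - ?b\<^sup>2 / l2_sq M g"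
      by linarith
    then show ?thesis using pos by (simp add: field_simps)
  qed
qed

lemma l2_Cauchy_Schwarz:
  assumes "square_integrable M f" "square_integrable M g"
  shows "(cmod (l2_inner M f g))\<^sup>2 \<le> l2_sq M f * l2_sq M g"
proof -
  have "cmod (l2_inner M f g) \<le> (\<integral>x. cmod (f x) * cmod (g x) \<partial>M)"
    unfolding l2_inner_def using integral_norm_bound[of M "\<lambda>x. f x * cnj (g x)"]
    by (simp add: norm_mult)
  then have "(cmod (l2_inner M f g))\<^sup>2 \<le> (\<integral>x. cmod (f x) * cmod (g x) \<partial>M)\<^sup>2"
    by (simp add: power_mono)
  then show ?thesis using l2_Cauchy_Schwarz_abs[OF assms] by linarith
qed

lemma l2_Cauchy_Schwarz_sqrt:
  assumes "square_integrable M f" "square_integrable M g"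
  shows "cmod (l2_inner M f g) \<le> sqrt (l2_sq M f * l2_sq M g)"
  by (rule real_le_rsqrt[OF l2_Cauchy_Schwarz[OF assms]])

lemma l2_sq_zero_inner:
  assumes "square_integrable M f" "square_integrable M g" "l2_sq M f = 0"
  shows "l2_inner M f g = 0"
  using l2_Cauchy_Schwarz[OF assms(1,2)] assms(3) by simp

lemma (in finite_measure) bounded_L2:
  assumes [measurable]: "f \<in> borel_measurable M" and "\<And>x. x \<in> space M \<Longrightarrow> cmod (f x) \<le> B"
  shows "square_integrable M f"
proof -
  have "integrable M (\<lambda>x. (cmod (f x))\<^sup>2)"
    by (rule integrable_const_bound[where B = "B\<^sup>2"]) (use assms(2) in \<open>auto simp: power_mono\<close>)
  then show ?thesis by (simp add: square_integrable_def)
qed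

lemma L2_integrable:
  assumes "finite_measure M" "square_integrable M f"
  shows "integrable M f"
proof -
  interpret finite_measure M by fact
  have "square_integrable M (\<lambda>x. 1)" by (rule bounded_L2[of _ 1]) auto
  from integrable_l2_inner[OF assms(2) this] show ?thesis by simp
qed

section \<open>Haar measure\<close>

locale haar_group =
  fixes mul :: "'g::{t2_space, second_countable_topology} \<Rightarrow> 'g \<Rightarrow> 'g"
    and ginv :: "'g \<Rightarrow> 'g" and e :: 'g and H :: "'g measure"
  assumes compact_group: "compact_group mul ginv e"
    and haar: "normalized_haar mul H"
begin

lemma mul_assoc: "mul (mul a b) c = mul a (mul b c)"
  and mul_e[simp]: "mul e a = a" "mul a e = a"
  and mul_ginv[simp]: "mul (ginv a) a = e" "mul a (ginv a) = e"
  and continuous_mul: "continuous_on UNIV (\<lambda>p. mul (fst p) (snd p))"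
  and continuous_ginv: "continuous_on UNIV ginv"
  and compact_UNIV_group: "compact (UNIV :: 'g set)"
  using compact_group by (auto simp: compact_group_def)

lemma mul_ginv_cancel[simp]: "mul (ginv a) (mul a b) = b" "mul a (mul (ginv a) b) = b"
  by (simp_all flip: mul_assoc)

lemma mul_ginv_cancel_right[simp]: "mul (mul b a) (ginv a) = b" "mul (mul b (ginv a)) a = b"
  by (simp_all add: mul_assoc)

lemma ginv_unique: "mul a b = e \<Longrightarrow> ginv a = b"
  by (metis mul_ginv_cancel(1) mul_e(2))

lemma ginv_ginv[simp]: "ginv (ginv a) = a"
  by (rule ginv_unique) simp

lemma ginv_mul: "ginv (mul a b) = mul (ginv b) (ginv a)"
  by (rule ginv_unique) (metis mul_assoc mul_ginv(2) mul_ginv_cancel(2))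

lemma ginv_e[simp]: "ginv e = e"
  by (rule ginv_unique) simp

lemma continuous_on_mul[continuous_intros]:
  assumes "continuous_on A f" "continuous_on A g"
  shows "continuous_on A (\<lambda>x. mul (f x) (g x))"
  using continuous_on_compose2[OF continuous_mul continuous_on_Pair[OF assms]] by simp

lemma continuous_on_ginv[continuous_intros]:
  assumes "continuous_on A f"
  shows "continuous_on A (\<lambda>x. ginv (f x))"
  using continuous_on_compose2[OF continuous_ginv assms] by simp

abbreviation cts :: "('g \<Rightarrow> 'b::topological_space) \<Rightarrow> bool" where
  "cts f \<equiv> continuous_on UNIV f"

abbreviation Ghat where "Ghat \<equiv> unitary_dual mul"

lemma sets_H[measurable_cong]: "sets H = sets borel"
  using haar by (simp add: normalized_haar_def)

lemma space_H[simp]: "space H = UNIV"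
  using sets_eq_imp_space_eq[OF sets_H] by simp

sublocale H: prob_space H
  using haar by (simp add: normalized_haar_def)

lemma emeasure_H_UNIV[simp]: "emeasure H UNIV = 1"
  using H.emeasure_space_1 by simp

lemma measurable_H: "measurable H M = measurable borel M" "measurable M H = measurable M borel"
  by (rule measurable_cong_sets; simp add: sets_H)+

lemma measurable_ginv[measurable]: "ginv \<in> measurable borel borel"
  by (intro borel_measurable_continuous_onI continuous_intros)

lemma measurable_mul[measurable]:
  "(\<lambda>p. mul (fst p) (snd p)) \<in> measurable (borel \<Otimes>\<^sub>M borel) borel"
  unfolding borel_prod by (rule borel_measurable_continuous_onI[OF continuous_mul])

lemma measurable_mul'[measurable (raw)]:
  assumes [measurable]: "f \<in> measurable M borel" "g \<in> measurable M borel"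
  shows "(\<lambda>x. mul (f x) (g x)) \<in> measurable M borel"
  using measurable_compose[OF measurable_Pair[OF assms] measurable_mul] by simp

lemma continuous_measurable_H: "cts f \<Longrightarrow> f \<in> borel_measurable H"
  for f :: "'g \<Rightarrow> 'b::topological_space"
  unfolding measurable_H by (rule borel_measurable_continuous_onI)

lemma distr_mul_left: "distr H H (mul g) = H"
proof (rule measure_eqI)
  fix A assume A: "A \<in> sets (distr H H (mul g))"
  \<comment> \<open>\<open>normalized_haar\<close> speaks of images and \<open>distr\<close> of
    preimages; the inverse translation converts one into the other.\<close>
  have "mul g -` A = mul (ginv g) ` A"
    by (auto simp: image_iff) (metis mul_ginv_cancel(1))
  then show "emeasure (distr H H (mul g)) A = emeasure H A"
    using A haar by (simp add: emeasure_distr normalized_haar_def sets_H)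
qed simp

text \<open>Integrating \<open>1\<^sub>A (x y)\<close> against the product of the image of \<open>H\<close> under inversion (which is
  right invariant) with \<open>H\<close> in both orders identifies the two measures.\<close>

lemma distr_ginv: "distr H H ginv = H"
proof (rule measure_eqI)
  fix A assume "A \<in> sets (distr H H ginv)"
  then have A[measurable]: "A \<in> sets borel" by (simp add: sets_H)
  have left: "(\<integral>\<^sup>+x. f (mul g x) \<partial>H) = (\<integral>\<^sup>+x. f x \<partial>H)" if [measurable]: "f \<in> borel_measurable borel"
    for f :: "'g \<Rightarrow> ennreal" and g
    by (subst (2) distr_mul_left[of g, symmetric], subst nn_integral_distr) auto
  interpret HH: pair_sigma_finite H H ..
  let ?F = "\<lambda>x y. indicator A (mul (ginv x) y) :: ennreal"
  have "emeasure (distr H H ginv) A = (\<integral>\<^sup>+x. indicator A (ginv x) \<partial>H)"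
    by (subst nn_integral_indicator[symmetric], simp add: sets_H, subst nn_integral_distr) auto
  also have "\<dots> = (\<integral>\<^sup>+y. (\<integral>\<^sup>+x. indicator A (ginv x) \<partial>H) \<partial>H)"
    by (simp)
  also have "\<dots> = (\<integral>\<^sup>+y. (\<integral>\<^sup>+x. ?F x y \<partial>H) \<partial>H)"
  proof (rule nn_integral_cong)
    fix y
    show "(\<integral>\<^sup>+x. indicator A (ginv x) \<partial>H) = (\<integral>\<^sup>+x. ?F x y \<partial>H)"
      using left[of "\<lambda>x. indicator A (ginv x)" "ginv y"] by (simp add: ginv_mul)
  qed
  also have "\<dots> = (\<integral>\<^sup>+x. (\<integral>\<^sup>+y. ?F x y \<partial>H) \<partial>H)"
    by (rule HH.Fubini') measurable
  also have "\<dots> = (\<integral>\<^sup>+x. emeasure H A \<partial>H)"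
    by (rule nn_integral_cong, subst left) (auto simp: sets_H)
  also have "\<dots> = emeasure H A" by (simp)
  finally show "emeasure (distr H H ginv) A = emeasure H A" .
qed simp

text \<open>Since \<open>mul x g = ginv (mul (ginv g) (ginv x))\<close>, right translation is a left
  translation conjugated by inversion, and both of these preserve \<open>H\<close>.\<close>

lemma distr_mul_right: "distr H H (\<lambda>x. mul x g) = H"
proof -
  have "distr H H (\<lambda>x. mul x g) = distr (distr H H ginv) H (\<lambda>x. mul x g)"
    by (simp add: distr_ginv)
  also have "\<dots> = distr H H (\<lambda>x. ginv (mul (ginv g) x))"
    by (subst distr_distr) (auto simp: o_def ginv_mul)
  also have "\<dots> = distr (distr H H (mul (ginv g))) H ginv"
    by (subst distr_distr) (auto simp: o_def)
  finally show ?thesis by (simp add: distr_mul_left distr_ginv)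
qed

lemma
  fixes f :: "'g \<Rightarrow> 'b::{banach, second_countable_topology}"
  assumes [measurable]: "f \<in> borel_measurable H"
  shows integral_mul_left: "(\<integral>x. f (mul g x) \<partial>H) = (\<integral>x. f x \<partial>H)"
    and integral_mul_right: "(\<integral>x. f (mul x g) \<partial>H) = (\<integral>x. f x \<partial>H)"
    and integral_ginv: "(\<integral>x. f (ginv x) \<partial>H) = (\<integral>x. f x \<partial>H)"
proof -
  show "(\<integral>x. f (mul g x) \<partial>H) = (\<integral>x. f x \<partial>H)"
    by (subst (2) distr_mul_left[of g, symmetric], subst integral_distr) auto
  show "(\<integral>x. f (mul x g) \<partial>H) = (\<integral>x. f x \<partial>H)"
    by (subst (2) distr_mul_right[of g, symmetric], subst integral_distr) auto
  show "(\<integral>x. f (ginv x) \<partial>H) = (\<integral>x. f x \<partial>H)"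
    by (subst (2) distr_ginv[symmetric], subst integral_distr) auto
qed

text \<open>Compactness covers the group by finitely many translates of \<open>U\<close>, all with
  the measure of \<open>U\<close>; if that were 0, the total mass could not be 1. It makes
  continuous functions insensitive to null sets.\<close>

lemma haar_open_pos:
  assumes "open U" "U \<noteq> {}"
  shows "emeasure H U > 0"
proof (rule ccontr)
  assume "\<not> emeasure H U > 0"
  then have U0: "emeasure H U = 0" by simp
  obtain u where u: "u \<in> U" using assms by blast
  have op: "open (mul g ` U)" for g
  proof -
    have "mul g ` U = mul (ginv g) -` U"
      by (auto simp: image_iff) (metis mul_ginv_cancel(2))
    moreover have "open (mul (ginv g) -` U)"
      by (rule open_vimage[OF assms(1)]) (intro continuous_intros)
    ultimately show ?thesis by simp
  qed
  have cover: "UNIV \<subseteq> (\<Union>g. mul g ` U)"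
  proof
    fix x
    have "x = mul (mul x (ginv u)) u" by simp
    then show "x \<in> (\<Union>g. mul g ` U)" using u by blast
  qed
  obtain C where C: "finite C" "UNIV \<subseteq> (\<Union>g\<in>C. mul g ` U)"
    by (rule compactE_image[OF compact_UNIV_group op cover])
  have "emeasure H UNIV \<le> emeasure H (\<Union>g\<in>C. mul g ` U)"
    by (rule emeasure_mono[OF C(2)]) (use op C in \<open>auto simp: sets_H\<close>)
  also have "\<dots> \<le> (\<Sum>g\<in>C. emeasure H (mul g ` U))"
    by (rule emeasure_subadditive_finite) (use op C in \<open>auto simp: sets_H\<close>)
  also have "\<dots> = 0"
    using haar assms U0 by (simp add: normalized_haar_def)
  finally show False by simp
qed

lemma continuous_AE_zero:
  fixes f :: "'g \<Rightarrow> 'b::{t1_space, zero}"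
  assumes "cts f" "AE x in H. f x = 0"
  shows "f x = 0"
proof (rule ccontr)
  assume x: "f x \<noteq> 0"
  have op: "open (f -` (-{0}))"
    using assms(1) by (intro open_vimage) auto
  have "f -` (-{0}) = {x \<in> space H. f x \<noteq> 0}" by auto
  then have "emeasure H (f -` (-{0})) = 0"
    using emeasure_eq_0_AE[of "\<lambda>x. f x \<noteq> 0" H] assms(2) by simp
  with haar_open_pos[OF op] x show False by auto
qed

lemma continuous_bounded:
  fixes f :: "'g \<Rightarrow> 'b::real_normed_vector"
  assumes "cts f"
  obtains B where "B > 0" "\<And>x. norm (f x) \<le> B"
proof -
  have "bounded (range f)"
    using compact_continuous_image[OF assms compact_UNIV_group] compact_imp_bounded by blast
  then show ?thesis using that by (metis bounded_pos rangeI)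
qed

lemma continuous_L2:
  assumes "cts f"
  shows "square_integrable H f"
proof -
  obtain B where "\<And>x. cmod (f x) \<le> B" using continuous_bounded[OF assms] by blast
  then show ?thesis
    by (intro H.bounded_L2 continuous_measurable_H assms)
qed

lemma continuous_integrable:
  fixes f :: "'g \<Rightarrow> 'b::{banach, second_countable_topology}"
  assumes "cts f"
  shows "integrable H f"
proof -
  obtain B where "\<And>x. norm (f x) \<le> B" using continuous_bounded[OF assms] by blast
  then show ?thesis
    by (intro H.integrable_const_bound[where B = B] continuous_measurable_H assms) auto
qed

lemma l2_sq_zero_continuous:
  assumes "cts f" "l2_sq H f = 0"
  shows "f x = 0"
proof -
  have "AE x in H. (cmod (f x))\<^sup>2 = 0"
    using assms continuous_L2[OF assms(1)]
    unfolding l2_sq_def square_integrable_def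
    by (subst (asm) integral_nonneg_eq_0_iff_AE) auto
  then have "AE x in H. f x = 0" by simp
  with continuous_AE_zero[OF assms(1)] show ?thesis .
qed

end

text \<open>First countability reduces continuity to sequences, where dominated convergence applies.
  Continuity of the integrand is asked only for almost every \<open>y\<close> because in
  \<open>continuous_coef\<close> the orbit functions are square integrable only almost
  everywhere.\<close>

lemma continuous_on_integral_dominated:
  fixes F :: "'a::first_countable_topology \<Rightarrow> 'b \<Rightarrow> 'c::{banach, second_countable_topology}"
  assumes meas: "\<And>x. F x \<in> borel_measurable M" and w: "integrable M w"
    and cont: "AE y in M. continuous_on UNIV (\<lambda>x. F x y)"
    and bound: "\<And>x. AE y in M. norm (F x y) \<le> w y"
  shows "continuous_on UNIV (\<lambda>x. \<integral>y. F x y \<partial>M)"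
proof -
  have "((\<lambda>x. \<integral>y. F x y \<partial>M) \<longlongrightarrow> (\<integral>y. F a y \<partial>M)) (at a within UNIV)" for a
    unfolding tendsto_at_iff_sequentially
  proof (intro allI impI)
    fix X :: "nat \<Rightarrow> 'a" assume X: "\<forall>i. X i \<in> UNIV - {a}" "X \<longlonglongrightarrow> a"
    have "(\<lambda>i. \<integral>y. F (X i) y \<partial>M) \<longlonglongrightarrow> (\<integral>y. F a y \<partial>M)"
    proof (rule integral_dominated_convergence[OF meas meas w])
      show "AE y in M. (\<lambda>i. F (X i) y) \<longlonglongrightarrow> F a y"
        using cont
      proof eventually_elim
        case (elim y)
        then have "((\<lambda>x. F x y) \<longlongrightarrow> F a y) (at a)" by (simp add: continuous_on_def)
        then show ?case
          using X by (subst (asm) tendsto_at_iff_sequentially) (auto simp: o_def)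
      qed
      show "AE y in M. norm (F (X i) y) \<le> w y" for i by (rule bound)
    qed
    then show "((\<lambda>x. \<integral>y. F x y \<partial>M) \<circ> X) \<longlonglongrightarrow> (\<integral>y. F a y \<partial>M)" by (simp add: o_def)
  qed
  then show ?thesis by (simp add: continuous_on_def)
qed

section \<open>Density of the continuous functions\<close>

lemma l2_sq_dominated_tendsto:
  assumes u: "square_integrable M u" and v: "\<And>n::nat. square_integrable M (v n)"
    and w: "square_integrable M w"
    and bd: "\<And>x. x \<in> space M \<Longrightarrow> cmod (u x) \<le> cmod (w x)"
      "\<And>n x. x \<in> space M \<Longrightarrow> cmod (v n x) \<le> cmod (w x)"
    and lim: "\<And>x. x \<in> space M \<Longrightarrow> (\<lambda>n. v n x) \<longlonglongrightarrow> u x"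
  shows "(\<lambda>n. l2_sq M (\<lambda>x. u x - v n x)) \<longlonglongrightarrow> 0"
proof -
  have [measurable]: "u \<in> borel_measurable M" "v n \<in> borel_measurable M" for n
    using u v by (auto simp: square_integrable_def)
  have "(\<lambda>n. \<integral>x. (cmod (u x - v n x))\<^sup>2 \<partial>M) \<longlonglongrightarrow> (\<integral>x. 0 \<partial>M)"
  proof (rule integral_dominated_convergence)
    show "integrable M (\<lambda>x. 4 * (cmod (w x))\<^sup>2)" using w by (simp add: square_integrable_def)
    show "AE x in M. (\<lambda>n. (cmod (u x - v n x))\<^sup>2) \<longlonglongrightarrow> 0"
    proof (rule AE_I2)
      fix x assume "x \<in> space M"
      then have "(\<lambda>n. (cmod (u x - v n x))\<^sup>2) \<longlonglongrightarrow> (cmod (u x - u x))\<^sup>2"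
        by (intro tendsto_intros lim)
      then show "(\<lambda>n. (cmod (u x - v n x))\<^sup>2) \<longlonglongrightarrow> 0" by simp
    qed
    show "AE x in M. norm ((cmod (u x - v n x))\<^sup>2) \<le> 4 * (cmod (w x))\<^sup>2" for n
    proof (rule AE_I2)
      fix x assume x: "x \<in> space M"
      have "cmod (u x - v n x) \<le> 2 * cmod (w x)"
        using norm_triangle_ineq4[of "u x" "v n x"] bd(1)[OF x] bd(2)[OF x, of n] by simp
      then have "(cmod (u x - v n x))\<^sup>2 \<le> (2 * cmod (w x))\<^sup>2" by (intro power_mono) auto
      then show "norm ((cmod (u x - v n x))\<^sup>2) \<le> 4 * (cmod (w x))\<^sup>2" by (simp add: power_mult_distrib)
    qed
  qed measurable
  then show ?thesis by (simp add: l2_sq_def)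
qed

lemma continuous_on_uniform_approx:
  fixes f :: "'a::topological_space \<Rightarrow> 'b::metric_space"
  assumes "\<And>\<epsilon>::real. \<epsilon> > 0 \<Longrightarrow> \<exists>h. continuous_on A h \<and> (\<forall>x\<in>A. dist (h x) (f x) < \<epsilon>)"
  shows "continuous_on A f"
proof -
  obtain h where h: "\<And>n::nat. continuous_on A (h n)" "\<And>n x. x \<in> A \<Longrightarrow> dist (h n x) (f x) < inverse (real (Suc n))"
    using assms[of "inverse (real (Suc _))"] by (metis inverse_positive_iff_positive of_nat_0_less_iff zero_less_Suc)
  have "uniform_limit A h f sequentially"
  proof (rule uniform_limitI)
    fix \<epsilon> :: real assume "\<epsilon> > 0"
    then obtain N where N: "inverse (real (Suc N)) < \<epsilon>" using reals_Archimedean by blast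
    show "\<forall>\<^sub>F n in sequentially. \<forall>x\<in>A. dist (h n x) (f x) < \<epsilon>"
    proof (rule eventually_sequentiallyI, intro ballI)
      fix n x assume "n \<ge> N" "x \<in> A"
      have "dist (h n x) (f x) < inverse (real (Suc n))" by (rule h(2)) fact
      also have "\<dots> \<le> inverse (real (Suc N))" using \<open>n \<ge> N\<close> by (simp add: field_simps)
      finally show "dist (h n x) (f x) < \<epsilon>" using N by simp
    qed
  qed
  then show ?thesis
    by (rule uniform_limit_theorem[rotated]) (use h in auto)
qed

context haar_group
begin

lemma normal_space_group: "normal_space (euclidean :: 'g topology)"
  by (intro compact_Hausdorff_or_regular_imp_normal_space disjI1)
    (auto simp: compact_space_def compact_UNIV_group Hausdorff_space_def disjnt_def, meson hausdorff)

text \<open>Normality gives each point of \<open>U\<close> a basic neighbourhood whose closure stays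
  in \<open>U\<close>, and there are only countably many basic sets. Finite unions of their closures
  make the sequence increasing.\<close>

lemma open_countable_union_closed:
  assumes "open (U :: 'g set)"
  obtains K :: "nat \<Rightarrow> 'g set" where "\<And>n. closed (K n)" "\<And>n. K n \<subseteq> U" "(\<Union>n. K n) = U" "incseq K"
proof -
  obtain B :: "'g set set" where B: "countable B" "topological_basis B"
    using ex_countable_basis by blast
  define C where "C = {b \<in> B. closure b \<subseteq> U}"
  have cover: "U \<subseteq> (\<Union>b\<in>C. closure b)"
  proof
    fix x assume x: "x \<in> U"
    have "closedin euclidean {x}" "closedin euclidean (-U)" "disjnt {x} (-U)"
      using assms x by (auto simp: closed_Compl disjnt_def)
    then obtain V W where VW: "open V" "open W" "x \<in> V" "-U \<subseteq> W" "disjnt V W"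
      using normal_space_group unfolding normal_space_def by (metis insert_subset open_openin)
    obtain b where b: "b \<in> B" "x \<in> b" "b \<subseteq> V"
      using B(2) VW by (meson topological_basisE)
    have "closure b \<subseteq> -W"
      using b VW by (intro closure_minimal) (auto simp: disjnt_def)
    then have "b \<in> C" using b VW by (auto simp: C_def)
    then show "x \<in> (\<Union>b\<in>C. closure b)" using b closure_subset by blast
  qed
  \<comment> \<open>The empty set is added so that \<open>from_nat_into\<close> enumerates a
    nonempty family even when \<open>U\<close> is empty.\<close>
  have cnt: "countable (insert {} C)" using B by (auto simp: C_def)
  define c where "c = from_nat_into (insert {} C)"
  have c: "c n \<in> insert {} C" for n
    unfolding c_def by (rule from_nat_into) simp
  have rng: "range c = insert {} C"
    unfolding c_def by (rule range_from_nat_into[OF _ cnt]) simp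
  define K where "K n = (\<Union>i\<le>n. closure (c i))" for n
  show thesis
  proof (rule that)
    show "closed (K n)" for n unfolding K_def by (intro closed_UN) auto
    show sub: "K n \<subseteq> U" for n
    proof -
      have "closure (c i) \<subseteq> U" for i using c[of i] by (auto simp: C_def)
      then show ?thesis unfolding K_def by blast
    qed
    show "(\<Union>n. K n) = U"
    proof
      show "U \<subseteq> (\<Union>n. K n)"
      proof
        fix x assume "x \<in> U"
        then obtain b where b: "b \<in> C" "x \<in> closure b" using cover by blast
        then obtain n where "c n = b" using rng by (metis imageE insert_iff)
        then have "x \<in> K n" using b by (auto simp: K_def)
        then show "x \<in> (\<Union>n. K n)" by blast
      qed
    qed (use sub in blast)
    show "incseq K" unfolding K_def incseq_def
      by (meson UN_mono atMost_subset_iff order_refl)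
  qed
qed

text \<open>Urysohn functions that are 0 off \<open>U\<close> and 1 on an increasing closed
  exhaustion of \<open>U\<close>: at each point the sequence is eventually constant.\<close>

lemma open_indicator_limit_continuous:
  assumes "open (U :: 'g set)"
  obtains w :: "nat \<Rightarrow> 'g \<Rightarrow> complex" where "\<And>n. cts (w n)" "\<And>n x. cmod (w n x) \<le> 1"
    "\<And>x. (\<lambda>n. w n x) \<longlonglongrightarrow> indicator U x"
proof -
  obtain K where K: "\<And>n. closed (K n)" "\<And>n. K n \<subseteq> U" "(\<Union>n. K n) = U" "incseq K"
    using open_countable_union_closed[OF assms] by blast
  have "\<exists>f. cts f \<and> (\<forall>x. f x \<in> {0..1::real}) \<and> (\<forall>x\<in>-U. f x = 0) \<and> (\<forall>x\<in>K n. f x = 1)" for n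
  proof -
    have "closedin euclidean (-U)" "closedin euclidean (K n)" "disjnt (-U) (K n)"
      using assms K by (auto simp: closed_Compl disjnt_def)
    then obtain f where f: "continuous_map euclidean (top_of_set {0..1::real}) f"
      "f ` (-U) \<subseteq> {0}" "f ` K n \<subseteq> {1}"
      using Urysohn_lemma[OF normal_space_group, of "-U" "K n" 0 1] by auto
    then show ?thesis
      by (intro exI[of _ f]) (auto simp: continuous_map_in_subtopology)
  qed
  then obtain f where f: "\<And>n. cts (f n)" "\<And>n x. f n x \<in> {0..1::real}"
    "\<And>n x. x \<notin> U \<Longrightarrow> f n x = 0" "\<And>n x. x \<in> K n \<Longrightarrow> f n x = 1"
    by (metis ComplI)
  show thesis
  proof (rule that[of "\<lambda>n x. of_real (f n x)"])
    show "cts (\<lambda>x. complex_of_real (f n x))" for n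
      by (intro continuous_intros f)
    show "cmod (of_real (f n x)) \<le> 1" for n x using f(2)[of n x] by simp
    show "(\<lambda>n. complex_of_real (f n x)) \<longlonglongrightarrow> indicator U x" for x
    proof (cases "x \<in> U")
      case True
      then obtain m where "x \<in> K m" using K by blast
      then have "f n x = 1" if "n \<ge> m" for n
        using f(4) K(4) that by (meson incseqD subsetD)
      then have "\<forall>\<^sub>F n in sequentially. complex_of_real (f n x) = indicator U x"
        using True by (intro eventually_sequentiallyI[of m]) auto
      then show ?thesis by (rule tendsto_eventually)
    qed (use f in simp)
  qed
qed

lemma L2_distr:
  assumes [measurable]: "T \<in> measurable M M" and "distr M M T = M" "square_integrable M f"
  shows "square_integrable M (\<lambda>x. f (T x))" "l2_sq M (\<lambda>x. f (T x)) = l2_sq M f"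
proof -
  have [measurable]: "f \<in> borel_measurable M" using assms by (simp add: square_integrable_def)
  have "integrable (distr M M T) (\<lambda>x. (cmod (f x))\<^sup>2)"
    using assms by (simp add: square_integrable_def)
  then show "square_integrable M (\<lambda>x. f (T x))"
    unfolding square_integrable_def by (subst (asm) integrable_distr_eq) auto
  show "l2_sq M (\<lambda>x. f (T x)) = l2_sq M f"
    unfolding l2_sq_def by (subst (2) assms(2)[symmetric], subst integral_distr) auto
qed

lemma
  assumes "square_integrable H f"
  shows L2_translate: "square_integrable H (\<lambda>x. f (mul g x))"
    and l2_sq_translate: "l2_sq H (\<lambda>x. f (mul g x)) = l2_sq H f"
  using L2_distr[OF _ distr_mul_left assms] by (simp_all add: measurable_H)

text \<open>Weak continuity of the translation orbit of \<open>u\<close>. For fixed \<open>v\<close>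
  the coefficient is linear in \<open>u\<close> and depends on it uniformly in \<open>g\<close>, so
  the property survives linear combinations and \<open>L\<^sup>2\<close>-limits and can be built up
  from continuous functions.\<close>

definition translation_continuous :: "('g \<Rightarrow> complex) \<Rightarrow> bool" where
  "translation_continuous u \<longleftrightarrow> square_integrable H u \<and>
     (\<forall>v. square_integrable H v \<longrightarrow> cts (\<lambda>g. l2_inner H (\<lambda>x. u (mul g x)) v))"

lemma translation_continuous_limit:
  assumes u: "square_integrable H u" and w: "\<And>n::nat. translation_continuous (w n)"
    and lim: "(\<lambda>n. l2_sq H (\<lambda>x. u x - w n x)) \<longlonglongrightarrow> 0"
  shows "translation_continuous u"
  unfolding translation_continuous_def
proof (intro conjI u allI impI)
  fix v assume v: "square_integrable H v"
  show "cts (\<lambda>g. l2_inner H (\<lambda>x. u (mul g x)) v)"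
  proof (rule continuous_on_uniform_approx)
    fix \<epsilon> :: real assume e: "\<epsilon> > 0"
    \<comment> \<open>Adding 1 keeps the denominator positive when \<open>v\<close> has norm
      0.\<close>
    have pos: "l2_sq H v + 1 > 0" using l2_sq_nonneg[of H v] by simp
    then have "\<epsilon>\<^sup>2 / (l2_sq H v + 1) > 0" using e by simp
    from order_tendstoD(2)[OF lim this] obtain n
      where n: "l2_sq H (\<lambda>x. u x - w n x) < \<epsilon>\<^sup>2 / (l2_sq H v + 1)"
      by (auto simp: eventually_sequentially)
    have ws: "square_integrable H (w n)" using w by (simp add: translation_continuous_def)
    let ?d = "\<lambda>x. u x - w n x"
    have d: "square_integrable H ?d" by (intro L2_diff u ws)
    have "dist (l2_inner H (\<lambda>x. w n (mul g x)) v) (l2_inner H (\<lambda>x. u (mul g x)) v) < \<epsilon>" for g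
    proof -
      have "(dist (l2_inner H (\<lambda>x. w n (mul g x)) v) (l2_inner H (\<lambda>x. u (mul g x)) v))\<^sup>2
          = (cmod (l2_inner H (\<lambda>x. ?d (mul g x)) v))\<^sup>2"
        by (subst l2_inner_diff_left)
          (simp_all add: L2_translate u ws v dist_norm norm_minus_commute)
      also have "\<dots> \<le> l2_sq H ?d * l2_sq H v"
        using l2_Cauchy_Schwarz[OF L2_translate[OF d, of g] v] l2_sq_translate[OF d, of g] by simp
      also have "\<dots> \<le> l2_sq H ?d * (l2_sq H v + 1)"
        using l2_sq_nonneg[of H ?d] by (intro mult_left_mono) auto
      also have "\<dots> < \<epsilon>\<^sup>2" using n pos by (simp add: pos_less_divide_eq)
      finally show ?thesis using e by (simp add: power_less_imp_less_base)
    qed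
    then show "\<exists>h. cts h \<and> (\<forall>g\<in>UNIV. dist (h g) (l2_inner H (\<lambda>x. u (mul g x)) v) < \<epsilon>)"
      using w[of n] v unfolding translation_continuous_def by blast
  qed
qed

lemma translation_continuous_continuous:
  assumes w: "cts w"
  shows "translation_continuous w"
  unfolding translation_continuous_def l2_inner_def
proof (intro conjI allI impI)
  show ws: "square_integrable H w" by (rule continuous_L2[OF w])
  fix v assume v: "square_integrable H v"
  obtain B where B: "B > 0" "\<And>x. cmod (w x) \<le> B" using continuous_bounded[OF w] by blast
  show "cts (\<lambda>g. \<integral>x. w (mul g x) * cnj (v x) \<partial>H)"
  proof (rule continuous_on_integral_dominated)
    show "integrable H (\<lambda>x. B * cmod (v x))"
      using L2_integrable[OF H.finite_measure_axioms v] by simp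
    show "(\<lambda>x. w (mul g x) * cnj (v x)) \<in> borel_measurable H" for g
      using integrable_l2_inner[OF L2_translate[OF ws] v] by auto
    show "AE y in H. cts (\<lambda>x. w (mul x y) * cnj (v y))"
      by (intro AE_I2 continuous_intros continuous_on_compose2[OF w]) auto
    show "AE y in H. norm (w (mul x y) * cnj (v y)) \<le> B * cmod (v y)" for x
      using B by (auto simp: norm_mult intro!: mult_right_mono)
  qed
qed

lemma translation_continuous_add:
  assumes "translation_continuous u" "translation_continuous w"
  shows "translation_continuous (\<lambda>x. u x + w x)"
  using assms unfolding translation_continuous_def
  by (auto simp: L2_add L2_translate l2_inner_add_left intro!: continuous_on_add)

lemma translation_continuous_scale:
  "translation_continuous u \<Longrightarrow> translation_continuous (\<lambda>x. a * u x)"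
  unfolding translation_continuous_def
  by (auto simp: L2_scale l2_inner_scale_left intro!: continuous_on_mult_left)

lemma translation_continuous_sum:
  assumes "\<And>i. i \<in> I \<Longrightarrow> translation_continuous (u i)"
  shows "translation_continuous (\<lambda>x. \<Sum>i\<in>I. u i x)"
  using assms
  by (induction I rule: infinite_finite_induct)
    (auto intro: translation_continuous_add translation_continuous_continuous)

lemma L2_indicator:
  "A \<in> sets borel \<Longrightarrow> square_integrable H (indicator A :: 'g \<Rightarrow> complex)"
  by (rule H.bounded_L2[where B = 1])
    (auto simp: measurable_H indicator_def)

lemma L2_const: "square_integrable H (\<lambda>x. c)"
  by (rule continuous_L2) simp

text \<open>A Dynkin system argument. Open sets form an intersection-stable generator and are
  reached by Urysohn approximations; complements use the constant function 1, and disjoint unions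
  are dominated limits of finite sums.\<close>

lemma translation_continuous_indicator:
  assumes "A \<in> sets borel"
  shows "translation_continuous (indicator A)"
proof -
  have "Int_stable {S::'g set. open S}" by (auto simp: Int_stable_def)
  moreover have "{S::'g set. open S} \<subseteq> Pow UNIV" by simp
  moreover have "A \<in> sigma_sets UNIV {S. open S}" using assms by (simp add: borel_def)
  ultimately show ?thesis
  proof (induction rule: sigma_sets_induct_disjoint)
    case (basic U)
    then have U: "open U" by simp
    then obtain w :: "nat \<Rightarrow> 'g \<Rightarrow> complex" where w: "\<And>n. cts (w n)"
      "\<And>n x. cmod (w n x) \<le> 1" "\<And>x. (\<lambda>n. w n x) \<longlonglongrightarrow> indicator U x"
      using open_indicator_limit_continuous by blast
    have "(\<lambda>n. l2_sq H (\<lambda>x. indicator U x - w n x)) \<longlonglongrightarrow> 0"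
    proof (rule l2_sq_dominated_tendsto[where w = "\<lambda>x. 1"])
      show "square_integrable H (indicator U :: 'g \<Rightarrow> complex)"
        using U by (intro L2_indicator) auto
    qed (use w in \<open>auto intro: L2_const continuous_L2 simp: indicator_def\<close>)
    then show ?case
      using U by (intro translation_continuous_limit[OF L2_indicator
            translation_continuous_continuous[OF w(1)]]) auto
  next
    case empty
    have "indicator {} = (\<lambda>x::'g. 0::complex)" by (auto simp: fun_eq_iff)
    then show ?case using translation_continuous_continuous[of "\<lambda>x. 0"] by simp
  next
    case (compl A)
    have eq: "indicator (UNIV - A) = (\<lambda>x. 1 + (-1) * indicator A x :: complex)"
      by (auto simp: indicator_def)
    show ?case unfolding eq
      by (intro translation_continuous_add translation_continuous_scale compl translation_continuous_continuous) simp
  next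
    case (union A)
    have meas: "A i \<in> sets borel" for i using union(2) by (auto simp: borel_def)
    let ?v = "\<lambda>n x. \<Sum>i<n. indicator (A i) x :: complex"
    have v: "?v n x = indicator (\<Union>i<n. A i) x" for n x
      using union(1) by (subst indicator_UN_disjoint) (auto simp: disjoint_family_on_def)
    have lim: "(\<lambda>n. ?v n x) \<longlonglongrightarrow> indicator (\<Union>i. A i) x" for x
      unfolding v by (rule LIMSEQ_indicator_UN)
    have "(\<lambda>n. l2_sq H (\<lambda>x. indicator (\<Union>i. A i) x - ?v n x)) \<longlonglongrightarrow> 0"
    proof (rule l2_sq_dominated_tendsto[where w = "\<lambda>x. 1"])
      show "square_integrable H (?v n)" for n
        by (intro L2_sum L2_indicator meas)
      show "square_integrable H (indicator (\<Union>i. A i) :: 'g \<Rightarrow> complex)"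
        by (intro L2_indicator sets.countable_UN) (use meas in auto)
      show "cmod (?v n x) \<le> cmod 1" for n x unfolding v by (simp add: indicator_def)
    qed (use lim in \<open>auto intro: L2_const simp: indicator_def\<close>)
    moreover have "translation_continuous (?v n)" for n
      by (rule translation_continuous_sum) (rule union)
    ultimately show ?case
      using meas by (intro translation_continuous_limit[of _ ?v, OF L2_indicator]) auto
  qed
qed

lemma translation_continuous_all:
  assumes u: "square_integrable H u"
  shows "translation_continuous u"
proof -
  have um[measurable]: "u \<in> borel_measurable H" using u by (simp add: square_integrable_def)
  \<comment> \<open>With reference point 0 the approximation by simple functions is dominated by
    \<open>2 * cmod (u x)\<close>, which is square integrable.\<close>
  obtain F where F: "\<And>i. simple_function H (F i)" "\<And>x. (\<lambda>i. F i x) \<longlonglongrightarrow> u x"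
    "\<And>i x. cmod (F i x) \<le> 2 * cmod (u x)"
    using borel_measurable_implies_sequence_metric[OF um, of 0] by auto
  have approx: "translation_continuous (F n)" for n
  proof -
    have "F n = (\<lambda>x. \<Sum>z\<in>F n ` UNIV. z * indicator (F n -` {z}) x)"
    proof
      fix x
      have "(\<Sum>z\<in>F n ` UNIV. z * indicator (F n -` {z}) x) = (\<Sum>z\<in>F n ` UNIV. if z = F n x then z else 0)"
        by (intro sum.cong) (auto simp: indicator_def)
      also have "\<dots> = F n x"
        using simple_functionD(1)[OF F(1), of n] by (simp add: sum.delta')
      finally show "F n x = (\<Sum>z\<in>F n ` UNIV. z * indicator (F n -` {z}) x)" by simp
    qed
    moreover have "translation_continuous (\<lambda>x. \<Sum>z\<in>F n ` UNIV. z * indicator (F n -` {z}) x)"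
      by (intro translation_continuous_sum translation_continuous_scale translation_continuous_indicator)
        (use simple_functionD(2)[OF F(1), of n] in \<open>simp add: sets_H\<close>)
    ultimately show ?thesis by simp
  qed
  have "(\<lambda>n. l2_sq H (\<lambda>x. u x - F n x)) \<longlonglongrightarrow> 0"
  proof (rule l2_sq_dominated_tendsto[OF u])
    show "square_integrable H (F n)" for n using approx by (simp add: translation_continuous_def)
    show "square_integrable H (\<lambda>x. 2 * u x)" by (rule L2_scale[OF u])
  qed (use F in \<open>auto simp: norm_mult\<close>)
  then show ?thesis by (rule translation_continuous_limit[OF u approx])
qed

end

section \<open>Schur orthogonality\<close>

lemma index_mat_mult_sum:
  assumes "A \<in> carrier_mat n m" "B \<in> carrier_mat m p" "i < n" "j < p"
  shows "(A * B) $$ (i,j) = (\<Sum>k<m. A $$ (i,k) * B $$ (k,j))"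
  using assms by (auto simp: scalar_prod_def atLeast0LessThan intro!: sum.cong)

lemma index_mult_mat_vec_sum:
  assumes "A \<in> carrier_mat n m" "v \<in> carrier_vec m" "i < n"
  shows "vec_index (A *\<^sub>v v) i = (\<Sum>k<m. A $$ (i,k) * vec_index v k)"
  using assms by (auto simp: scalar_prod_def atLeast0LessThan intro!: sum.cong)

lemma mat_adj_carrier: "A \<in> carrier_mat n m \<Longrightarrow> mat_adj A \<in> carrier_mat m n"
  by (simp add: mat_adj_def)

lemma mat_trace_mult_commute:
  assumes "A \<in> carrier_mat n m" "B \<in> carrier_mat m n"
  shows "mat_trace (A * B) = mat_trace (B * A)"
proof -
  have "mat_trace (A * B) = (\<Sum>i<n. \<Sum>k<m. A $$ (i,k) * B $$ (k,i))"
    unfolding mat_trace_def using assms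
    by (auto intro!: sum.cong simp: index_mat_mult_sum[OF assms] simp del: index_mult_mat(1))
  also have "\<dots> = (\<Sum>k<m. \<Sum>i<n. B $$ (k,i) * A $$ (i,k))"
    by (subst sum.swap) (simp add: mult.commute)
  also have "\<dots> = mat_trace (B * A)"
    unfolding mat_trace_def using assms
    by (auto intro!: sum.cong simp: index_mat_mult_sum[OF assms(2,1)] simp del: index_mult_mat(1))
  finally show ?thesis .
qed

lemma mat_trace_one: "mat_trace (1\<^sub>m n) = of_nat n"
  by (simp add: mat_trace_def)

lemma mat_zero_if_unit_vecs:
  fixes B :: "complex mat"
  assumes B: "B \<in> carrier_mat d d'" and z: "\<And>j. j < d' \<Longrightarrow> B *\<^sub>v unit_vec d' j = 0\<^sub>v d"
  shows "B = 0\<^sub>m d d'"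
proof (rule eq_matI)
  fix i j assume ij: "i < dim_row (0\<^sub>m d d' :: complex mat)" "j < dim_col (0\<^sub>m d d' :: complex mat)"
  then have "vec_index (B *\<^sub>v unit_vec d' j) i = 0" using z[of j] by simp
  then show "B $$ (i,j) = 0\<^sub>m d d' $$ (i,j)" using ij B by simp
qed (use B in auto)

text \<open>The kernel of \<open>B\<close> is invariant under \<open>\<sigma>\<close>, so
  irreducibility makes it 0 or everything; the latter would force \<open>B\<close> to
  vanish.\<close>

lemma intertwiner_injective:
  assumes B: "B \<in> carrier_mat d d'" and B0: "B \<noteq> 0\<^sub>m d d'"
    and \<sigma>: "\<And>g. \<sigma> g \<in> carrier_mat d' d'" and \<pi>: "\<And>g. \<pi> g \<in> carrier_mat d d"
    and tw: "\<And>g. \<pi> g * B = B * \<sigma> g" and irr: "irreducible_rep d' \<sigma>"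
    and v: "v \<in> carrier_vec d'" "B *\<^sub>v v = 0\<^sub>v d"
  shows "v = 0\<^sub>v d'"
proof -
  define K where "K = {v \<in> carrier_vec d'. B *\<^sub>v v = 0\<^sub>v d}"
  have "invariant_subspace d' \<sigma> K"
    unfolding invariant_subspace_def
  proof (intro conjI ballI allI)
    show "K \<subseteq> carrier_vec d'" "0\<^sub>v d' \<in> K" using B by (auto simp: K_def)
    fix v w assume vw: "v \<in> K" "w \<in> K"
    then show "v + w \<in> K" using B by (auto simp: K_def mult_add_distrib_mat_vec)
  next
    fix a v assume "v \<in> K"
    then show "a \<cdot>\<^sub>v v \<in> K" using B by (auto simp: K_def mult_mat_vec)
  next
    fix g v assume v: "v \<in> K"
    have "B *\<^sub>v (\<sigma> g *\<^sub>v v) = (B * \<sigma> g) *\<^sub>v v"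
      using B \<sigma>[of g] v by (simp add: K_def)
    also have "\<dots> = \<pi> g *\<^sub>v (B *\<^sub>v v)"
      using B \<pi>[of g] v by (simp add: K_def flip: tw)
    also have "B *\<^sub>v v = 0\<^sub>v d" using v by (simp add: K_def)
    also have "\<pi> g *\<^sub>v 0\<^sub>v d = 0\<^sub>v d" using \<pi>[of g] by auto
    finally show "\<sigma> g *\<^sub>v v \<in> K" using \<sigma>[of g] v by (auto simp: K_def)
  qed
  then consider "K = {0\<^sub>v d'}" | "K = carrier_vec d'"
    using irr unfolding irreducible_rep_def by blast
  then show ?thesis
  proof cases
    case 1
    then show ?thesis using v by (auto simp: K_def)
  next
    case 2
    then have "unit_vec d' j \<in> K" for j by simp
    then have "B = 0\<^sub>m d d'" by (intro mat_zero_if_unit_vecs[OF B]) (simp add: K_def)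
    with B0 show ?thesis by simp
  qed
qed

text \<open>Dually, the range of \<open>B\<close> is invariant under \<open>\<pi>\<close> and is not
  0.\<close>

lemma intertwiner_surjective:
  assumes B: "B \<in> carrier_mat d d'" and B0: "B \<noteq> 0\<^sub>m d d'"
    and \<sigma>: "\<And>g. \<sigma> g \<in> carrier_mat d' d'" and \<pi>: "\<And>g. \<pi> g \<in> carrier_mat d d"
    and tw: "\<And>g. \<pi> g * B = B * \<sigma> g" and irr: "irreducible_rep d \<pi>"
    and w: "w \<in> carrier_vec d"
  shows "\<exists>v\<in>carrier_vec d'. B *\<^sub>v v = w"
proof -
  define R where "R = (\<lambda>v. B *\<^sub>v v) ` carrier_vec d'"
  have "invariant_subspace d \<pi> R"
    unfolding invariant_subspace_def
  proof (intro conjI ballI allI)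
    show "R \<subseteq> carrier_vec d" using B by (auto simp: R_def)
    have "B *\<^sub>v 0\<^sub>v d' = 0\<^sub>v d" using B by auto
    then show "0\<^sub>v d \<in> R" by (metis R_def imageI zero_carrier_vec)
    fix v w assume "v \<in> R" "w \<in> R"
    then obtain v' w' where *: "v = B *\<^sub>v v'" "w = B *\<^sub>v w'" "v' \<in> carrier_vec d'" "w' \<in> carrier_vec d'"
      by (auto simp: R_def)
    then have "v + w = B *\<^sub>v (v' + w')" using B by (simp add: mult_add_distrib_mat_vec)
    then show "v + w \<in> R" using * by (auto simp: R_def)
  next
    fix a v assume "v \<in> R"
    then obtain v' where *: "v = B *\<^sub>v v'" "v' \<in> carrier_vec d'" by (auto simp: R_def)
    then have "a \<cdot>\<^sub>v v = B *\<^sub>v (a \<cdot>\<^sub>v v')" using B by (simp add: mult_mat_vec)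
    then show "a \<cdot>\<^sub>v v \<in> R" using * by (auto simp: R_def)
  next
    fix g v assume "v \<in> R"
    then obtain v' where *: "v = B *\<^sub>v v'" "v' \<in> carrier_vec d'" by (auto simp: R_def)
    have "\<pi> g *\<^sub>v v = (\<pi> g * B) *\<^sub>v v'" using * B \<pi>[of g] by simp
    also have "\<dots> = B *\<^sub>v (\<sigma> g *\<^sub>v v')" unfolding tw using * B \<sigma>[of g] by simp
    finally show "\<pi> g *\<^sub>v v \<in> R" using * \<sigma>[of g] by (auto simp: R_def)
  qed
  then consider "R = {0\<^sub>v d}" | "R = carrier_vec d"
    using irr unfolding irreducible_rep_def by blast
  then show ?thesis
  proof cases
    case 1
    have "B *\<^sub>v unit_vec d' j \<in> R" for j by (auto simp: R_def)
    with 1 have "B = 0\<^sub>m d d'" by (intro mat_zero_if_unit_vecs[OF B]) simp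
    with B0 show ?thesis by simp
  next
    case 2
    then have "w \<in> R" using w by simp
    then show ?thesis by (auto simp: R_def)
  qed
qed

text \<open>Surjectivity supplies a right inverse \<open>C\<close> column by column. Then
  \<open>B * (C * B - 1) = 0\<close>, and injectivity of \<open>B\<close> applied to the columns
  gives \<open>C * B = 1\<close>. The two products have equal trace, which equates the
  dimensions.\<close>

lemma Schur_intertwiner_inverse:
  assumes B: "B \<in> carrier_mat d d'" and B0: "B \<noteq> 0\<^sub>m d d'"
    and \<sigma>: "\<And>g. \<sigma> g \<in> carrier_mat d' d'" and \<pi>: "\<And>g. \<pi> g \<in> carrier_mat d d"
    and tw: "\<And>g. \<pi> g * B = B * \<sigma> g"
    and irr: "irreducible_rep d \<pi>" "irreducible_rep d' \<sigma>"
  obtains C where "d = d'" "C \<in> carrier_mat d' d" "B * C = 1\<^sub>m d" "C * B = 1\<^sub>m d'"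
proof -
  have "\<forall>i. \<exists>v\<in>carrier_vec d'. B *\<^sub>v v = unit_vec d i"
    using intertwiner_surjective[OF B B0 \<sigma> \<pi> tw irr(1)] by (metis unit_vec_carrier)
  then obtain c where c: "\<And>i. c i \<in> carrier_vec d'" "\<And>i. B *\<^sub>v c i = unit_vec d i"
    by metis
  define C where "C = mat_of_cols d' (map c [0..<d])"
  have C: "C \<in> carrier_mat d' d" unfolding C_def by auto
  have colC: "col C i = c i" if "i < d" for i
    using that c by (simp add: C_def)
  have BC: "B * C = 1\<^sub>m d"
  proof (rule mat_col_eqI)
    fix i assume "i < dim_col (1\<^sub>m d :: complex mat)"
    then show "col (B * C) i = col (1\<^sub>m d) i"
      using B C c by (simp add: col_mult2[OF B C] colC)
  qed (use B C in auto)
  have "C * B - 1\<^sub>m d' = 0\<^sub>m d' d'"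
  proof (rule mat_col_eqI)
    fix i assume i: "i < dim_col (0\<^sub>m d' d' :: complex mat)"
    let ?D = "C * B - 1\<^sub>m d'"
    have D: "?D \<in> carrier_mat d' d'" using B C by auto
    have "B * ?D = B * (C * B) - B * 1\<^sub>m d'"
      using B C by (intro mult_minus_distrib_mat) auto
    also have "B * (C * B) = B"
      using B C BC by (simp flip: assoc_mult_mat[of B d d' C d B d'])
    finally have "B * ?D = 0\<^sub>m d d'" using B by auto
    then have "B *\<^sub>v col ?D i = 0\<^sub>v d"
      using col_mult2[OF B D, of i] i by simp
    then have "col ?D i = 0\<^sub>v d'"
      using col_dim[of ?D i] unfolding carrier_matD(1)[OF D]
      by (intro intertwiner_injective[OF B B0 \<sigma> \<pi> tw irr(2)])
    then show "col ?D i = col (0\<^sub>m d' d') i" using i by simp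
  qed (use B C in auto)
  then have D0: "(C * B - 1\<^sub>m d') $$ (i,j) = 0" if "i < d'" "j < d'" for i j using that by simp
  have CB: "C * B = 1\<^sub>m d'"
  proof (rule eq_matI)
    fix i j assume ij: "i < dim_row (1\<^sub>m d' :: complex mat)" "j < dim_col (1\<^sub>m d' :: complex mat)"
    then have "(C * B - 1\<^sub>m d') $$ (i,j) = (C * B) $$ (i,j) - 1\<^sub>m d' $$ (i,j)"
      by (intro index_minus_mat) auto
    with D0[of i j] ij show "(C * B) $$ (i,j) = 1\<^sub>m d' $$ (i,j)" by simp
  qed (use B C in auto)
  have "(of_nat d :: complex) = mat_trace (B * C)" by (simp add: BC mat_trace_one)
  also have "\<dots> = of_nat d'" by (simp add: mat_trace_mult_commute[OF B C] CB mat_trace_one)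
  finally have "d = d'" by simp
  with C BC CB that show thesis by blast
qed

text \<open>Over the complex numbers \<open>B\<close> has an eigenvalue \<open>c\<close>; then
  \<open>B - c\<close> commutes with the representation and has a nonzero kernel, so by
  \<open>intertwiner_injective\<close> it is 0.\<close>

lemma Schur_commutant_scalar:
  assumes B: "B \<in> carrier_mat d d" and \<pi>: "\<And>g. \<pi> g \<in> carrier_mat d d"
    and tw: "\<And>g. \<pi> g * B = B * \<pi> g" and irr: "irreducible_rep d \<pi>"
  obtains c where "B = c \<cdot>\<^sub>m 1\<^sub>m d"
proof -
  have d: "d > 0" using irr by (simp add: irreducible_rep_def)
  obtain c where c: "eigenvalue B c"
    using spectrum_non_empty[OF B] d by (auto simp: spectrum_def)
  then obtain v where v: "v \<in> carrier_vec d" "v \<noteq> 0\<^sub>v d" "B *\<^sub>v v = c \<cdot>\<^sub>v v"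
    using B by (auto simp: eigenvalue_def eigenvector_def)
  let ?D = "B - c \<cdot>\<^sub>m 1\<^sub>m d"
  have D: "?D \<in> carrier_mat d d" using B by auto
  have Dv: "?D *\<^sub>v v = 0\<^sub>v d"
  proof -
    have "?D *\<^sub>v v = B *\<^sub>v v - (c \<cdot>\<^sub>m 1\<^sub>m d) *\<^sub>v v"
      using B v by (intro minus_mult_distrib_mat_vec) auto
    also have "(c \<cdot>\<^sub>m 1\<^sub>m d) *\<^sub>v v = c \<cdot>\<^sub>v v"
      using v by (auto simp: smult_scalar_prod_distrib[of _ d])
    finally show ?thesis using v by simp
  qed
  have twD: "\<pi> g * ?D = ?D * \<pi> g" for g
  proof -
    have "\<pi> g * ?D = \<pi> g * B - \<pi> g * (c \<cdot>\<^sub>m 1\<^sub>m d)"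
      using B \<pi>[of g] by (intro mult_minus_distrib_mat) auto
    also have "\<pi> g * (c \<cdot>\<^sub>m 1\<^sub>m d) = (c \<cdot>\<^sub>m 1\<^sub>m d) * \<pi> g"
      using \<pi>[of g] by (simp add: mult_smult_distrib[of _ d d _ d] mult_smult_assoc_mat[of _ d d _ d])
    also have "\<pi> g * B - (c \<cdot>\<^sub>m 1\<^sub>m d) * \<pi> g = ?D * \<pi> g"
      unfolding tw using B \<pi>[of g] by (intro minus_mult_distrib_mat[symmetric]) auto
    finally show ?thesis .
  qed
  have "?D = 0\<^sub>m d d"
    using intertwiner_injective[OF D _ \<pi> \<pi> twD irr v(1) Dv] v(2) by blast
  have "B = c \<cdot>\<^sub>m 1\<^sub>m d"
  proof (rule eq_matI)
    fix i j assume ij: "i < dim_row (c \<cdot>\<^sub>m 1\<^sub>m d)" "j < dim_col (c \<cdot>\<^sub>m 1\<^sub>m d)"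
    have "?D $$ (i,j) = 0" using ij \<open>?D = 0\<^sub>m d d\<close> by simp
    then show "B $$ (i,j) = (c \<cdot>\<^sub>m 1\<^sub>m d) $$ (i,j)" using ij B by auto
  qed (use B in auto)
  then show thesis by (rule that)
qed

section \<open>Orthogonality of matrix coefficients\<close>

context haar_group
begin

context
  fixes d \<pi> assumes rep: "unitary_rep mul d \<pi>"
begin

lemma unitary_rep_carrier: "\<pi> g \<in> carrier_mat d d"
  and unitary_rep_unitary: "\<pi> g * mat_adj (\<pi> g) = 1\<^sub>m d"
  and unitary_rep_hom: "\<pi> (mul g h) = \<pi> g * \<pi> h"
  and unitary_rep_continuous: "i < d \<Longrightarrow> j < d \<Longrightarrow> cts (\<lambda>g. \<pi> g $$ (i,j))"
  using rep by (auto simp: unitary_rep_def)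

lemma unitary_rep_e: "\<pi> e = 1\<^sub>m d"
proof -
  have "\<pi> e * (\<pi> e * mat_adj (\<pi> e)) = (\<pi> e * \<pi> e) * mat_adj (\<pi> e)"
    using unitary_rep_carrier[of e]
    by (intro assoc_mult_mat[symmetric, of _ d d _ d _ d]) (auto simp: mat_adj_carrier)
  also have "\<pi> e * \<pi> e = \<pi> e" by (simp flip: unitary_rep_hom)
  finally show ?thesis using unitary_rep_carrier[of e] by (simp add: unitary_rep_unitary)
qed

lemma unitary_rep_ginv: "\<pi> (ginv g) = mat_adj (\<pi> g)"
proof -
  have "\<pi> (ginv g) * (\<pi> g * mat_adj (\<pi> g)) = (\<pi> (ginv g) * \<pi> g) * mat_adj (\<pi> g)"
    using unitary_rep_carrier
    by (intro assoc_mult_mat[symmetric, of _ d d _ d _ d]) (auto simp: mat_adj_carrier)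
  also have "\<pi> (ginv g) * \<pi> g = 1\<^sub>m d" by (simp add: unitary_rep_e flip: unitary_rep_hom)
  finally show ?thesis using unitary_rep_carrier
    by (simp add: unitary_rep_unitary mat_adj_carrier left_mult_one_mat[of _ d d] right_mult_one_mat[of _ d d])
qed

lemma unitary_rep_index_mul:
  "i < d \<Longrightarrow> j < d \<Longrightarrow> \<pi> (mul g h) $$ (i,j) = (\<Sum>k<d. \<pi> g $$ (i,k) * \<pi> h $$ (k,j))"
  unfolding unitary_rep_hom by (rule index_mat_mult_sum[OF unitary_rep_carrier unitary_rep_carrier])

lemma unitary_rep_index_ginv: "i < d \<Longrightarrow> j < d \<Longrightarrow> \<pi> (ginv g) $$ (i,j) = cnj (\<pi> g $$ (j,i))"
  unfolding unitary_rep_ginv using unitary_rep_carrier[of g] by (simp add: mat_adj_def)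

lemma unitary_rep_columns_orthonormal:
  assumes "i < d" "j < d"
  shows "(\<Sum>k<d. \<pi> g $$ (k,i) * cnj (\<pi> g $$ (k,j))) = (if i = j then 1 else 0)"
proof -
  have "(if i = j then 1 else 0) = \<pi> (mul (ginv g) g) $$ (j,i)"
    using assms by (auto simp: unitary_rep_e)
  also have "\<dots> = (\<Sum>k<d. cnj (\<pi> g $$ (k,j)) * \<pi> g $$ (k,i))"
    using assms by (subst unitary_rep_index_mul) (auto simp: unitary_rep_index_ginv)
  finally show ?thesis by (simp add: mult.commute)
qed

lemma mat_trace_rep: "mat_trace (\<pi> g) = (\<Sum>i<d. \<pi> g $$ (i,i))"
  using unitary_rep_carrier[of g] by (simp add: mat_trace_def)

end

text \<open>\<open>B\<close> is the Haar average of
  \<open>\<pi>(g) E \<sigma>(g)\<^sup>-\<^sup>1\<close>, where \<open>E\<close> is the matrix unit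
  at \<open>(j,l)\<close>; unitarity turns the inverse into a conjugate transpose. Invariance of the
  average under \<open>g \<mapsto> x g\<close> is the intertwining relation.\<close>

lemma averaged_intertwiner:
  assumes \<pi>: "unitary_rep mul d \<pi>" and \<sigma>: "unitary_rep mul d' \<sigma>" and j: "j < d" and l: "l < d'"
  defines "B \<equiv> mat d d' (\<lambda>(i,k). \<integral>g. \<pi> g $$ (i,j) * cnj (\<sigma> g $$ (k,l)) \<partial>H)"
  shows "\<pi> x * B = B * \<sigma> x"
proof (rule eq_matI)
  have B: "B \<in> carrier_mat d d'" by (simp add: B_def)
  note c\<pi> = unitary_rep_carrier[OF \<pi>] and c\<sigma> = unitary_rep_carrier[OF \<sigma>]
  fix i k assume "i < dim_row (B * \<sigma> x)" "k < dim_col (B * \<sigma> x)"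
  then have ik: "i < d" "k < d'" using B c\<sigma>[of x] by auto
  have cont: "continuous_on UNIV (\<lambda>g. \<pi> g $$ (i,j) * cnj (\<sigma> g $$ (k,l)))" if "i < d" "k < d'" for i k
    by (intro continuous_intros unitary_rep_continuous[OF \<pi>] unitary_rep_continuous[OF \<sigma>] j l that)
  have int: "integrable H (\<lambda>g. \<pi> g $$ (i,j) * cnj (\<sigma> g $$ (k,l)))" if "i < d" "k < d'" for i k
    by (rule continuous_integrable[OF cont[OF that]])
  have "(\<pi> x * B) $$ (i,k) = (\<Sum>m<d. \<pi> x $$ (i,m) * B $$ (m,k))"
    by (rule index_mat_mult_sum[OF c\<pi> B ik])
  also have "\<dots> = (\<Sum>m<d. \<integral>g. \<pi> x $$ (i,m) * (\<pi> g $$ (m,j) * cnj (\<sigma> g $$ (k,l))) \<partial>H)"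
    using ik by (intro sum.cong) (auto simp: B_def)
  also have "\<dots> = (\<integral>g. (\<Sum>m<d. \<pi> x $$ (i,m) * (\<pi> g $$ (m,j) * cnj (\<sigma> g $$ (k,l)))) \<partial>H)"
    using int ik by (subst Bochner_Integration.integral_sum) auto
  \<comment> \<open>The argument of \<open>\<sigma>\<close> is rewritten as
    \<open>mul (ginv x) (mul x g)\<close> to exhibit the integrand as a function of
    \<open>mul x g\<close>.\<close>
  also have "\<dots> = (\<integral>g. \<pi> (mul x g) $$ (i,j) * cnj (\<sigma> (mul (ginv x) (mul x g)) $$ (k,l)) \<partial>H)"
    using ik j by (simp add: unitary_rep_index_mul[OF \<pi>] sum_distrib_right mult.assoc)
  also have "\<dots> = (\<integral>g. \<pi> g $$ (i,j) * cnj (\<sigma> (mul (ginv x) g) $$ (k,l)) \<partial>H)"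
  proof (rule integral_mul_left[of "\<lambda>g. \<pi> g $$ (i,j) * cnj (\<sigma> (mul (ginv x) g) $$ (k,l))"])
    show "(\<lambda>g. \<pi> g $$ (i,j) * cnj (\<sigma> (mul (ginv x) g) $$ (k,l))) \<in> borel_measurable H"
      by (intro continuous_measurable_H continuous_intros unitary_rep_continuous[OF \<pi>] j l ik
          continuous_on_compose2[OF unitary_rep_continuous[OF \<sigma>]]) auto
  qed
  also have "\<dots> = (\<integral>g. (\<Sum>m<d'. (\<pi> g $$ (i,j) * cnj (\<sigma> g $$ (m,l))) * \<sigma> x $$ (m,k)) \<partial>H)"
    using ik l by (simp add: unitary_rep_index_mul[OF \<sigma>] unitary_rep_index_ginv[OF \<sigma>]
        sum_distrib_left mult_ac)
  also have "\<dots> = (\<Sum>m<d'. \<integral>g. (\<pi> g $$ (i,j) * cnj (\<sigma> g $$ (m,l))) * \<sigma> x $$ (m,k) \<partial>H)"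
    using int ik by (subst Bochner_Integration.integral_sum) auto
  also have "\<dots> = (\<Sum>m<d'. B $$ (i,m) * \<sigma> x $$ (m,k))"
    using ik by (intro sum.cong) (auto simp: B_def)
  also have "\<dots> = (B * \<sigma> x) $$ (i,k)"
    by (rule index_mat_mult_sum[OF B c\<sigma> ik, symmetric])
  finally show "(\<pi> x * B) $$ (i,k) = (B * \<sigma> x) $$ (i,k)" .
qed (use unitary_rep_carrier[OF \<pi>, of x] unitary_rep_carrier[OF \<sigma>, of x] in \<open>auto simp: B_def\<close>)

lemma Schur_orthogonality_inequivalent:
  assumes \<pi>: "(d, \<pi>) \<in> irreps mul" and \<sigma>: "(d', \<sigma>) \<in> irreps mul"
    and ne: "((d, \<pi>), (d', \<sigma>)) \<notin> rep_equiv mul" and ij: "i < d" "j < d" "k < d'" "l < d'"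
  shows "(\<integral>g. \<pi> g $$ (i,j) * cnj (\<sigma> g $$ (k,l)) \<partial>H) = 0"
proof -
  have u: "unitary_rep mul d \<pi>" "unitary_rep mul d' \<sigma>"
    and irr: "irreducible_rep d \<pi>" "irreducible_rep d' \<sigma>"
    using \<pi> \<sigma> by (auto simp: irreps_def)
  note c = unitary_rep_carrier[OF u(1)] unitary_rep_carrier[OF u(2)]
  define B where "B = mat d d' (\<lambda>(i,k). \<integral>g. \<pi> g $$ (i,j) * cnj (\<sigma> g $$ (k,l)) \<partial>H)"
  have B: "B \<in> carrier_mat d d'" by (simp add: B_def)
  have tw: "\<pi> x * B = B * \<sigma> x" for x
    unfolding B_def by (rule averaged_intertwiner[OF u ij(2,4)])
  have "B = 0\<^sub>m d d'"
  proof (rule ccontr)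
    assume B0: "B \<noteq> 0\<^sub>m d d'"
    obtain C where C: "d = d'" "C \<in> carrier_mat d' d" "B * C = 1\<^sub>m d" "C * B = 1\<^sub>m d'"
      using Schur_intertwiner_inverse[OF B B0 c(2,1) tw irr] by blast
    \<comment> \<open>\<open>B\<close> intertwines from \<open>\<sigma>\<close> to
      \<open>\<pi>\<close>, whereas \<open>rep_equiv\<close> asks for the opposite direction; hence
      the passage to the inverse.\<close>
    have "C * \<pi> x = \<sigma> x * C" for x
    proof -
      have "C * \<pi> x = C * (\<pi> x * (B * C))" using C c(1)[of x] by simp
      also have "\<dots> = C * ((\<pi> x * B) * C)" using B C c(1)[of x] by (simp add: assoc_mult_mat[of _ d d _ d _ d])
      also have "\<pi> x * B * C = B * (\<sigma> x * C)"
        unfolding tw using B C c(2)[of x] by (intro assoc_mult_mat) auto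
      also have "C * (B * (\<sigma> x * C)) = (C * B) * (\<sigma> x * C)"
        using B C c(2)[of x] by (intro assoc_mult_mat[symmetric, of _ d d _ d _ d]) auto
      also have "\<dots> = \<sigma> x * C" using C c(2)[of x] by simp
      finally show ?thesis .
    qed
    moreover have "invertible_mat C"
      using B C by (auto simp: invertible_mat_def inverts_mat_def)
    ultimately have "((d, \<pi>), (d', \<sigma>)) \<in> rep_equiv mul"
      using \<pi> \<sigma> C by (auto simp: rep_equiv_def)
    with ne show False by simp
  qed
  then have "B $$ (i,k) = 0" using ij by simp
  then show ?thesis using ij by (simp add: B_def)
qed

text \<open>The averaged intertwiner is a scalar matrix, and its trace identifies the scalar: under
  the integral the trace is the inner product of columns \<open>j\<close> and \<open>l\<close> of a
  unitary matrix.\<close>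

lemma Schur_orthogonality_same:
  assumes \<pi>: "(d, \<pi>) \<in> irreps mul" and ij: "i < d" "j < d" "k < d" "l < d"
  shows "(\<integral>g. \<pi> g $$ (i,j) * cnj (\<pi> g $$ (k,l)) \<partial>H) = (if i = k \<and> j = l then 1 / of_nat d else 0)"
proof -
  have u: "unitary_rep mul d \<pi>" and irr: "irreducible_rep d \<pi>"
    using \<pi> by (auto simp: irreps_def)
  define B where "B = mat d d (\<lambda>(i,k). \<integral>g. \<pi> g $$ (i,j) * cnj (\<pi> g $$ (k,l)) \<partial>H)"
  have B: "B \<in> carrier_mat d d" by (simp add: B_def)
  have tw: "\<pi> x * B = B * \<pi> x" for x
    unfolding B_def by (rule averaged_intertwiner[OF u u ij(2,4)])
  obtain c where c: "B = c \<cdot>\<^sub>m 1\<^sub>m d"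
    using Schur_commutant_scalar[OF B unitary_rep_carrier[OF u] tw irr] by blast
  have "of_nat d * c = mat_trace B" by (simp add: c mat_trace_def)
  also have "\<dots> = (\<Sum>m<d. \<integral>g. \<pi> g $$ (m,j) * cnj (\<pi> g $$ (m,l)) \<partial>H)"
    by (simp add: mat_trace_def B_def)
  also have "\<dots> = (\<integral>g. (\<Sum>m<d. \<pi> g $$ (m,j) * cnj (\<pi> g $$ (m,l))) \<partial>H)"
    by (subst Bochner_Integration.integral_sum)
      (auto intro!: continuous_integrable continuous_intros unitary_rep_continuous[OF u] ij)
  also have "\<dots> = (if j = l then 1 else 0)"
    using ij by (simp add: unitary_rep_columns_orthonormal[OF u] H.prob_space[unfolded space_H])
  finally have "c = (if j = l then 1 / of_nat d else 0)" using ij by (auto simp: field_simps)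
  moreover have "(\<integral>g. \<pi> g $$ (i,j) * cnj (\<pi> g $$ (k,l)) \<partial>H) = B $$ (i,k)"
    using ij by (simp add: B_def)
  ultimately show ?thesis using ij c by auto
qed

end

section \<open>Equivalence classes of irreducible representations and their characters\<close>

lemma invertible_mat_inverse:
  fixes T :: "'a::comm_ring_1 mat"
  assumes T: "T \<in> carrier_mat n n" and inv: "invertible_mat T"
  obtains U where "U \<in> carrier_mat n n" "T * U = 1\<^sub>m n" "U * T = 1\<^sub>m n"
proof -
  obtain U where U: "T * U = 1\<^sub>m n" "U * T = 1\<^sub>m (dim_row U)"
    using T inv by (auto simp: invertible_mat_def inverts_mat_def)
  \<comment> \<open>\<open>invertible_mat\<close> does not fix the dimensions of the inverse; they
    are read off from the two products.\<close>
  have "dim_col U = dim_col (T * U)" by simp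
  moreover have "dim_row U = dim_col (U * T)" unfolding U(2) by simp
  ultimately have "U \<in> carrier_mat n n" using T U(1) by auto
  then show thesis using U that by auto
qed

lemma intertwine_inverse:
  fixes T :: "'a::comm_ring_1 mat"
  assumes "T \<in> carrier_mat n n" "U \<in> carrier_mat n n" "T * U = 1\<^sub>m n" "U * T = 1\<^sub>m n"
    and "A \<in> carrier_mat n n" "B \<in> carrier_mat n n" "T * A = B * T"
  shows "U * B = A * U"
proof -
  note assoc = assoc_mult_mat[of _ n n _ n _ n]
  have "B * (T * U) = B" unfolding assms(3) by (rule right_mult_one_mat[OF assms(6)])
  then have "U * B = U * (B * (T * U))" by simp
  also have "\<dots> = U * ((B * T) * U)" using assms by (simp add: assoc)
  also have "\<dots> = U * ((T * A) * U)" using assms by simp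
  also have "(T * A) * U = T * (A * U)" using assms by (intro assoc) auto
  also have "U * (T * (A * U)) = (U * T) * (A * U)" using assms by (intro assoc[symmetric]) auto
  also have "\<dots> = A * U" using assms by simp
  finally show ?thesis .
qed

context haar_group
begin

lemma rep_equiv_refl: "p \<in> irreps mul \<Longrightarrow> (p, p) \<in> rep_equiv mul"
proof -
  assume p: "p \<in> irreps mul"
  obtain d \<pi> where dp: "p = (d, \<pi>)" by fastforce
  then have "\<pi> g \<in> carrier_mat d d" for g using p by (auto simp: irreps_def unitary_rep_def)
  then have "1\<^sub>m d * \<pi> g = \<pi> g * 1\<^sub>m d" for g
    by (simp add: right_mult_one_mat[of _ d d] left_mult_one_mat[of _ d d])
  moreover have "invertible_mat (1\<^sub>m d :: complex mat)"
    by (auto simp: invertible_mat_def inverts_mat_def intro!: exI[of _ "1\<^sub>m d"])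
  ultimately show ?thesis using p by (auto simp: dp rep_equiv_def intro!: bexI[of _ "1\<^sub>m d"])
qed

text \<open>Needed so that the representatives chosen by \<open>rep_of\<close> in distinct classes
  are inequivalent, which is what Schur orthogonality uses.\<close>

lemma equiv_rep_equiv: "equiv (irreps mul) (rep_equiv mul)"
proof (rule equivI)
  show "rep_equiv mul \<subseteq> irreps mul \<times> irreps mul" by (auto simp: rep_equiv_def)
  show "refl_on (irreps mul) (rep_equiv mul)"
    using rep_equiv_refl by (auto simp: refl_on_def rep_equiv_def)
  show "sym (rep_equiv mul)"
  proof (rule symI)
    fix p q assume pq: "(p, q) \<in> rep_equiv mul"
    then obtain d \<pi> \<sigma> T where *: "p = (d, \<pi>)" "q = (d, \<sigma>)" "p \<in> irreps mul" "q \<in> irreps mul"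
      "T \<in> carrier_mat d d" "invertible_mat T" "\<And>g. T * \<pi> g = \<sigma> g * T"
      by (auto simp: rep_equiv_def)
    obtain U where U: "U \<in> carrier_mat d d" "T * U = 1\<^sub>m d" "U * T = 1\<^sub>m d"
      using invertible_mat_inverse[OF *(5,6)] by blast
    have "\<pi> g \<in> carrier_mat d d" "\<sigma> g \<in> carrier_mat d d" for g
      using * by (auto simp: irreps_def unitary_rep_def)
    then have "U * \<sigma> g = \<pi> g * U" for g
      using intertwine_inverse[OF *(5) U] * by blast
    moreover have "invertible_mat U"
      using U *(5) by (auto simp: invertible_mat_def inverts_mat_def)
    ultimately show "(q, p) \<in> rep_equiv mul" using * U by (auto simp: rep_equiv_def)
  qed
  show "trans (rep_equiv mul)"
  proof (rule transI)
    fix p q r assume "(p, q) \<in> rep_equiv mul" "(q, r) \<in> rep_equiv mul"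
    then obtain d \<pi> \<sigma> \<tau> T S where *: "p = (d, \<pi>)" "q = (d, \<sigma>)" "r = (d, \<tau>)"
      "p \<in> irreps mul" "q \<in> irreps mul" "r \<in> irreps mul"
      "T \<in> carrier_mat d d" "invertible_mat T" "\<And>g. T * \<pi> g = \<sigma> g * T"
      "S \<in> carrier_mat d d" "invertible_mat S" "\<And>g. S * \<sigma> g = \<tau> g * S"
      by (auto simp: rep_equiv_def)
    have c: "\<pi> g \<in> carrier_mat d d" "\<sigma> g \<in> carrier_mat d d" "\<tau> g \<in> carrier_mat d d" for g
      using * by (auto simp: irreps_def unitary_rep_def)
    obtain U where U: "U \<in> carrier_mat d d" "T * U = 1\<^sub>m d" "U * T = 1\<^sub>m d"
      using invertible_mat_inverse[OF *(7,8)] by blast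
    obtain V where V: "V \<in> carrier_mat d d" "S * V = 1\<^sub>m d" "V * S = 1\<^sub>m d"
      using invertible_mat_inverse[OF *(10,11)] by blast
    note assoc = assoc_mult_mat[of _ d d _ d _ d]
    have "S * T * (U * V) = S * (T * (U * V))" using * U V by (intro assoc) auto
    also have "T * (U * V) = T * U * V" using * U V by (intro assoc[symmetric]) auto
    also have "S * \<dots> = 1\<^sub>m d" using * U V by simp
    finally have ST1: "S * T * (U * V) = 1\<^sub>m d" .
    have "U * V * (S * T) = U * (V * (S * T))" using * U V by (intro assoc) auto
    also have "V * (S * T) = V * S * T" using * U V by (intro assoc[symmetric]) auto
    also have "U * \<dots> = 1\<^sub>m d" using * U V by simp
    finally have "U * V * (S * T) = 1\<^sub>m d" .
    with ST1 have "invertible_mat (S * T)"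
      using U V * by (auto simp: invertible_mat_def inverts_mat_def intro!: exI[of _ "U * V"])
    moreover have "S * T * \<pi> g = \<tau> g * (S * T)" for g
    proof -
      have "S * T * \<pi> g = S * (\<sigma> g * T)" using * c[of g] by (simp add: assoc)
      also have "\<dots> = (S * \<sigma> g) * T" using * c[of g] by (intro assoc[symmetric]) auto
      also have "\<dots> = \<tau> g * (S * T)" using * c[of g] by (simp add: assoc)
      finally show ?thesis .
    qed
    ultimately show "(p, r) \<in> rep_equiv mul"
      using * by (auto simp: rep_equiv_def intro!: bexI[of _ "S * T"])
  qed
qed

lemma rep_of_in_class:
  assumes "c \<in> Ghat"
  shows "rep_of c \<in> c" "rep_of c \<in> irreps mul"
proof -
  have "c \<noteq> {}"
    using assms equiv_rep_equiv unfolding unitary_dual_def by (rule in_quotient_imp_non_empty[rotated])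
  then show "rep_of c \<in> c" unfolding rep_of_def by (simp add: some_in_eq)
  then show "rep_of c \<in> irreps mul"
    using in_quotient_imp_subset[OF equiv_rep_equiv] assms by (auto simp: unitary_dual_def)
qed

lemma unitary_dual_rep:
  assumes "c \<in> Ghat"
  obtains \<pi> where "(dim_cls c, \<pi>) \<in> irreps mul" "(dim_cls c, \<pi>) = rep_of c"
    "unitary_rep mul (dim_cls c) \<pi>" "char_cls c = (\<lambda>g. \<Sum>i<dim_cls c. \<pi> g $$ (i,i))" "dim_cls c > 0"
proof -
  define \<pi> where "\<pi> = snd (rep_of c)"
  have eq: "(dim_cls c, \<pi>) = rep_of c" by (simp add: \<pi>_def dim_cls_def)
  then have irr: "(dim_cls c, \<pi>) \<in> irreps mul" using rep_of_in_class[OF assms] by simp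
  then have "unitary_rep mul (dim_cls c) \<pi>" "dim_cls c > 0"
    by (auto simp: irreps_def irreducible_rep_def)
  with eq irr show thesis
    by (intro that) (auto simp: fun_eq_iff char_cls_def mat_trace_rep \<pi>_def[symmetric])
qed

lemma continuous_char: "c \<in> Ghat \<Longrightarrow> cts (char_cls c)"
proof -
  assume "c \<in> Ghat"
  then obtain \<pi> where \<pi>: "unitary_rep mul (dim_cls c) \<pi>" "char_cls c = (\<lambda>g. \<Sum>i<dim_cls c. \<pi> g $$ (i,i))"
    using unitary_dual_rep by blast
  have "cts (\<lambda>g. \<Sum>i<dim_cls c. \<pi> g $$ (i,i))"
    by (intro continuous_intros unitary_rep_continuous[OF \<pi>(1)]) auto
  then show ?thesis by (simp add: \<pi>(2))
qed

text \<open>As \<open>\<chi>(k\<^sup>-\<^sup>1)\<close> is the conjugate of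
  \<open>\<chi>(k)\<close>, this says that the functions
  \<open>d\<^sub>\<pi> \<chi>\<^sub>\<pi>\<close> are mutually orthogonal convolution idempotents.
  Writing \<open>\<chi>(k u)\<close> as the trace of a matrix product reduces it to Schur
  orthogonality.\<close>

lemma char_convolution:
  assumes c1: "c1 \<in> Ghat" and c2: "c2 \<in> Ghat"
  shows "(\<integral>k. char_cls c1 (mul k u) * cnj (char_cls c2 k) \<partial>H)
    = (if c1 = c2 then char_cls c1 u / of_nat (dim_cls c1) else 0)"
proof -
  obtain \<pi> where \<pi>: "(dim_cls c1, \<pi>) \<in> irreps mul" "(dim_cls c1, \<pi>) = rep_of c1"
    "unitary_rep mul (dim_cls c1) \<pi>" "char_cls c1 = (\<lambda>g. \<Sum>i<dim_cls c1. \<pi> g $$ (i,i))" "dim_cls c1 > 0"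
    by (rule unitary_dual_rep[OF c1])
  obtain \<sigma> where \<sigma>: "(dim_cls c2, \<sigma>) \<in> irreps mul" "(dim_cls c2, \<sigma>) = rep_of c2"
    "unitary_rep mul (dim_cls c2) \<sigma>" "char_cls c2 = (\<lambda>g. \<Sum>i<dim_cls c2. \<sigma> g $$ (i,i))" "dim_cls c2 > 0"
    by (rule unitary_dual_rep[OF c2])
  let ?d = "dim_cls c1" and ?d' = "dim_cls c2"
  have "(\<integral>k. char_cls c1 (mul k u) * cnj (char_cls c2 k) \<partial>H) =
      (\<integral>k. (\<Sum>i<?d. \<Sum>j<?d. \<Sum>l<?d'. \<pi> u $$ (j,i) * (\<pi> k $$ (i,j) * cnj (\<sigma> k $$ (l,l)))) \<partial>H)"
    by (simp add: \<pi>(4) \<sigma>(4) unitary_rep_index_mul[OF \<pi>(3)] sum_distrib_left sum_distrib_right mult_ac)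
  also have "\<dots> = (\<Sum>i<?d. \<Sum>j<?d. \<Sum>l<?d'. \<integral>k. \<pi> u $$ (j,i) * (\<pi> k $$ (i,j) * cnj (\<sigma> k $$ (l,l))) \<partial>H)"
    by (intro trans[OF Bochner_Integration.integral_sum] sum.cong refl continuous_integrable
        continuous_intros unitary_rep_continuous[OF \<pi>(3)] unitary_rep_continuous[OF \<sigma>(3)]) auto
  also have "\<dots> = (\<Sum>i<?d. \<Sum>j<?d. \<Sum>l<?d'. \<pi> u $$ (j,i) * (\<integral>k. \<pi> k $$ (i,j) * cnj (\<sigma> k $$ (l,l)) \<partial>H))"
    by simp
  also have "\<dots> = (if c1 = c2 then char_cls c1 u / of_nat ?d else 0)"
  proof (cases "c1 = c2")
    case True
    then have eq: "\<sigma> = \<pi>" using \<pi>(2) \<sigma>(2) by (metis prod.inject)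
    have inner: "(\<Sum>l<?d. \<pi> u $$ (j,i) * (\<integral>k. \<pi> k $$ (i,j) * cnj (\<pi> k $$ (l,l)) \<partial>H)) =
       (if j = i then \<pi> u $$ (j,i) / of_nat ?d else 0)" if "i < ?d" "j < ?d" for i j
    proof -
      have "(\<Sum>l<?d. \<pi> u $$ (j,i) * (\<integral>k. \<pi> k $$ (i,j) * cnj (\<pi> k $$ (l,l)) \<partial>H)) =
        (\<Sum>l<?d. if l = i then (if j = i then \<pi> u $$ (j,i) / of_nat ?d else 0) else 0)"
        using that by (intro sum.cong) (auto simp: Schur_orthogonality_same[OF \<pi>(1)])
      then show ?thesis using that by (simp add: sum.delta)
    qed
    have "(\<Sum>i<?d. \<Sum>j<?d. \<Sum>l<?d. \<pi> u $$ (j,i) * (\<integral>k. \<pi> k $$ (i,j) * cnj (\<pi> k $$ (l,l)) \<partial>H))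
        = (\<Sum>i<?d. \<Sum>j<?d. if j = i then \<pi> u $$ (j,i) / of_nat ?d else 0)"
      by (intro sum.cong refl inner) auto
    also have "\<dots> = char_cls c1 u / of_nat ?d"
      by (simp add: \<pi>(4) sum.delta sum_divide_distrib)
    finally show ?thesis using True eq by simp
  next
    case False
    have "((dim_cls c1, \<pi>), (dim_cls c2, \<sigma>)) \<notin> rep_equiv mul"
    proof
      assume "((dim_cls c1, \<pi>), (dim_cls c2, \<sigma>)) \<in> rep_equiv mul"
      then have "(rep_of c1, rep_of c2) \<in> rep_equiv mul" using \<pi>(2) \<sigma>(2) by simp
      then have "c1 = c2"
        using c1 c2 unfolding unitary_dual_def
        by (intro quotient_eqI[OF equiv_rep_equiv _ _ rep_of_in_class(1)[OF c1] rep_of_in_class(1)[OF c2]])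
      with False show False ..
    qed
    then show ?thesis using False
      by (simp add: Schur_orthogonality_inequivalent[OF \<pi>(1) \<sigma>(1)])
  qed
  finally show ?thesis .
qed

text \<open>\<open>char_cls\<close> is computed from a chosen representative; conjugation invariance
  of the trace makes it the character of any given member of the class.\<close>

lemma irrep_class:
  assumes \<sigma>: "(d, \<sigma>) \<in> irreps mul"
  obtains c where "c \<in> Ghat" "dim_cls c = d" "\<And>g. char_cls c g = mat_trace (\<sigma> g)"
proof -
  define c where "c = rep_equiv mul `` {(d, \<sigma>)}"
  have c: "c \<in> Ghat" using \<sigma> by (auto simp: c_def unitary_dual_def intro: quotientI)
  obtain \<pi> where \<pi>: "(dim_cls c, \<pi>) \<in> irreps mul" "(dim_cls c, \<pi>) = rep_of c"
    "unitary_rep mul (dim_cls c) \<pi>"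
    using unitary_dual_rep[OF c] by blast
  have "((d, \<sigma>), (dim_cls c, \<pi>)) \<in> rep_equiv mul"
    using rep_of_in_class(1)[OF c] \<pi>(2) by (simp add: c_def)
  then obtain T where T: "d = dim_cls c" "T \<in> carrier_mat d d" "invertible_mat T" "\<And>g. T * \<sigma> g = \<pi> g * T"
    by (auto simp: rep_equiv_def)
  obtain U where U: "U \<in> carrier_mat d d" "T * U = 1\<^sub>m d" "U * T = 1\<^sub>m d"
    using invertible_mat_inverse[OF T(2,3)] by blast
  have car: "\<sigma> g \<in> carrier_mat d d" "\<pi> g \<in> carrier_mat d d" for g
    using \<sigma> \<pi>(3) T(1) by (auto simp: irreps_def unitary_rep_def)
  have "char_cls c g = mat_trace (\<sigma> g)" for g
  proof -
    have "char_cls c g = mat_trace (\<pi> g)" by (simp add: char_cls_def flip: \<pi>(2))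
    also have "\<pi> g = \<pi> g * (T * U)" using car[of g] U by simp
    also have "\<dots> = (T * \<sigma> g) * U"
      unfolding T(4) using car[of g] T U by (intro assoc_mult_mat[symmetric, of _ d d _ d _ d]) auto
    also have "mat_trace \<dots> = mat_trace (U * (T * \<sigma> g))"
      using car[of g] T U by (intro mat_trace_mult_commute[of _ d d]) auto
    also have "U * (T * \<sigma> g) = (U * T) * \<sigma> g"
      using car[of g] T U by (intro assoc_mult_mat[symmetric, of _ d d _ d _ d]) auto
    also have "\<dots> = \<sigma> g" using car[of g] U by simp
    finally show ?thesis .
  qed
  with c T(1) show thesis by (intro that) auto
qed

text \<open>Matrix coefficients are fixed by convolution with \<open>d \<chi>\<close> of their own
  representation, so a nonzero combination of them cannot be annihilated by that character. This
  yields the contradiction in \<open>Peter_Weyl_continuous\<close>.\<close>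

lemma char_reproduces_coefficients:
  assumes \<sigma>: "(d, \<sigma>) \<in> irreps mul" and ij: "i < d" "j < d"
  shows "of_nat d * (\<integral>h. mat_trace (\<sigma> h) * \<sigma> (mul (ginv h) x) $$ (i,j) \<partial>H) = \<sigma> x $$ (i,j)"
proof -
  have u: "unitary_rep mul d \<sigma>" using \<sigma> by (simp add: irreps_def)
  have "(\<integral>h. mat_trace (\<sigma> h) * \<sigma> (mul (ginv h) x) $$ (i,j) \<partial>H)
     = (\<integral>h. (\<Sum>k<d. \<Sum>l<d. \<sigma> x $$ (k,j) * (\<sigma> h $$ (l,l) * cnj (\<sigma> h $$ (k,i)))) \<partial>H)"
    using ij by (simp add: mat_trace_rep[OF u] unitary_rep_index_mul[OF u] unitary_rep_index_ginv[OF u]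
        sum_distrib_left sum_distrib_right mult_ac)
  also have "\<dots> = (\<Sum>k<d. \<Sum>l<d. \<integral>h. \<sigma> x $$ (k,j) * (\<sigma> h $$ (l,l) * cnj (\<sigma> h $$ (k,i))) \<partial>H)"
    using ij by (intro trans[OF Bochner_Integration.integral_sum] sum.cong refl continuous_integrable
        continuous_intros unitary_rep_continuous[OF u]) auto
  also have "\<dots> = (\<Sum>k<d. if k = i then \<sigma> x $$ (i,j) / of_nat d else 0)"
  proof (rule sum.cong)
    fix k assume "k \<in> {..<d}"
    then have "(\<Sum>l<d. \<integral>h. \<sigma> x $$ (k,j) * (\<sigma> h $$ (l,l) * cnj (\<sigma> h $$ (k,i))) \<partial>H) =
      (\<Sum>l<d. if l = k then (if k = i then \<sigma> x $$ (i,j) / of_nat d else 0) else 0)"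
      using ij by (intro sum.cong) (auto simp: Schur_orthogonality_same[OF \<sigma>])
    then show "(\<Sum>l<d. \<integral>h. \<sigma> x $$ (k,j) * (\<sigma> h $$ (l,l) * cnj (\<sigma> h $$ (k,i))) \<partial>H) =
      (if k = i then \<sigma> x $$ (i,j) / of_nat d else 0)"
      using \<open>k \<in> {..<d}\<close> by (simp add: sum.delta)
  qed simp
  also have "\<dots> = \<sigma> x $$ (i,j) / of_nat d" using ij by (simp add: sum.delta)
  finally show ?thesis using ij by simp
qed

end

section \<open>Isotypic components of an action\<close>

context haar_group
begin

lemma continuous_comp:
  fixes F :: "'g \<Rightarrow> 'b::topological_space"
  assumes "cts F" "continuous_on A t"
  shows "continuous_on A (\<lambda>x. F (t x))"
  by (rule continuous_on_compose2[OF assms]) simp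

sublocale HH: pair_prob_space H H ..

lemma continuous_integrable_prod:
  fixes F :: "'g \<Rightarrow> 'g \<Rightarrow> complex"
  assumes F: "continuous_on UNIV (\<lambda>p. F (fst p) (snd p))"
  shows "integrable (H \<Otimes>\<^sub>M H) (\<lambda>(h, k). F h k)"
proof -
  \<comment> \<open>Second countability identifies the product of the Borel sigma-algebras with the
    Borel sets of the product, so joint continuity gives joint measurability.\<close>
  have "sets (H \<Otimes>\<^sub>M H) = sets (borel :: ('g \<times> 'g) measure)"
    unfolding borel_prod[symmetric] by (intro sets_pair_measure_cong sets_H)
  then have meas: "(\<lambda>(h, k). F h k) \<in> borel_measurable (H \<Otimes>\<^sub>M H)"
    using borel_measurable_continuous_onI[OF F] by (simp add: case_prod_unfold cong: measurable_cong_sets)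
  have "compact (UNIV :: ('g \<times> 'g) set)"
    using compact_Times[OF compact_UNIV_group compact_UNIV_group] by simp
  then have "bounded (range (\<lambda>p. F (fst p) (snd p)))"
    using compact_continuous_image[OF F] compact_imp_bounded by blast
  then obtain B where "\<And>p. cmod (F (fst p) (snd p)) \<le> B" by (meson bounded_iff rangeI)
  then show ?thesis
    by (intro HH.integrable_const_bound[where B = B] meas AE_I2) (auto simp: case_prod_unfold)
qed

lemma continuous_Fubini:
  fixes F :: "'g \<Rightarrow> 'g \<Rightarrow> complex"
  assumes F: "continuous_on UNIV (\<lambda>p. F (fst p) (snd p))"
  shows "(\<integral>k. (\<integral>h. F h k \<partial>H) \<partial>H) = (\<integral>h. (\<integral>k. F h k \<partial>H) \<partial>H)"
  by (rule HH.Fubini_integral[OF continuous_integrable_prod[OF F]])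

end

text \<open>Invariance is recorded as equality of image measures, a form that passes to products.
  The locale is interpreted twice, for \<open>Y\<close> and for the product of the probability space
  with \<open>Y\<close>.\<close>

locale haar_action = haar_group mul ginv e H
  for mul :: "'g::{t2_space, second_countable_topology} \<Rightarrow> 'g \<Rightarrow> 'g" and ginv e H +
  fixes act :: "'g \<Rightarrow> 'x \<Rightarrow> 'x" and M :: "'x measure"
  assumes sigma_finite_M: "sigma_finite_measure M"
    and act_measurable[measurable]: "(\<lambda>(g, x). act g x) \<in> measurable (H \<Otimes>\<^sub>M M) M"
    and act_mul: "\<And>g h x. x \<in> space M \<Longrightarrow> act (mul g h) x = act g (act h x)"
    and distr_act: "\<And>g. distr M M (act g) = M"
begin

sublocale M: sigma_finite_measure M by (rule sigma_finite_M)
sublocale HM: pair_sigma_finite H M ..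

lemma measurable_act[measurable]: "act g \<in> measurable M M"
  using measurable_compose[OF measurable_Pair1'[of g H M] act_measurable] by simp

lemma measurable_act_comp[measurable (raw)]:
  assumes "k \<in> measurable N borel" "x \<in> measurable N M"
  shows "(\<lambda>w. act (k w) (x w)) \<in> measurable N M"
proof -
  have "k \<in> measurable N H" using assms(1) by (simp add: measurable_H)
  from measurable_compose[OF measurable_Pair[OF this assms(2)] act_measurable]
  show ?thesis by simp
qed

lemma L2_act: "square_integrable M f \<Longrightarrow> square_integrable M (\<lambda>x. f (act g x))"
  and l2_sq_act: "square_integrable M f \<Longrightarrow> l2_sq M (\<lambda>x. f (act g x)) = l2_sq M f"
  by (simp_all add: L2_distr[OF measurable_act distr_act])

lemma l2_inner_act:
  assumes "square_integrable M f" "square_integrable M f'"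
  shows "l2_inner M (\<lambda>x. f (act g x)) (\<lambda>x. f' (act g x)) = l2_inner M f f'"
proof -
  have [measurable]: "f \<in> borel_measurable M" "f' \<in> borel_measurable M"
    using assms by (auto simp: square_integrable_def)
  show ?thesis unfolding l2_inner_def
    by (subst (2) distr_act[of g, symmetric], subst integral_distr) auto
qed

text \<open>The action axioms do not include \<open>act e x = x\<close>. Since \<open>act e\<close> is idempotent, \<open>f - f \<circ> act e\<close>
  vanishes on its range, and invariance of the measure turns this into an almost everywhere statement.\<close>

lemma act_e_AE:
  assumes f: "square_integrable M f"
  shows "AE x in M. f (act e x) = f x"
proof -
  let ?d = "\<lambda>x. f x - f (act e x)"
  have d: "square_integrable M ?d" by (intro L2_diff f L2_act)
  have "l2_sq M ?d = l2_sq M (\<lambda>x. ?d (act e x))" by (rule l2_sq_act[OF d, symmetric])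
  also have "\<dots> = 0"
    unfolding l2_sq_def
    by (rule trans[OF Bochner_Integration.integral_cong[OF refl, of _ _ "\<lambda>x. 0"]])
      (simp_all add: act_mul[symmetric])
  finally have "AE x in M. (cmod (?d x))\<^sup>2 = 0"
    using d unfolding l2_sq_def square_integrable_def
    by (subst (asm) integral_nonneg_eq_0_iff_AE) auto
  then show ?thesis by auto
qed

lemma l2_inner_act_e_left:
  assumes "square_integrable M f" "square_integrable M f'"
  shows "l2_inner M (\<lambda>x. f (act e x)) f' = l2_inner M f f'"
proof (rule l2_inner_cong_AE)
  show "AE x in M. f (act e x) = f x" by (rule act_e_AE[OF assms(1)])
qed (use assms in \<open>auto simp: L2_act L2_measurable\<close>)

text \<open>Unitarity of the action: translate both arguments by \<open>ginv g\<close>, then remove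
  the remaining \<open>act e\<close> up to a null set.\<close>

lemma l2_inner_act_left:
  assumes f: "square_integrable M f" "square_integrable M f'"
  shows "l2_inner M (\<lambda>x. f (act g x)) f' = l2_inner M f (\<lambda>x. f' (act (ginv g) x))"
proof -
  have "l2_inner M (\<lambda>x. f (act g x)) f'
      = l2_inner M (\<lambda>x. f (act g (act (ginv g) x))) (\<lambda>x. f' (act (ginv g) x))"
    by (rule l2_inner_act[symmetric]) (intro f L2_act)+
  also have "\<dots> = l2_inner M (\<lambda>x. f (act e x)) (\<lambda>x. f' (act (ginv g) x))"
    by (rule l2_inner_cong) (simp_all flip: act_mul)
  also have "\<dots> = l2_inner M f (\<lambda>x. f' (act (ginv g) x))"
    by (rule l2_inner_act_e_left) (intro f L2_act)+
  finally show ?thesis .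
qed

text \<open>By invariance every section in \<open>h\<close> has the norm of \<open>f\<close>, and
  \<open>H\<close> has mass 1. The map \<open>T\<close> stands for the identity, a left translation
  or the inversion.\<close>

lemma L2_orbit:
  assumes f: "square_integrable M f" and T[measurable]: "T \<in> measurable borel borel"
  shows "square_integrable (H \<Otimes>\<^sub>M M) (\<lambda>(h, x). f (act (T h) x))"
proof -
  have [measurable]: "f \<in> borel_measurable M" using f by (simp add: square_integrable_def)
  have [measurable]: "fst \<in> measurable (H \<Otimes>\<^sub>M M) borel"
    using measurable_fst[of H M] by (simp add: measurable_H)
  have meas: "(\<lambda>p. f (act (T (fst p)) (snd p))) \<in> borel_measurable (H \<Otimes>\<^sub>M M)"
    by measurable
  have "integrable (H \<Otimes>\<^sub>M M) (\<lambda>p. (cmod (f (act (T (fst p)) (snd p))))\<^sup>2)"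
  proof (rule HM.Fubini_integrable)
    show "(\<lambda>p. (cmod (f (act (T (fst p)) (snd p))))\<^sup>2) \<in> borel_measurable (H \<Otimes>\<^sub>M M)"
      using meas by measurable
    have "(\<integral>x. (cmod (f (act (T h) x)))\<^sup>2 \<partial>M) = l2_sq M f" for h
      using l2_sq_act[OF f, of "T h"] by (simp add: l2_sq_def)
    then show "integrable H (\<lambda>h. \<integral>x. norm ((cmod (f (act (T (fst (h, x))) (snd (h, x)))))\<^sup>2) \<partial>M)"
      by simp
    show "AE h in H. integrable M (\<lambda>x. (cmod (f (act (T (fst (h, x))) (snd (h, x)))))\<^sup>2)"
      using L2_act[OF f] by (simp add: square_integrable_def)
  qed
  then show ?thesis using meas by (simp add: square_integrable_def case_prod_unfold)
qed

lemma AE_L2_orbit: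
  assumes f: "square_integrable M f" and T[measurable]: "T \<in> measurable borel borel"
  shows "AE x in M. square_integrable H (\<lambda>h. f (act (T h) x))"
    and "integrable M (\<lambda>x. l2_sq H (\<lambda>h. f (act (T h) x)))"
proof -
  have [measurable]: "f \<in> borel_measurable M" using f by (simp add: square_integrable_def)
  have int: "integrable (H \<Otimes>\<^sub>M M) (\<lambda>(h, x). (cmod (f (act (T h) x)))\<^sup>2)"
    using L2_orbit[OF assms] by (simp add: square_integrable_def case_prod_unfold)
  have meas: "(\<lambda>h. f (act (T h) x)) \<in> borel_measurable H" if "x \<in> space M" for x
    using that by (simp add: measurable_H)
  show "AE x in M. square_integrable H (\<lambda>h. f (act (T h) x))"
    using HM.AE_integrable_snd[OF int] meas by (auto simp: square_integrable_def)
  show "integrable M (\<lambda>x. l2_sq H (\<lambda>h. f (act (T h) x)))"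
    using HM.integrable_snd[OF int] by (simp add: l2_sq_def)
qed

definition coef :: "('x \<Rightarrow> complex) \<Rightarrow> ('x \<Rightarrow> complex) \<Rightarrow> 'g \<Rightarrow> complex" where
  "coef f f' g = l2_inner M (\<lambda>x. f (act g x)) f'"

text \<open>Averaging over translates by \<open>h\<close> writes the coefficient as the integral over \<open>x\<close> of the
  coefficients of the translation action on the orbit functions \<open>h \<mapsto> f (h x)\<close>, which are continuous.\<close>

lemma continuous_coef:
  assumes f: "square_integrable M f" and f': "square_integrable M f'"
  shows "cts (coef f f')"
proof -
  let ?F = "\<lambda>g x. l2_inner H (\<lambda>h. f (act (mul g h) x)) (\<lambda>h. f' (act h x))"
  have id[measurable]: "(\<lambda>h::'g. h) \<in> measurable borel borel" by simp
  have tr[measurable]: "mul g \<in> measurable borel borel" for g by measurable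
  have int: "integrable (H \<Otimes>\<^sub>M M) (\<lambda>(h, x). f (act (mul g h) x) * cnj (f' (act h x)))" for g
    using integrable_l2_inner[OF L2_orbit[OF f tr] L2_orbit[OF f' id]]
    by (simp add: case_prod_unfold)
  have eq: "coef f f' g = (\<integral>x. ?F g x \<partial>M)" for g
  proof -
    have c: "(\<integral>x. f (act (mul g h) x) * cnj (f' (act h x)) \<partial>M) = coef f f' g" for h
    proof -
      have "coef f f' g = l2_inner M (\<lambda>x. f (act g (act h x))) (\<lambda>x. f' (act h x))"
        unfolding coef_def by (rule l2_inner_act[symmetric]) (intro f f' L2_act)+
      also have "\<dots> = (\<integral>x. f (act (mul g h) x) * cnj (f' (act h x)) \<partial>M)"
        unfolding l2_inner_def by (rule Bochner_Integration.integral_cong) (simp_all add: act_mul)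
      finally show ?thesis by simp
    qed
    have "coef f f' g = (\<integral>h. (\<integral>x. f (act (mul g h) x) * cnj (f' (act h x)) \<partial>M) \<partial>H)"
      unfolding c using H.prob_space by simp
    also have "\<dots> = (\<integral>x. ?F g x \<partial>M)"
      unfolding l2_inner_def by (rule HM.Fubini_integral[OF int, symmetric])
    finally show ?thesis .
  qed
  have "cts (\<lambda>g. \<integral>x. ?F g x \<partial>M)"
  proof (rule continuous_on_integral_dominated)
    show "?F g \<in> borel_measurable M" for g
      using HM.integrable_snd[OF int[of g]] by (auto simp: l2_inner_def)
    show "integrable M (\<lambda>x. l2_sq H (\<lambda>h. f (act h x)) + l2_sq H (\<lambda>h. f' (act h x)))"
      by (intro Bochner_Integration.integrable_add AE_L2_orbit f f' id)
    show "AE x in M. cts (\<lambda>g. ?F g x)"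
      using AE_L2_orbit(1)[OF f id] AE_L2_orbit(1)[OF f' id]
    proof eventually_elim
      case (elim x)
      then show ?case using translation_continuous_all[OF elim(1)] by (simp add: translation_continuous_def)
    qed
    show "AE x in M. norm (?F g x) \<le> l2_sq H (\<lambda>h. f (act h x)) + l2_sq H (\<lambda>h. f' (act h x))" for g
      using AE_L2_orbit(1)[OF f id] AE_L2_orbit(1)[OF f' id]
    proof eventually_elim
      case (elim x)
      let ?a = "l2_sq H (\<lambda>h. f (act h x))" and ?b = "l2_sq H (\<lambda>h. f' (act h x))"
      have "(cmod (?F g x))\<^sup>2 \<le> ?a * ?b"
        using l2_Cauchy_Schwarz[OF L2_translate[OF elim(1), of g] elim(2)]
          l2_sq_translate[OF elim(1), of g] by simp
      also have "\<dots> \<le> (?a + ?b)\<^sup>2"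
        using l2_sq_nonneg[of H "\<lambda>h. f (act h x)"] l2_sq_nonneg[of H "\<lambda>h. f' (act h x)"]
        by (simp add: power2_sum)
      finally show ?case
        using l2_sq_nonneg[of H "\<lambda>h. f (act h x)"] l2_sq_nonneg[of H "\<lambda>h. f' (act h x)"]
        by (rule power2_le_imp_le[OF _ add_nonneg_nonneg])
    qed
  qed
  then show ?thesis by (simp add: eq[abs_def])
qed

text \<open>Where the integrand is not integrable the Bochner integral is 0 by convention; for
  square integrable \<open>f\<close>, \<open>AE_L2_orbit\<close> confines this to a null
  set.\<close>

definition isotypic :: "(nat \<times> ('g \<Rightarrow> complex mat)) set \<Rightarrow> ('x \<Rightarrow> complex) \<Rightarrow> 'x \<Rightarrow> complex" where
  "isotypic c f x = of_nat (dim_cls c) * (\<integral>h. char_cls c h * f (act (ginv h) x) \<partial>H)"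

context
  fixes c assumes c: "c \<in> Ghat"
begin

lemma L2_char_orbit:
  assumes f: "square_integrable M f"
  shows "square_integrable (H \<Otimes>\<^sub>M M) (\<lambda>(h, x). char_cls c h * f (act (ginv h) x))"
proof -
  have [measurable]: "char_cls c \<in> borel_measurable borel"
    using continuous_measurable_H[OF continuous_char[OF c]] by (simp add: measurable_H)
  have [measurable]: "fst \<in> measurable (H \<Otimes>\<^sub>M M) borel"
    using measurable_fst[of H M] by (simp add: measurable_H)
  have [measurable]: "f \<in> borel_measurable M" using f by (simp add: square_integrable_def)
  obtain B where B: "B > 0" "\<And>h. cmod (char_cls c h) \<le> B"
    using continuous_bounded[OF continuous_char[OF c]] by blast
  have o: "square_integrable (H \<Otimes>\<^sub>M M) (\<lambda>p. f (act (ginv (fst p)) (snd p)))"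
    using L2_orbit[OF f measurable_ginv] by (simp add: case_prod_unfold)
  have meas: "(\<lambda>p. char_cls c (fst p) * f (act (ginv (fst p)) (snd p))) \<in> borel_measurable (H \<Otimes>\<^sub>M M)"
    by measurable
  have "integrable (H \<Otimes>\<^sub>M M) (\<lambda>p. (cmod (char_cls c (fst p) * f (act (ginv (fst p)) (snd p))))\<^sup>2)"
  proof (rule Bochner_Integration.integrable_bound)
    show "integrable (H \<Otimes>\<^sub>M M) (\<lambda>p. B\<^sup>2 * (cmod (f (act (ginv (fst p)) (snd p))))\<^sup>2)"
      using o by (simp add: square_integrable_def)
    show "AE p in H \<Otimes>\<^sub>M M. norm ((cmod (char_cls c (fst p) * f (act (ginv (fst p)) (snd p))))\<^sup>2)
        \<le> norm (B\<^sup>2 * (cmod (f (act (ginv (fst p)) (snd p))))\<^sup>2)"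
      using B by (auto simp: norm_mult power_mult_distrib intro!: mult_right_mono power_mono)
  qed (use meas in measurable)
  then show ?thesis using meas by (simp add: square_integrable_def case_prod_unfold)
qed

text \<open>Cauchy-Schwarz over the group bounds the squared integral at \<open>x\<close> by a
  constant times the squared norm of the orbit function of \<open>x\<close>, which is integrable in
  \<open>x\<close>.\<close>

lemma L2_isotypic:
  assumes f: "square_integrable M f"
  shows "square_integrable M (isotypic c f)"
proof -
  have [measurable]: "char_cls c \<in> borel_measurable H"
    by (rule continuous_measurable_H[OF continuous_char[OF c]])
  have [measurable]: "f \<in> borel_measurable M" using f by (simp add: square_integrable_def)
  have meas: "(\<lambda>x. \<integral>h. char_cls c h * f (act (ginv h) x) \<partial>H) \<in> borel_measurable M"
  proof (rule H.borel_measurable_lebesgue_integral)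
    have "(\<lambda>p. (snd p, fst p)) \<in> measurable (M \<Otimes>\<^sub>M H) (H \<Otimes>\<^sub>M M)" by measurable
    from measurable_compose[OF this L2_measurable[OF L2_char_orbit[OF f]]]
    show "(\<lambda>(x, h). char_cls c h * f (act (ginv h) x)) \<in> borel_measurable (M \<Otimes>\<^sub>M H)"
      by (simp add: case_prod_unfold)
  qed
  have cs: "square_integrable H (\<lambda>h. cnj (char_cls c h))"
    using continuous_L2[of "\<lambda>h. cnj (char_cls c h)"] continuous_char[OF c]
    by (auto intro: continuous_intros)
  let ?C = "l2_sq H (\<lambda>h. cnj (char_cls c h))"
  have "integrable M (\<lambda>x. (cmod (\<integral>h. char_cls c h * f (act (ginv h) x) \<partial>H))\<^sup>2)"
  proof (rule Bochner_Integration.integrable_bound)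
    show "integrable M (\<lambda>x. l2_sq H (\<lambda>h. f (act (ginv h) x)) * ?C)"
      by (intro integrable_mult_left AE_L2_orbit f measurable_ginv)
    show "AE x in M. norm ((cmod (\<integral>h. char_cls c h * f (act (ginv h) x) \<partial>H))\<^sup>2)
       \<le> norm (l2_sq H (\<lambda>h. f (act (ginv h) x)) * ?C)"
      using AE_L2_orbit(1)[OF f measurable_ginv]
    proof eventually_elim
      case (elim x)
      show ?case
        using l2_Cauchy_Schwarz[OF elim cs] by (simp add: l2_inner_def mult.commute abs_mult l2_sq_nonneg)
    qed
  qed (use meas in measurable)
  then have "square_integrable M (\<lambda>x. \<integral>h. char_cls c h * f (act (ginv h) x) \<partial>H)"
    using meas by (simp add: square_integrable_def)
  from L2_scale[OF this, of "of_nat (dim_cls c)"]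
  show ?thesis by (simp add: isotypic_def[abs_def])
qed

text \<open>Fubini trades the component, defined only through integrals over orbits, for an integral
  of the character against a continuous function on the group. Later statements about components are
  proved on that side.\<close>

lemma l2_inner_isotypic_left:
  assumes f: "square_integrable M f" and f': "square_integrable M f'"
  shows "l2_inner M (isotypic c f) f'
    = of_nat (dim_cls c) * (\<integral>h. char_cls c h * coef f f' (ginv h) \<partial>H)"
proof -
  have [measurable]: "f' \<in> borel_measurable M" using f' by (simp add: square_integrable_def)
  have B: "square_integrable (H \<Otimes>\<^sub>M M) (\<lambda>p. f' (snd p))"
  proof -
    have "integrable (H \<Otimes>\<^sub>M M) (\<lambda>p. (cmod (f' (snd p)))\<^sup>2)"
      by (rule HM.Fubini_integrable) (use f' in \<open>auto simp: square_integrable_def\<close>)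
    then show ?thesis by (simp add: square_integrable_def)
  qed
  have int: "integrable (H \<Otimes>\<^sub>M M) (\<lambda>(h, x). char_cls c h * f (act (ginv h) x) * cnj (f' x))"
    using integrable_l2_inner[OF L2_char_orbit[OF f] B] by (simp add: case_prod_unfold)
  have "l2_inner M (isotypic c f) f'
      = of_nat (dim_cls c) * (\<integral>x. (\<integral>h. char_cls c h * f (act (ginv h) x) * cnj (f' x) \<partial>H) \<partial>M)"
    unfolding l2_inner_def isotypic_def by (simp add: mult.assoc[of "of_nat (dim_cls c)"])
  also have "(\<integral>x. (\<integral>h. char_cls c h * f (act (ginv h) x) * cnj (f' x) \<partial>H) \<partial>M)
      = (\<integral>h. (\<integral>x. char_cls c h * f (act (ginv h) x) * cnj (f' x) \<partial>M) \<partial>H)"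
    by (rule HM.Fubini_integral[OF int])
  also have "\<dots> = (\<integral>h. char_cls c h * coef f f' (ginv h) \<partial>H)"
    unfolding coef_def l2_inner_def by (simp add: mult.assoc)
  finally show ?thesis .
qed

end

lemma isotypic_act:
  assumes "x \<in> space M"
  shows "isotypic c f (act g x) = of_nat (dim_cls c) * (\<integral>h. char_cls c h * f (act (mul (ginv h) g) x) \<partial>H)"
  unfolding isotypic_def using assms by (simp add: act_mul)

text \<open>Unfolding both components gives a double integral of \<open>\<chi>\<^sub>1(h)\<close>,
  the conjugate of \<open>\<chi>\<^sub>2(k)\<close> and \<open>\<psi>(h\<^sup>-\<^sup>1 k)\<close>;
  after a substitution the inner integral is the one in \<open>char_convolution\<close>. The case
  \<open>c1 = c2\<close> encodes that the component map is a self-adjoint idempotent, and allowing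
  \<open>f1\<close> and \<open>f2\<close> to differ covers the mixed products of two
  processes.\<close>

lemma isotypic_orthogonality:
  assumes c1: "c1 \<in> unitary_dual mul" and c2: "c2 \<in> unitary_dual mul"
    and f1: "square_integrable M f1" and f2: "square_integrable M f2"
  shows "l2_inner M (isotypic c1 f1) (isotypic c2 f2) = (if c1 = c2 then l2_inner M (isotypic c1 f1) f2 else 0)"
proof -
  let ?d1 = "of_nat (dim_cls c1) :: complex" and ?d2 = "of_nat (dim_cls c2) :: complex"
  let ?ch1 = "char_cls c1" and ?ch2 = "char_cls c2" and ?\<psi> = "coef f1 f2"
  have d1: "?d1 \<noteq> 0" using unitary_dual_rep[OF c1] by (metis less_irrefl of_nat_eq_0_iff)
  note E1 = L2_isotypic[OF c1 f1] and E2 = L2_isotypic[OF c2 f2]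
  have cont: "continuous_on UNIV ?ch1" "continuous_on UNIV ?ch2" "continuous_on UNIV ?\<psi>"
    by (rule continuous_char[OF c1] continuous_char[OF c2] continuous_coef[OF f1 f2])+
  have inner: "coef f1 (isotypic c2 f2) (ginv h) = ?d2 * (\<integral>k. cnj (?ch2 k) * ?\<psi> (mul (ginv h) k) \<partial>H)" for h
  proof -
    have sq: "square_integrable M (\<lambda>x. f1 (act (ginv h) x))" by (rule L2_act[OF f1])
    \<comment> \<open>Unitarity moves \<open>k\<close> to the other argument, so that both group
      variables meet in a single coefficient.\<close>
    have pull: "cnj (coef f2 (\<lambda>x. f1 (act (ginv h) x)) (ginv k)) = ?\<psi> (mul (ginv h) k)" for k
    proof -
      have "cnj (coef f2 (\<lambda>x. f1 (act (ginv h) x)) (ginv k))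
          = cnj (l2_inner M f2 (\<lambda>x. f1 (act (ginv h) (act k x))))"
        unfolding coef_def by (subst l2_inner_act_left[OF f2 sq]) simp
      also have "\<dots> = ?\<psi> (mul (ginv h) k)"
        unfolding coef_def l2_inner_cnj by (rule l2_inner_cong) (simp_all add: act_mul)
      finally show ?thesis .
    qed
    have "coef f1 (isotypic c2 f2) (ginv h) = cnj (l2_inner M (isotypic c2 f2) (\<lambda>x. f1 (act (ginv h) x)))"
      by (simp add: coef_def l2_inner_cnj)
    also have "\<dots> = ?d2 * (\<integral>k. cnj (?ch2 k) * cnj (coef f2 (\<lambda>x. f1 (act (ginv h) x)) (ginv k)) \<partial>H)"
      by (simp add: l2_inner_isotypic_left[OF c2 f2 sq] flip: Bochner_Integration.integral_cnj)
    also have "\<dots> = ?d2 * (\<integral>k. cnj (?ch2 k) * ?\<psi> (mul (ginv h) k) \<partial>H)"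
      by (simp add: pull)
    finally show ?thesis .
  qed
  have "l2_inner M (isotypic c1 f1) (isotypic c2 f2)
      = ?d1 * ?d2 * (\<integral>h. (\<integral>k. ?ch1 h * (cnj (?ch2 k) * ?\<psi> (mul (ginv h) k)) \<partial>H) \<partial>H)"
    by (simp add: l2_inner_isotypic_left[OF c1 f1 E2] inner mult.assoc
        mult.left_commute[of "char_cls c1 _" "of_nat (dim_cls c2)"])
  also have "(\<integral>h. (\<integral>k. ?ch1 h * (cnj (?ch2 k) * ?\<psi> (mul (ginv h) k)) \<partial>H) \<partial>H)
      = (\<integral>k. (\<integral>h. ?ch1 h * (cnj (?ch2 k) * ?\<psi> (mul (ginv h) k)) \<partial>H) \<partial>H)"
    by (rule continuous_Fubini[symmetric])
      (intro continuous_intros continuous_comp[OF cont(1)] continuous_comp[OF cont(2)]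
        continuous_comp[OF cont(3)])
  \<comment> \<open>Replacing \<open>h\<close> by \<open>mul k h\<close> frees the coefficient of
    \<open>k\<close>, because \<open>mul (ginv (mul k h)) k = ginv h\<close>.\<close>
  also have "\<dots> = (\<integral>k. (\<integral>h. ?ch1 (mul k h) * (cnj (?ch2 k) * ?\<psi> (ginv h)) \<partial>H) \<partial>H)"
  proof (rule Bochner_Integration.integral_cong[OF refl])
    fix k
    have "(\<lambda>h. ?ch1 h * (cnj (?ch2 k) * ?\<psi> (mul (ginv h) k))) \<in> borel_measurable H"
      by (intro continuous_measurable_H continuous_intros continuous_comp[OF cont(1)]
        continuous_comp[OF cont(3)])
    from integral_mul_left[OF this, of k]
    show "(\<integral>h. ?ch1 h * (cnj (?ch2 k) * ?\<psi> (mul (ginv h) k)) \<partial>H)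
        = (\<integral>h. ?ch1 (mul k h) * (cnj (?ch2 k) * ?\<psi> (ginv h)) \<partial>H)"
      by (simp add: ginv_mul)
  qed
  also have "\<dots> = (\<integral>h. (\<integral>k. ?ch1 (mul k h) * (cnj (?ch2 k) * ?\<psi> (ginv h)) \<partial>H) \<partial>H)"
    by (rule continuous_Fubini)
      (intro continuous_intros continuous_comp[OF cont(1)] continuous_comp[OF cont(2)]
        continuous_comp[OF cont(3)])
  also have "\<dots> = (\<integral>h. (\<integral>k. ?ch1 (mul k h) * cnj (?ch2 k) \<partial>H) * ?\<psi> (ginv h) \<partial>H)"
    by (simp flip: mult.assoc)
  also have "\<dots> = (if c1 = c2 then (\<integral>h. ?ch1 h * ?\<psi> (ginv h) \<partial>H) / ?d1 else 0)"
    by (simp add: char_convolution[OF c1 c2])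
  finally show ?thesis
    using d1 l2_inner_isotypic_left[OF c1 f1 f2] by (cases "c1 = c2") simp_all
qed

end

section \<open>Convolution and spectral idempotents\<close>

text \<open>Log-convexity makes the ratios of successive terms increase, and submultiplicativity
  bounds them by \<open>b 0\<close>; \<open>l\<close> is their limit. As no ratio exceeds
  \<open>l\<close>, the normalised sequence decreases, and \<open>b_ge\<close> keeps it at least
  1.\<close>

lemma log_convex_submultiplicative_limit:
  fixes b :: "nat \<Rightarrow> real"
  assumes pos: "\<And>n. b n > 0" and lc: "\<And>n. (b (Suc n))\<^sup>2 \<le> b n * b (Suc (Suc n))"
    and sub: "\<And>m n. b (Suc (m + n)) \<le> b m * b n"
  obtains l c where "l > 0" "c \<ge> 1" "(\<lambda>n. b n / l ^ Suc n) \<longlonglongrightarrow> c"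
proof -
  define r where "r n = b (Suc n) / b n" for n
  have r_pos: "r n > 0" for n using pos by (simp add: r_def)
  have "r n \<le> r (Suc n)" for n
    using lc[of n] pos[of n] pos[of "Suc n"] by (simp add: r_def field_simps power2_eq_square)
  then have inc: "incseq r" by (rule incseq_SucI)
  have r_le: "r n \<le> b 0" for n using sub[of 0 n] pos[of n] by (simp add: r_def field_simps)
  obtain l where l: "r \<longlonglongrightarrow> l" "\<And>n. r n \<le> l" using incseq_convergent[OF inc] r_le by metis
  have l_pos: "l > 0" using r_pos[of 0] l(2)[of 0] by linarith
  have b_Suc: "b (Suc n) = r n * b n" for n using pos[of n] by (simp add: r_def)
  \<comment> \<open>Together with \<open>b (Suc (m + n)) \<le> b m * b n\<close> this gives
    \<open>r m ^ Suc n \<le> b n\<close> for every \<open>m\<close>, and then \<open>m\<close> tends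
    to infinity.\<close>
  have low: "r m ^ i * b m \<le> b (m + i)" for m i
  proof (induction i)
    case (Suc i)
    have "r m ^ Suc i * b m \<le> r m * b (m + i)" using Suc r_pos[of m] by (simp add: mult.assoc)
    also have "\<dots> \<le> r (m + i) * b (m + i)"
      using incseqD[OF inc, of m "m + i"] pos[of "m + i"] by (intro mult_right_mono) auto
    finally show ?case by (simp add: b_Suc)
  qed simp
  have b_ge: "l ^ Suc n \<le> b n" for n
  proof (rule LIMSEQ_le_const2)
    show "(\<lambda>m. r m ^ Suc n) \<longlonglongrightarrow> l ^ Suc n" by (intro tendsto_power l)
    have "r m ^ Suc n \<le> b n" for m
    proof -
      have "r m ^ Suc n * b m \<le> b n * b m"
        using order_trans[OF low[of m "Suc n"], of "b m * b n"] sub[of m n] by (simp add: mult.commute)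
      then show ?thesis using pos[of m] by simp
    qed
    then show "\<exists>N. \<forall>m\<ge>N. r m ^ Suc n \<le> b n" by blast
  qed
  let ?c = "\<lambda>n. b n / l ^ Suc n"
  have c_ge: "?c n \<ge> 1" for n using b_ge[of n] l_pos by (simp add: field_simps)
  have "?c (Suc n) \<le> ?c n" for n
    using l(2)[of n] l_pos pos[of n] by (simp add: b_Suc field_simps)
  then have "decseq ?c" by (rule decseq_SucI)
  then obtain c where c: "?c \<longlonglongrightarrow> c" using decseq_convergent[of ?c 1] c_ge by metis
  have "c \<ge> 1" using c c_ge by (intro LIMSEQ_le_const) auto
  with l_pos c that show thesis by blast
qed

context haar_group
begin

definition conv :: "('g \<Rightarrow> complex) \<Rightarrow> ('g \<Rightarrow> complex) \<Rightarrow> 'g \<Rightarrow> complex" where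
  "conv a b x = (\<integral>y. a y * b (mul (ginv y) x) \<partial>H)"

definition conv_adj :: "('g \<Rightarrow> complex) \<Rightarrow> 'g \<Rightarrow> complex" where
  "conv_adj a x = cnj (a (ginv x))"

lemma continuous_conv_adj:
  assumes "cts a" shows "cts (conv_adj a)"
  unfolding conv_adj_def by (intro continuous_intros continuous_comp[OF assms])

lemma l2_sq_conv_adj: "cts a \<Longrightarrow> l2_sq H (conv_adj a) = l2_sq H a"
  unfolding l2_sq_def conv_adj_def complex_mod_cnj
  by (rule integral_ginv) (intro continuous_measurable_H continuous_intros)

lemma conv_eq_l2_inner: "conv a b x = l2_inner H a (\<lambda>y. conv_adj b (mul (ginv x) y))"
  unfolding conv_def l2_inner_def conv_adj_def by (simp add: ginv_mul)

text \<open>A pointwise bound in terms of \<open>L\<^sup>2\<close>-norms: convolving with a fixed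
  continuous function turns \<open>L\<^sup>2\<close>-convergence into uniform convergence.\<close>

lemma conv_bound:
  assumes a: "cts a" and b: "cts b"
  shows "(cmod (conv a b x))\<^sup>2 \<le> l2_sq H a * l2_sq H b"
proof -
  note b' = continuous_L2[OF continuous_conv_adj[OF b]]
  show ?thesis
    unfolding conv_eq_l2_inner
    using l2_Cauchy_Schwarz[OF continuous_L2[OF a]
        L2_translate[OF b', of "ginv x"]]
      l2_sq_translate[OF b', of "ginv x"] l2_sq_conv_adj[OF b] by simp
qed

lemma continuous_conv:
  assumes a: "cts a" and b: "cts b"
  shows "cts (conv a b)"
proof -
  obtain A where A: "\<And>x. cmod (a x) \<le> A" using continuous_bounded[OF a] by metis
  obtain B where B: "B > 0" "\<And>x. cmod (b x) \<le> B" using continuous_bounded[OF b] by metis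
  have "cts (\<lambda>x. \<integral>y. a y * b (mul (ginv y) x) \<partial>H)"
  proof (rule continuous_on_integral_dominated)
    show "integrable H (\<lambda>y. A * B)" by simp
    show "(\<lambda>y. a y * b (mul (ginv y) x)) \<in> borel_measurable H" for x
      by (intro continuous_measurable_H continuous_intros a continuous_comp[OF b])
    show "AE y in H. cts (\<lambda>x. a y * b (mul (ginv y) x))"
      by (intro AE_I2 continuous_intros continuous_comp[OF b])
    show "AE y in H. cmod (a y * b (mul (ginv y) x)) \<le> A * B" for x
      using A B by (auto simp: norm_mult intro!: mult_mono order_trans[OF norm_ge_zero A])
  qed
  then show ?thesis by (simp add: conv_def[abs_def])
qed

lemma integrable_conv:
  fixes a b :: "'g \<Rightarrow> complex"
  assumes "cts a" "cts b"
  shows "integrable H (\<lambda>y. a y * b (mul (ginv y) x))"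
  by (rule continuous_integrable)
    (intro continuous_intros assms(1) continuous_comp[OF assms(2)])

lemma l2_sq_le_bound:
  assumes "cts f" "\<And>x. (cmod (f x))\<^sup>2 \<le> B"
  shows "l2_sq H f \<le> B"
proof -
  have "l2_sq H f \<le> (\<integral>x. B \<partial>H)"
    unfolding l2_sq_def
    by (rule integral_mono) (use continuous_L2[OF assms(1)] assms(2) in
        \<open>auto simp: square_integrable_def\<close>)
  then show ?thesis using H.prob_space by simp
qed

lemma l2_sq_conv_le:
  assumes "cts a" "cts b"
  shows "l2_sq H (conv a b) \<le> l2_sq H a * l2_sq H b"
  by (rule l2_sq_le_bound[OF continuous_conv conv_bound]) (use assms in auto)

lemma conv_assoc:
  assumes a: "cts a" and b: "cts b" and c: "cts c"
  shows "conv (conv a b) c = conv a (conv b c)"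
proof
  fix x
  let ?F = "\<lambda>z y. a y * b (mul (ginv y) z) * c (mul (ginv z) x)"
  have "conv (conv a b) c x = (\<integral>z. (\<integral>y. ?F z y \<partial>H) \<partial>H)"
    by (simp add: conv_def)
  also have "\<dots> = (\<integral>y. (\<integral>z. ?F z y \<partial>H) \<partial>H)"
    by (rule continuous_Fubini[symmetric])
      (intro continuous_intros continuous_comp[OF a] continuous_comp[OF b]
        continuous_comp[OF c])
  also have "\<dots> = (\<integral>y. a y * conv b c (mul (ginv y) x) \<partial>H)"
  proof (rule Bochner_Integration.integral_cong[OF refl])
    fix y
    have "(\<lambda>z. ?F z y) \<in> borel_measurable H"
      by (intro continuous_measurable_H continuous_intros continuous_comp[OF b]
          continuous_comp[OF c])
    then have "(\<integral>z. ?F z y \<partial>H) = (\<integral>z. ?F (mul y z) y \<partial>H)"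
      by (rule integral_mul_left[symmetric])
    also have "\<dots> = (\<integral>z. a y * (b z * c (mul (ginv z) (mul (ginv y) x))) \<partial>H)"
      by (simp add: ginv_mul mul_assoc mult.assoc)
    finally show "(\<integral>z. ?F z y \<partial>H) = a y * conv b c (mul (ginv y) x)" by (simp add: conv_def)
  qed
  finally show "conv (conv a b) c x = conv a (conv b c) x" by (simp add: conv_def)
qed

lemma conv_adj_conv:
  assumes a: "cts a" and b: "cts b"
  shows "conv_adj (conv a b) = conv (conv_adj b) (conv_adj a)"
proof
  fix x
  have "(\<lambda>y. conv_adj b y * conv_adj a (mul (ginv y) x)) \<in> borel_measurable H"
    by (intro continuous_measurable_H continuous_intros continuous_conv_adj b
        continuous_comp[OF continuous_conv_adj[OF a]])
  from integral_mul_left[OF this, of x]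
  show "conv_adj (conv a b) x = conv (conv_adj b) (conv_adj a) x"
    by (simp add: conv_def conv_adj_def ginv_mul mul_assoc mult.commute flip: Bochner_Integration.integral_cnj)
qed

lemma conv_at_e: "conv a b e = l2_inner H a (conv_adj b)"
  by (simp add: conv_eq_l2_inner)

lemma conv_zero_left: "conv (\<lambda>x. 0) b = (\<lambda>x. 0)"
  by (simp add: conv_def fun_eq_iff)

lemma conv_zero_right: "conv a (\<lambda>x. 0) = (\<lambda>x. 0)"
  by (simp add: conv_def fun_eq_iff)

lemma conv_scale_left: "conv (\<lambda>x. s * a x) b = (\<lambda>x. s * conv a b x)"
  by (simp add: conv_def fun_eq_iff mult.assoc)

lemma conv_scale_right: "conv a (\<lambda>x. s * b x) = (\<lambda>x. s * conv a b x)"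
  by (simp add: conv_def fun_eq_iff mult.left_commute)

lemma conv_diff_left:
  assumes "cts a" "cts a'" "cts b"
  shows "conv (\<lambda>x. a x - a' x) b = (\<lambda>x. conv a b x - conv a' b x)"
  unfolding conv_def using assms by (simp add: fun_eq_iff left_diff_distrib integrable_conv)

lemma conv_diff_right:
  assumes "cts a" "cts b" "cts b'"
  shows "conv a (\<lambda>x. b x - b' x) = (\<lambda>x. conv a b x - conv a b' x)"
  unfolding conv_def using assms by (simp add: fun_eq_iff right_diff_distrib integrable_conv)

lemma conv_add_right:
  assumes "cts a" "cts b" "cts b'"
  shows "conv a (\<lambda>x. b x + b' x) = (\<lambda>x. conv a b x + conv a b' x)"
  unfolding conv_def using assms by (simp add: fun_eq_iff distrib_left integrable_conv)

lemma conv_tendsto: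
  assumes cont: "cts a" "cts b" "\<And>n. cts (u n)"
    and lim: "(\<lambda>n. l2_sq H (\<lambda>x. u n x - b x)) \<longlonglongrightarrow> 0"
  shows "(\<lambda>n. conv a (u n) x) \<longlonglongrightarrow> conv a b x" "(\<lambda>n. conv (u n) a x) \<longlonglongrightarrow> conv b a x"
proof -
  have sq: "(\<lambda>n. sqrt (l2_sq H a * l2_sq H (\<lambda>x. u n x - b x))) \<longlonglongrightarrow> sqrt (l2_sq H a * 0)"
    by (intro tendsto_intros lim)
  have d: "cts (\<lambda>x. u n x - b x)" for n by (intro continuous_intros cont)
  show "(\<lambda>n. conv a (u n) x) \<longlonglongrightarrow> conv a b x"
  proof (rule LIM_zero_cancel, rule Lim_null_comparison)
    show "\<forall>\<^sub>F n in sequentially. cmod (conv a (u n) x - conv a b x) \<le> sqrt (l2_sq H a * l2_sq H (\<lambda>x. u n x - b x))"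
      using real_le_rsqrt[OF conv_bound[OF cont(1) d]] cont by (simp add: conv_diff_right)
    show "(\<lambda>n. sqrt (l2_sq H a * l2_sq H (\<lambda>x. u n x - b x))) \<longlonglongrightarrow> 0" using sq by simp
  qed
  show "(\<lambda>n. conv (u n) a x) \<longlonglongrightarrow> conv b a x"
  proof (rule LIM_zero_cancel, rule Lim_null_comparison)
    show "\<forall>\<^sub>F n in sequentially. cmod (conv (u n) a x - conv b a x) \<le> sqrt (l2_sq H a * l2_sq H (\<lambda>x. u n x - b x))"
      using real_le_rsqrt[OF conv_bound[OF d cont(1)]] cont by (simp add: conv_diff_left mult.commute)
    show "(\<lambda>n. sqrt (l2_sq H a * l2_sq H (\<lambda>x. u n x - b x))) \<longlonglongrightarrow> 0" using sq by simp
  qed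
qed

lemma uniform_limit_l2:
  assumes cont: "cts b" "\<And>n. cts (u n)" and lim: "uniform_limit UNIV u b sequentially"
  shows "(\<lambda>n. l2_sq H (\<lambda>x. u n x - b x)) \<longlonglongrightarrow> 0"
proof (rule tendstoI)
  fix \<epsilon> :: real assume e: "\<epsilon> > 0"
  then have "sqrt (\<epsilon> / 2) > 0" by simp
  from uniform_limitD[OF lim this]
  show "\<forall>\<^sub>F n in sequentially. dist (l2_sq H (\<lambda>x. u n x - b x)) 0 < \<epsilon>"
  proof eventually_elim
    case (elim n)
    have "l2_sq H (\<lambda>x. u n x - b x) \<le> \<epsilon> / 2"
    proof (rule l2_sq_le_bound)
      show "cts (\<lambda>x. u n x - b x)" by (intro continuous_intros cont)
      fix x
      have "cmod (u n x - b x) \<le> sqrt (\<epsilon> / 2)" using elim by (simp add: dist_norm less_imp_le)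
      then show "(cmod (u n x - b x))\<^sup>2 \<le> \<epsilon> / 2" using e by (metis norm_ge_zero power_mono real_sqrt_pow2 half_gt_zero less_imp_le)
    qed
    then show ?case using e l2_sq_nonneg[of H "\<lambda>x. u n x - b x"] by simp
  qed
qed

text \<open>\<open>conv_power k n\<close> is the power with \<open>n + 1\<close> factors, because a
  unit for convolution need not exist among functions. This accounts for every
  \<open>Suc (m + n)\<close> below.\<close>

primrec conv_power :: "('g \<Rightarrow> complex) \<Rightarrow> nat \<Rightarrow> 'g \<Rightarrow> complex" where
  "conv_power k 0 = k"
| "conv_power k (Suc n) = conv k (conv_power k n)"

lemma continuous_conv_power: "cts k \<Longrightarrow> cts (conv_power k n)"
  by (induction n) (auto intro: continuous_conv)

lemma conv_conv_power:
  assumes "cts k"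
  shows "conv (conv_power k m) (conv_power k n) = conv_power k (Suc (m + n))"
  by (induction m) (simp_all add: assms conv_assoc continuous_conv_power)

lemma conv_adj_conv_power:
  assumes k: "cts k" and adj: "conv_adj k = k"
  shows "conv_adj (conv_power k n) = conv_power k n"
proof (induction n)
  case (Suc n)
  have "conv (conv_power k n) (conv_power k 0) = conv_power k (Suc n)"
    using conv_conv_power[OF k, of n 0] by simp
  then show ?case using Suc by (simp add: conv_adj_conv k continuous_conv_power adj)
qed (simp add: adj)

text \<open>The powers \<open>k\<^sup>n\<close> of a self-adjoint kernel are renormalised by the top eigenvalue of \<open>k\<^sup>2\<close>. Since
  \<open>\<parallel>k\<^sup>n\<parallel>\<^sup>2 = k\<^sup>2\<^sup>n(e)\<close> is log-convex and submultiplicative in \<open>n\<close>, they converge uniformly, and the limit is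
  the kernel of the projection onto the top eigenspace. This replaces the spectral theorem.\<close>

lemma spectral_idempotent:
  assumes k: "cts k" and adj: "conv_adj k = k" and k0: "k x0 \<noteq> 0"
  obtains p where "cts p" "conv p p = p" "p e \<noteq> 0"
    "\<And>a. cts a \<Longrightarrow> conv a k = (\<lambda>x. 0) \<Longrightarrow> conv a p = (\<lambda>x. 0)"
proof -
  define K where "K = conv_power k"
  have K: "cts (K n)" for n unfolding K_def by (rule continuous_conv_power[OF k])
  note Ks = continuous_L2[OF K]
  have KK: "conv (K m) (K n) = K (Suc (m + n))" for m n unfolding K_def by (rule conv_conv_power[OF k])
  have Kadj: "conv_adj (K n) = K n" for n unfolding K_def by (rule conv_adj_conv_power[OF k adj])
  have inner: "l2_inner H (K m) (K n) = K (Suc (m + n)) e" for m n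
    using conv_at_e[of "K m" "K n"] by (simp add: KK Kadj)
  define b where "b n = l2_sq H (K n)" for n
  have Ke: "K (Suc (n + n)) e = of_real (b n)" for n
    using inner[of n n] by (simp add: b_def l2_inner_self)
  \<comment> \<open>Cauchy-Schwarz for \<open>K n\<close> and \<open>K (n + 2)\<close>: by
    self-adjointness their inner product is the squared norm of the power between them.\<close>
  have lc: "(b (Suc n))\<^sup>2 \<le> b n * b (Suc (Suc n))" for n
  proof -
    have "l2_inner H (K n) (K (Suc (Suc n))) = of_real (b (Suc n))"
      using inner[of n "Suc (Suc n)"] Ke[of "Suc n"] by simp
    then show ?thesis using l2_Cauchy_Schwarz[OF Ks[of n] Ks[of "Suc (Suc n)"]] by (simp add: b_def)
  qed
  have sub: "b (Suc (m + n)) \<le> b m * b n" for m n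
    using l2_sq_conv_le[OF K[of m] K[of n]] by (simp add: KK b_def)
  have b0: "b 0 > 0"
    using l2_sq_zero_continuous[OF k] k0 l2_sq_nonneg[of H k] by (fastforce simp: b_def K_def)
  have b1: "b (Suc 0) > 0"
  proof (rule ccontr)
    assume "\<not> b (Suc 0) > 0"
    then have "l2_sq H (K (Suc 0)) = 0" using l2_sq_nonneg[of H "K (Suc 0)"] by (simp add: b_def)
    then have "K (Suc 0) e = 0" by (rule l2_sq_zero_continuous[OF K])
    then show False using Ke[of 0] b0 by simp
  qed
  have pos: "b n > 0" for n
  proof (induction n rule: induct_nat_012)
    case (ge2 n)
    have "0 < (b (Suc n))\<^sup>2" using ge2 by simp
    then have "0 < b n * b (Suc (Suc n))" using lc[of n] by linarith
    then show ?case using ge2 by (simp add: zero_less_mult_iff)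
  qed (use b0 b1 in auto)
  obtain l c where l: "l > 0" and c: "c \<ge> 1" "(\<lambda>n. b n / l ^ Suc n) \<longlonglongrightarrow> c"
    using log_convex_submultiplicative_limit[OF pos lc sub] by metis
  define C where "C n = b n / l ^ Suc n" for n
  \<comment> \<open>\<open>K (Suc (n + n))\<close> is the power of \<open>conv k k\<close> with
    \<open>n + 1\<close> factors, so dividing by \<open>l ^ Suc n\<close> makes
    \<open>q_conv\<close> exact, and \<open>q n e\<close> is the normalised term
    \<open>C n\<close>.\<close>
  define q where "q n x = of_real (1 / l ^ Suc n) * K (Suc (n + n)) x" for n x
  have q: "cts (q n)" for n unfolding q_def by (intro continuous_intros K)
  note qs = continuous_L2[OF q]
  have qe: "q n e = of_real (C n)" for n using Ke[of n] by (simp add: q_def C_def)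
  have q_conv: "conv (q m) (q n) = q (Suc (m + n))" for m n
    unfolding q_def conv_scale_left conv_scale_right KK by (simp add: fun_eq_iff power_add add_ac mult_ac)
  have q_inner: "l2_inner H (q m) (q n) = of_real (C (Suc (m + n)))" for m n
    unfolding q_def l2_inner_scale_left l2_inner_scale_right inner
    using Ke[of "Suc (m + n)"] by (simp add: C_def power_add algebra_simps)
  have C_lim: "C \<longlonglongrightarrow> c" using c(2) by (simp add: C_def[abs_def])
  have q_sq: "l2_sq H (q n) = C (Suc (n + n))" for n
    using q_inner[of n n] by (simp add: l2_inner_self)
  \<comment> \<open>All three terms on the right are values of the convergent sequence
    \<open>C\<close>, and their limits cancel.\<close>
  have q_diff: "l2_sq H (\<lambda>x. q m x - q n x) = C (Suc (m + m)) + C (Suc (n + n)) - 2 * C (Suc (m + n))" for m n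
    using l2_sq_diff_expand[OF qs qs, of m n] by (simp add: q_sq q_inner)
  have cauchy: "\<exists>N. \<forall>m\<ge>N. \<forall>n\<ge>N. l2_sq H (\<lambda>x. q m x - q n x) < \<epsilon>" if "\<epsilon> > 0" for \<epsilon> :: real
  proof -
    from C_lim that have "\<forall>\<^sub>F n in sequentially. dist (C n) c < \<epsilon> / 4" by (intro tendstoD) auto
    then obtain N where N: "\<And>n. n \<ge> N \<Longrightarrow> \<bar>C n - c\<bar> < \<epsilon> / 4"
      by (auto simp: eventually_sequentially dist_real_def)
    have "l2_sq H (\<lambda>x. q m x - q n x) < \<epsilon>" if "m \<ge> N" "n \<ge> N" for m n
    proof -
      have "\<bar>C (Suc (m + m)) - c\<bar> < \<epsilon> / 4" "\<bar>C (Suc (n + n)) - c\<bar> < \<epsilon> / 4"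
        "\<bar>C (Suc (m + n)) - c\<bar> < \<epsilon> / 4"
        by (rule N, use that in simp)+
      then show ?thesis unfolding q_diff by linarith
    qed
    then show ?thesis by (intro exI[of _ N] allI impI)
  qed
  define D where "D = l2_sq H (q 0)"
  \<comment> \<open>One further convolution with \<open>q 0\<close> upgrades the Cauchy property
    from the \<open>L\<^sup>2\<close>-norm to the uniform norm.\<close>
  have q_Suc: "q (Suc n) = conv (q 0) (q n)" for n using q_conv[of 0 n] by simp
  have D: "D > 0" using pos[of 1] l by (simp add: D_def q_sq C_def)
  have "uniformly_Cauchy_on UNIV (\<lambda>n. q (Suc n))"
  proof (rule uniformly_Cauchy_onI)
    fix \<epsilon> :: real assume e: "\<epsilon> > 0"
    obtain N where N: "\<And>m n. m \<ge> N \<Longrightarrow> n \<ge> N \<Longrightarrow> l2_sq H (\<lambda>x. q m x - q n x) < \<epsilon>\<^sup>2 / D"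
      using cauchy[of "\<epsilon>\<^sup>2 / D"] e D by auto
    have "dist (q (Suc m) x) (q (Suc n) x) < \<epsilon>" if "m \<ge> N" "n \<ge> N" for m n x
    proof -
      have "cts (\<lambda>x. q m x - q n x)" by (intro continuous_intros q)
      from conv_bound[OF q[of 0] this, of x]
      have "(cmod (q (Suc m) x - q (Suc n) x))\<^sup>2 \<le> D * l2_sq H (\<lambda>x. q m x - q n x)"
        by (simp add: q_Suc conv_diff_right q D_def)
      also have "\<dots> < \<epsilon>\<^sup>2" using N[OF that] D by (simp add: field_simps)
      finally show ?thesis using e by (simp add: dist_norm power_less_imp_less_base)
    qed
    then show "\<exists>M. \<forall>x\<in>UNIV. \<forall>m\<ge>M. \<forall>n\<ge>M. dist (q (Suc m) x) (q (Suc n) x) < \<epsilon>" by blast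
  qed
  then obtain p where lim: "uniform_limit UNIV (\<lambda>n. q (Suc n)) p sequentially"
    using Cauchy_uniformly_convergent[of UNIV "\<lambda>n. q (Suc n)"] by (auto simp: uniformly_convergent_on_def)
  have p: "cts p"
    by (rule uniform_limit_theorem[OF _ lim]) (auto simp: q)
  have l2lim: "(\<lambda>n. l2_sq H (\<lambda>x. q (Suc n) x - p x)) \<longlonglongrightarrow> 0"
    by (rule uniform_limit_l2[OF p q lim])
  have ptw: "(\<lambda>n. q (Suc n) x) \<longlonglongrightarrow> p x" for x
    using tendsto_uniform_limitI[OF lim] by simp
  \<comment> \<open>Letting \<open>n\<close> tend to infinity in \<open>q_conv\<close> shows that
    \<open>p\<close> absorbs each \<open>q (Suc m)\<close>; letting \<open>m\<close> tend to
    infinity as well gives \<open>conv p p = p\<close>.\<close>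
  have qp: "conv (q (Suc m)) p x = p x" for m x
  proof (rule LIMSEQ_unique)
    show "(\<lambda>n. conv (q (Suc m)) (q (Suc n)) x) \<longlonglongrightarrow> conv (q (Suc m)) p x"
      by (rule conv_tendsto(1)[OF q p q l2lim])
    have "(\<lambda>n. q (Suc (n + (m + 2))) x) \<longlonglongrightarrow> p x"
      using LIMSEQ_ignore_initial_segment[OF ptw[of x], of "m + 2"] by simp
    then show "(\<lambda>n. conv (q (Suc m)) (q (Suc n)) x) \<longlonglongrightarrow> p x"
      by (simp add: q_conv add.commute)
  qed
  show thesis
  proof (rule that)
    show "conv p p = p"
    proof
      fix x
      have "(\<lambda>n. conv (q (Suc n)) p x) \<longlonglongrightarrow> conv p p x"
        by (rule conv_tendsto(2)[OF p p q l2lim])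
      then show "conv p p x = p x" by (simp add: qp LIMSEQ_const_iff)
    qed
    have "(\<lambda>n. of_real (C (Suc n)) :: complex) \<longlonglongrightarrow> of_real c"
      by (intro tendsto_of_real LIMSEQ_Suc C_lim)
    then have "p e = of_real c" using ptw[of e] by (simp add: qe LIMSEQ_unique)
    then show "p e \<noteq> 0" using c by simp
    fix a assume a: "cts a" and ak: "conv a k = (\<lambda>x. 0)"
    have "conv a (K n) = (\<lambda>x. 0)" for n
      by (cases n) (simp_all add: K_def ak conv_zero_left flip: conv_assoc[OF a k continuous_conv_power[OF k]])
    then have "conv a (q n) = (\<lambda>x. 0)" for n unfolding q_def conv_scale_right by simp
    moreover have "(\<lambda>n. conv a (q (Suc n)) x) \<longlonglongrightarrow> conv a p x" for x
      by (rule conv_tendsto(1)[OF a p q l2lim])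
    ultimately show "conv a p = (\<lambda>x. 0)" by (simp add: LIMSEQ_const_iff fun_eq_iff)
  qed (rule p)
qed

end

section \<open>The Peter-Weyl theorem\<close>

lemma Bessel_inequality:
  assumes I: "finite I" and f: "\<And>i. i \<in> I \<Longrightarrow> square_integrable M (f i)" and g: "square_integrable M g"
    and on: "\<And>i j. i \<in> I \<Longrightarrow> j \<in> I \<Longrightarrow> l2_inner M (f i) (f j) = (if i = j then 1 else 0)"
  shows "(\<Sum>i\<in>I. (cmod (l2_inner M (f i) g))\<^sup>2) \<le> l2_sq M g"
proof -
  let ?a = "\<lambda>i. l2_inner M g (f i)"
  let ?s = "\<lambda>x. \<Sum>i\<in>I. ?a i * f i x"
  let ?A = "\<Sum>i\<in>I. (cmod (?a i))\<^sup>2"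
  have fs: "square_integrable M (\<lambda>x. ?a i * f i x)" if "i \<in> I" for i
    using L2_scale[OF f[OF that]] .
  have s: "square_integrable M ?s" by (rule L2_sum[OF fs])
  have gs: "l2_inner M g ?s = of_real ?A"
  proof -
    have "l2_inner M g ?s = (\<Sum>i\<in>I. l2_inner M g (\<lambda>x. ?a i * f i x))"
      by (rule l2_inner_sum_right) (use fs g in auto)
    also have "\<dots> = (\<Sum>i\<in>I. cnj (?a i) * ?a i)" by (simp only: l2_inner_scale_right)
    finally show ?thesis by (simp add: complex_norm_square mult.commute del: of_real_power)
  qed
  have "l2_inner M (f j) ?s = cnj (?a j)" if j: "j \<in> I" for j
  proof -
    have "l2_inner M (f j) ?s = (\<Sum>i\<in>I. l2_inner M (f j) (\<lambda>x. ?a i * f i x))"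
      by (rule l2_inner_sum_right) (use fs f j in auto)
    also have "\<dots> = (\<Sum>i\<in>I. cnj (?a i) * (if j = i then 1 else 0))"
      using j by (simp add: l2_inner_scale_right on)
    also have "\<dots> = cnj (?a j)" using I j by (simp add: if_distrib[of "\<lambda>t. _ * t"] sum.delta' cong: if_cong)
    finally show ?thesis .
  qed
  moreover have "l2_inner M ?s ?s = (\<Sum>i\<in>I. l2_inner M (\<lambda>x. ?a i * f i x) ?s)"
    by (rule l2_inner_sum_left) (use fs s in auto)
  ultimately have ss: "l2_inner M ?s ?s = of_real ?A"
    by (simp add: l2_inner_scale_left complex_norm_square del: of_real_power)
  have "0 \<le> l2_sq M (\<lambda>x. g x - ?s x)" by (rule l2_sq_nonneg)
  also have "\<dots> = l2_sq M g + l2_sq M ?s - 2 * Re (l2_inner M g ?s)"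
    by (rule l2_sq_diff_expand[OF g s])
  also have "l2_sq M ?s = ?A" using ss unfolding l2_inner_self of_real_eq_iff .
  also have "Re (l2_inner M g ?s) = ?A" unfolding gs by simp
  finally have "?A \<le> l2_sq M g" by simp
  moreover have "cmod (?a i) = cmod (l2_inner M (f i) g)" for i
    by (metis complex_mod_cnj l2_inner_cnj)
  ultimately show ?thesis by simp
qed

context haar_group
begin

text \<open>Linear spaces of continuous functions closed under right translation, the side that
  commutes with left convolution by a kernel.\<close>

definition translation_invariant :: "('g \<Rightarrow> complex) set \<Rightarrow> bool" where
  "translation_invariant W \<longleftrightarrow> (\<forall>f\<in>W. cts f) \<and> (\<lambda>x. 0) \<in> W \<and>
     (\<forall>f\<in>W. \<forall>h\<in>W. (\<lambda>x. f x + h x) \<in> W) \<and> (\<forall>a. \<forall>f\<in>W. (\<lambda>x. a * f x) \<in> W) \<and>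
     (\<forall>g. \<forall>f\<in>W. (\<lambda>x. f (mul x g)) \<in> W)"

text \<open>Dimension is encoded by orthonormal families: \<open>W\<close> has dimension
  \<open>n\<close> when a family of length \<open>n\<close> exists and none of length
  \<open>Suc n\<close>.\<close>

definition orthonormal_in :: "('g \<Rightarrow> complex) set \<Rightarrow> nat \<Rightarrow> (nat \<Rightarrow> 'g \<Rightarrow> complex) \<Rightarrow> bool" where
  "orthonormal_in W n f \<longleftrightarrow> (\<forall>i<n. f i \<in> W) \<and>
     (\<forall>i<n. \<forall>j<n. l2_inner H (f i) (f j) = (if i = j then 1 else 0))"

lemma
  assumes "translation_invariant W"
  shows translation_invariant_cts: "f \<in> W \<Longrightarrow> cts f"
    and translation_invariant_zero: "(\<lambda>x. 0) \<in> W"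
    and translation_invariant_add: "f \<in> W \<Longrightarrow> h \<in> W \<Longrightarrow> (\<lambda>x. f x + h x) \<in> W"
    and translation_invariant_scale: "f \<in> W \<Longrightarrow> (\<lambda>x. a * f x) \<in> W"
    and translation_invariant_translate: "f \<in> W \<Longrightarrow> (\<lambda>x. f (mul x g)) \<in> W"
  using assms by (auto simp: translation_invariant_def)

lemma translation_invariant_sum:
  assumes W: "translation_invariant W" and f: "\<And>i. i \<in> I \<Longrightarrow> f i \<in> W"
  shows "(\<lambda>x. \<Sum>i\<in>I. a i * f i x) \<in> W"
  using f
proof (induction I rule: infinite_finite_induct)
  case (insert j I)
  have "(\<lambda>x. a j * f j x + (\<Sum>i\<in>I. a i * f i x)) \<in> W"
    by (rule translation_invariant_add[OF W translation_invariant_scale[OF W]]) (use insert in auto)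
  then show ?case using insert by simp
qed (simp_all add: translation_invariant_zero[OF W])

lemma l2_inner_translate:
  assumes "cts f" "cts h"
  shows "l2_inner H (\<lambda>x. f (mul x g)) (\<lambda>x. h (mul x g)) = l2_inner H f h"
  unfolding l2_inner_def
  by (rule integral_mul_right) (intro continuous_measurable_H continuous_intros assms)

lemma orthonormal_in_coefficient:
  assumes f: "orthonormal_in W n f" and W: "translation_invariant W" and i: "i < n"
  shows "l2_inner H (\<lambda>x. \<Sum>j<n. a j * f j x) (f i) = a i"
proof -
  have fs: "square_integrable H (f j)" if "j < n" for j
    using f that by (auto simp: orthonormal_in_def intro!: continuous_L2 translation_invariant_cts[OF W])
  have "l2_inner H (\<lambda>x. \<Sum>j<n. a j * f j x) (f i) = (\<Sum>j<n. a j * l2_inner H (f j) (f i))"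
    using i by (subst l2_inner_sum_left) (auto intro: L2_scale fs simp: l2_inner_scale_left)
  also have "\<dots> = (\<Sum>j<n. if j = i then a i else 0)"
    using f i by (intro sum.cong) (auto simp: orthonormal_in_def)
  also have "\<dots> = a i" using i by simp
  finally show ?thesis .
qed

text \<open>The residual of \<open>w\<close> is orthogonal to the family. If its norm were not 0,
  normalising it by \<open>t\<close> would give a family of length \<open>Suc n\<close>; and a
  continuous function of norm 0 vanishes at every point.\<close>

lemma orthonormal_in_spans:
  assumes W: "translation_invariant W" and f: "orthonormal_in W n f"
    and max: "\<not> (\<exists>h. orthonormal_in W (Suc n) h)" and w: "w \<in> W"
  shows "w x = (\<Sum>i<n. l2_inner H w (f i) * f i x)"
proof -
  have fW: "f i \<in> W" if "i < n" for i using f that by (simp add: orthonormal_in_def)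
  note sq = continuous_L2[OF translation_invariant_cts[OF W]]
  let ?s = "\<lambda>x. \<Sum>i<n. l2_inner H w (f i) * f i x"
  have s: "?s \<in> W" by (rule translation_invariant_sum[OF W]) (simp add: fW)
  define r where "r x = w x - ?s x" for x
  have "r = (\<lambda>x. w x + (-1) * ?s x)" by (simp add: r_def fun_eq_iff)
  then have r: "r \<in> W"
    using translation_invariant_add[OF W w translation_invariant_scale[OF W s, of "-1"]] by simp
  have r_orth: "l2_inner H r (f i) = 0" if "i < n" for i
    unfolding r_def using that
    by (simp add: l2_inner_diff_left[OF sq[OF w] sq[OF s] sq[OF fW]] orthonormal_in_coefficient[OF f W])
  have "l2_sq H r = 0"
  proof (rule ccontr)
    assume "l2_sq H r \<noteq> 0"
    then have pos: "l2_sq H r > 0" using l2_sq_nonneg[of H r] by simp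
    define t where "t = complex_of_real (1 / sqrt (l2_sq H r))"
    have tt: "t * cnj t * of_real (l2_sq H r) = 1"
    proof -
      have "t * cnj t * of_real (l2_sq H r)
          = of_real (1 / sqrt (l2_sq H r) * (1 / sqrt (l2_sq H r)) * l2_sq H r)"
        unfolding t_def by (simp only: complex_cnj_complex_of_real of_real_mult)
      also have "1 / sqrt (l2_sq H r) * (1 / sqrt (l2_sq H r)) * l2_sq H r = 1" using pos by simp
      finally show ?thesis by simp
    qed
    have fr: "l2_inner H (f i) r = 0" if "i < n" for i
      using r_orth[OF that] by (metis complex_cnj_zero l2_inner_cnj)
    have "orthonormal_in W (Suc n) (\<lambda>i. if i < n then f i else (\<lambda>x. t * r x))"
      unfolding orthonormal_in_def
      using f tt r fW
      by (auto simp: orthonormal_in_def less_Suc_eq l2_inner_scale_left l2_inner_scale_right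
          l2_inner_self r_orth fr mult_ac intro: translation_invariant_scale[OF W])
    with max show False by blast
  qed
  then have "r x = 0" by (rule l2_sq_zero_continuous[OF translation_invariant_cts[OF W r]])
  then show ?thesis by (simp add: r_def)
qed

text \<open>A reproducing kernel bounds the dimension: summing Bessel's inequality for the kernel sections
  over an orthonormal family and integrating over the group counts the family.\<close>

lemma orthonormal_in_bound:
  assumes p: "cts p" and W: "translation_invariant W" and rep: "\<And>f. f \<in> W \<Longrightarrow> conv p f = f"
    and f: "orthonormal_in W n f"
  shows "real n \<le> l2_sq H p"
proof -
  have fc: "cts (f i)" and fW: "f i \<in> W" if "i < n" for i
    using f that translation_invariant_cts[OF W] by (auto simp: orthonormal_in_def)
  note fs = continuous_L2[OF fc]
  define q where "q x y = cnj (p (mul x (ginv y)))" for x y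
  have qc: "cts (q x)" for x unfolding q_def by (intro continuous_intros continuous_comp[OF p])
  have q_sq: "l2_sq H (q x) = l2_sq H p" for x
  proof -
    have "l2_sq H (q x) = (\<integral>y. (cmod (p (mul x y)))\<^sup>2 \<partial>H)"
      unfolding l2_sq_def q_def complex_mod_cnj
      by (rule integral_ginv) (intro continuous_measurable_H continuous_intros continuous_comp[OF p])
    also have "\<dots> = l2_sq H p" unfolding l2_sq_def
      by (rule integral_mul_left) (intro continuous_measurable_H continuous_intros p)
    finally show ?thesis .
  qed
  have val: "f i x = l2_inner H (f i) (q x)" if i: "i < n" for i x
  proof -
    have "f i x = (\<integral>y. p y * f i (mul (ginv y) x) \<partial>H)"
      using rep[OF fW[OF i]] by (simp add: conv_def fun_eq_iff)
    also have "\<dots> = (\<integral>y. p (mul x y) * f i (mul (ginv (mul x y)) x) \<partial>H)"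
      by (rule integral_mul_left[symmetric])
        (intro continuous_measurable_H continuous_intros p continuous_comp[OF fc[OF i]])
    also have "\<dots> = (\<integral>y. p (mul x y) * f i (ginv y) \<partial>H)" by (simp add: ginv_mul mul_assoc)
    also have "\<dots> = (\<integral>y. p (mul x (ginv y)) * f i (ginv (ginv y)) \<partial>H)"
      by (rule integral_ginv[symmetric])
        (intro continuous_measurable_H continuous_intros continuous_comp[OF p]
          continuous_comp[OF fc[OF i]])
    also have "\<dots> = l2_inner H (f i) (q x)" by (simp add: l2_inner_def q_def mult.commute)
    finally show ?thesis .
  qed
  have bound: "(\<Sum>i<n. (cmod (f i x))\<^sup>2) \<le> l2_sq H p" for x
    using Bessel_inequality[of "{..<n}" H f "q x"] f fs continuous_L2[OF qc]
    by (simp add: val[symmetric] q_sq orthonormal_in_def)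
  have "real n = (\<Sum>i<n. l2_sq H (f i))"
  proof -
    have "l2_sq H (f i) = 1" if "i < n" for i
      using f that l2_inner_self[of H "f i"] by (simp add: orthonormal_in_def)
    then show ?thesis by simp
  qed
  also have "\<dots> = (\<integral>x. (\<Sum>i<n. (cmod (f i x))\<^sup>2) \<partial>H)"
    unfolding l2_sq_def using fs by (subst Bochner_Integration.integral_sum) (auto simp: square_integrable_def)
  also have "\<dots> \<le> (\<integral>x. l2_sq H p \<partial>H)"
    by (rule integral_mono) (use fs bound in \<open>auto simp: square_integrable_def\<close>)
  also have "\<dots> = l2_sq H p" using H.prob_space by simp
  finally show ?thesis .
qed

text \<open>The case of the empty family in \<open>orthonormal_in_spans\<close>: if there were no
  unit vector, \<open>f\<close> would equal the empty sum.\<close>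

lemma orthonormal_in_singleton:
  assumes W: "translation_invariant W" and f: "f \<in> W" "f x \<noteq> 0"
  shows "\<exists>h. orthonormal_in W (Suc 0) h"
proof (rule ccontr)
  assume max: "\<nexists>h. orthonormal_in W (Suc 0) h"
  have "orthonormal_in W 0 (\<lambda>i x. 0)" by (simp add: orthonormal_in_def)
  from orthonormal_in_spans[OF W this max f(1), of x] f(2) show False by simp
qed

lemma orthonormal_in_mono: "orthonormal_in W n f \<Longrightarrow> m \<le> n \<Longrightarrow> orthonormal_in W m f"
  by (auto simp: orthonormal_in_def)

text \<open>All dimensions are bounded by the squared norm of \<open>p\<close>, so a nonzero
  invariant subspace of least dimension \<open>d\<close> exists. Minimality is phrased as the
  existence of \<open>d\<close> orthonormal elements in each nonzero invariant \<open>U\<close>,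
  since by maximality in \<open>W\<close> such a family already spans \<open>W\<close>.\<close>

lemma minimal_invariant_subspace:
  assumes p: "cts p" and V: "translation_invariant V" and rep: "\<And>f. f \<in> V \<Longrightarrow> conv p f = f"
    and v: "v \<in> V" "v x \<noteq> 0"
  obtains W d f where "W \<subseteq> V" "translation_invariant W" "d > 0" "orthonormal_in W d f"
    "\<not> (\<exists>h. orthonormal_in W (Suc d) h)"
    "\<forall>U u y. U \<subseteq> W \<and> translation_invariant U \<and> u \<in> U \<and> u y \<noteq> 0 \<longrightarrow> (\<exists>h. orthonormal_in U d h)"
proof -
  define Q where "Q d \<longleftrightarrow> (\<exists>W. W \<subseteq> V \<and> translation_invariant W \<and> (\<exists>w\<in>W. \<exists>y. w y \<noteq> 0) \<and>
     (\<exists>h. orthonormal_in W d h) \<and> \<not> (\<exists>h. orthonormal_in W (Suc d) h))" for d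
  have maxdim: "\<exists>d. (\<exists>h. orthonormal_in W d h) \<and> \<not> (\<exists>h. orthonormal_in W (Suc d) h)"
    if "W \<subseteq> V" "translation_invariant W" for W
  proof -
    let ?P = "\<lambda>d. \<exists>h. orthonormal_in W d h"
    have "?P 0" by (simp add: orthonormal_in_def)
    moreover have "\<forall>d. ?P d \<longrightarrow> d \<le> nat \<lceil>l2_sq H p\<rceil>"
    proof (intro allI impI)
      fix d assume "?P d"
      then have "real d \<le> l2_sq H p" using orthonormal_in_bound[OF p that(2)] rep that(1) by blast
      then show "d \<le> nat \<lceil>l2_sq H p\<rceil>" by linarith
    qed
    ultimately show ?thesis
      using GreatestI_nat[of ?P 0] Greatest_le_nat[of ?P] by (metis Suc_n_not_le_n)
  qed
  have "\<exists>d. Q d" using maxdim[OF order_refl V] V v unfolding Q_def by blast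
  then have "Q (LEAST d. Q d)" by (rule LeastI_ex)
  then obtain d where d: "Q d" "\<And>m. Q m \<Longrightarrow> d \<le> m" using Least_le[of Q] by metis
  then obtain W f w y where W: "W \<subseteq> V" "translation_invariant W" "orthonormal_in W d f"
    "\<not> (\<exists>h. orthonormal_in W (Suc d) h)" "w \<in> W" "w y \<noteq> 0" unfolding Q_def by blast
  have "d > 0" using orthonormal_in_singleton[OF W(2,5,6)] W(4) by (cases d) auto
  show thesis
  proof (rule that[OF W(1,2) \<open>d > 0\<close> W(3,4)], intro allI impI, elim conjE)
    fix U u y assume U: "U \<subseteq> W" "translation_invariant U" "u \<in> U" "u y \<noteq> 0"
    have UV: "U \<subseteq> V" using U(1) W(1) by simp
    obtain m h where m: "orthonormal_in U m h" "\<not> (\<exists>h. orthonormal_in U (Suc m) h)"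
      using maxdim[OF UV U(2)] by blast
    have "Q m" using m U UV unfolding Q_def by blast
    then have "d \<le> m" by (rule d(2))
    then show "\<exists>h. orthonormal_in U d h" using orthonormal_in_mono[OF m(1)] by blast
  qed
qed

text \<open>The matrices of right translation in the orthonormal basis \<open>f\<close>. They are
  unitary because translation preserves the inner product, and irreducible because an invariant
  subspace of coordinate vectors corresponds to a translation invariant subspace of
  \<open>W\<close>.\<close>

lemma minimal_subspace_irrep:
  assumes W: "translation_invariant W" and d: "d > 0" and f: "orthonormal_in W d f"
    and max: "\<not> (\<exists>h. orthonormal_in W (Suc d) h)"
    and min: "\<forall>U u y. U \<subseteq> W \<and> translation_invariant U \<and> u \<in> U \<and> u y \<noteq> 0 \<longrightarrow> (\<exists>h. orthonormal_in U d h)"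
  obtains \<pi> where "(d, \<pi>) \<in> irreps mul" "\<forall>j<d. \<forall>x g. f j (mul x g) = (\<Sum>i<d. \<pi> g $$ (i,j) * f i x)"
proof -
  have fW: "f i \<in> W" if "i < d" for i using f that by (simp add: orthonormal_in_def)
  note fc = translation_invariant_cts[OF W fW]
  define R where "R g h x = h (mul x g)" for g :: 'g and h :: "'g \<Rightarrow> complex" and x
  have RW: "R g h \<in> W" if "h \<in> W" for g h
    unfolding R_def[abs_def] using translation_invariant_translate[OF W that] by simp
  \<comment> \<open>Column \<open>j\<close> holds the coordinates of the translate of
    \<open>f j\<close>; with this convention \<open>R (mul g h)\<close>, being \<open>R g\<close>
    after \<open>R h\<close>, corresponds to the matrix product in the same order.\<close>
  define m where "m g i j = l2_inner H (R g (f j)) (f i)" for g i j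
  define \<pi> where "\<pi> g = mat d d (\<lambda>(i,j). m g i j)" for g
  have spans: "w x = (\<Sum>i<d. l2_inner H w (f i) * f i x)" if "w \<in> W" for w x
    by (rule orthonormal_in_spans[OF W f max that])
  have Rf: "R g (f j) x = (\<Sum>i<d. m g i j * f i x)" if "j < d" for g j x
    unfolding m_def by (rule spans[OF RW[OF fW[OF that]]])
  have m_mul: "m (mul g h) i j = (\<Sum>k<d. m g i k * m h k j)" if ij: "i < d" "j < d" for g h i j
  proof -
    have "R (mul g h) (f j) = (\<lambda>x. \<Sum>k<d. m h k j * R g (f k) x)"
    proof
      fix x
      have "R (mul g h) (f j) x = R h (f j) (mul x g)" by (simp add: R_def mul_assoc)
      then show "R (mul g h) (f j) x = (\<Sum>k<d. m h k j * R g (f k) x)"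
        by (simp add: Rf[OF ij(2)]) (simp add: R_def)
    qed
    then have "m (mul g h) i j = l2_inner H (\<lambda>x. \<Sum>k<d. m h k j * R g (f k) x) (f i)"
      by (simp add: m_def)
    also have "\<dots> = (\<Sum>k<d. m h k j * m g i k)"
    proof (subst l2_inner_sum_left)
      show "square_integrable H (\<lambda>x. m h k j * R g (f k) x)" if "k \<in> {..<d}" for k
        using that by (intro L2_scale continuous_L2
            translation_invariant_cts[OF W] RW fW) simp
      show "square_integrable H (f i)" by (rule continuous_L2[OF fc[OF ij(1)]])
    qed (simp add: l2_inner_scale_left m_def)
    finally show ?thesis by (simp add: mult.commute)
  qed
  have m_e: "m e i j = (if i = j then 1 else 0)" if "i < d" "j < d" for i j
  proof -
    have "R e (f j) = f j" by (simp add: R_def fun_eq_iff)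
    then show ?thesis using f that by (auto simp: m_def orthonormal_in_def)
  qed
  \<comment> \<open>Translating both arguments of the inner product by \<open>ginv g\<close> moves
    the group element to the other side.\<close>
  have m_cnj: "cnj (m g j k) = m (ginv g) k j" if jk: "j < d" "k < d" for g j k
  proof -
    have "cnj (m g j k) = l2_inner H (f j) (R g (f k))" by (simp add: m_def l2_inner_cnj)
    also have "\<dots> = l2_inner H (\<lambda>x. f j (mul x (ginv g))) (\<lambda>x. R g (f k) (mul x (ginv g)))"
      by (rule l2_inner_translate[symmetric]) (use jk fW RW translation_invariant_cts[OF W] in auto)
    also have "\<dots> = m (ginv g) k j" by (simp add: m_def R_def[abs_def])
    finally show ?thesis .
  qed
  have m_cont: "cts (\<lambda>g. m g i j)" if ij: "i < d" "j < d" for i j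
  proof -
    obtain A where A: "\<And>x. cmod (f j x) \<le> A" using continuous_bounded[OF fc[OF ij(2)]] by metis
    obtain B where B: "\<And>x. cmod (f i x) \<le> B" using continuous_bounded[OF fc[OF ij(1)]] by metis
    have "cts (\<lambda>g. \<integral>x. f j (mul x g) * cnj (f i x) \<partial>H)"
    proof (rule continuous_on_integral_dominated)
      show "integrable H (\<lambda>y. A * B)" by simp
      show "(\<lambda>x. f j (mul x g) * cnj (f i x)) \<in> borel_measurable H" for g
        by (intro continuous_measurable_H continuous_intros continuous_comp[OF fc[OF ij(2)]] fc ij)
      show "AE x in H. cts (\<lambda>g. f j (mul x g) * cnj (f i x))"
        by (intro AE_I2 continuous_intros continuous_comp[OF fc[OF ij(2)]])
      show "AE x in H. cmod (f j (mul x g) * cnj (f i x)) \<le> A * B" for g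
        using A B by (auto simp: norm_mult intro!: mult_mono order_trans[OF norm_ge_zero A])
    qed
    then show ?thesis by (simp add: m_def R_def l2_inner_def)
  qed
  have rep: "unitary_rep mul d \<pi>"
    unfolding unitary_rep_def
  proof (intro conjI allI impI)
    fix g h
    show car: "\<pi> g \<in> carrier_mat d d" for g by (simp add: \<pi>_def)
    show "\<pi> (mul g h) = \<pi> g * \<pi> h"
    proof (rule eq_matI)
      fix i j assume "i < dim_row (\<pi> g * \<pi> h)" "j < dim_col (\<pi> g * \<pi> h)"
      then have ij: "i < d" "j < d" by (auto simp: \<pi>_def)
      show "\<pi> (mul g h) $$ (i,j) = (\<pi> g * \<pi> h) $$ (i,j)"
        unfolding index_mat_mult_sum[OF car car ij] using ij by (simp add: \<pi>_def m_mul)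
    qed (auto simp: \<pi>_def)
    show "\<pi> g * mat_adj (\<pi> g) = 1\<^sub>m d"
    proof (rule eq_matI)
      fix i j assume "i < dim_row (1\<^sub>m d :: complex mat)" "j < dim_col (1\<^sub>m d :: complex mat)"
      then have ij: "i < d" "j < d" by auto
      have "(\<pi> g * mat_adj (\<pi> g)) $$ (i,j) = (\<Sum>k<d. m g i k * cnj (m g j k))"
        unfolding index_mat_mult_sum[OF car mat_adj_carrier[OF car] ij]
        using ij by (simp add: \<pi>_def mat_adj_def)
      also have "\<dots> = (\<Sum>k<d. m g i k * m (ginv g) k j)"
        using ij by (intro sum.cong) (auto simp: m_cnj)
      also have "\<dots> = m (mul g (ginv g)) i j" by (rule m_mul[OF ij, symmetric])
      also have "\<dots> = 1\<^sub>m d $$ (i,j)" using ij by (simp add: m_e)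
      finally show "(\<pi> g * mat_adj (\<pi> g)) $$ (i,j) = 1\<^sub>m d $$ (i,j)" .
    qed (auto simp: \<pi>_def mat_adj_def)
  next
    fix i j assume "i < d" "j < d"
    then show "cts (\<lambda>g. \<pi> g $$ (i,j))" using m_cont by (simp add: \<pi>_def)
  qed
  have irr: "irreducible_rep d \<pi>"
    unfolding irreducible_rep_def
  proof (intro conjI allI impI d)
    fix U assume U: "invariant_subspace d \<pi> U"
    \<comment> \<open>\<open>F\<close> identifies coordinate vectors with elements of
      \<open>W\<close>; orthonormality of \<open>f\<close> makes it injective.\<close>
    define F where "F v x = (\<Sum>i<d. vec_index v i * f i x)" for v :: "complex Matrix.vec" and x
    have FW: "F v \<in> W" for v
      unfolding F_def[abs_def] by (rule translation_invariant_sum[OF W]) (simp add: fW)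
    have F_inj: "v = w" if "F v = F w" "v \<in> carrier_vec d" "w \<in> carrier_vec d" for v w
    proof (rule eq_vecI)
      fix i assume "i < dim_vec w"
      then have i: "i < d" using that by simp
      have "l2_inner H (F v) (f i) = vec_index v i" "l2_inner H (F w) (f i) = vec_index w i"
        unfolding F_def[abs_def] by (rule orthonormal_in_coefficient[OF f W i])+
      then show "vec_index v i = vec_index w i" using that(1) by simp
    qed (use that in simp)
    have Uc: "U \<subseteq> carrier_vec d" and U0: "0\<^sub>v d \<in> U" and Ua: "\<And>v w. v \<in> U \<Longrightarrow> w \<in> U \<Longrightarrow> v + w \<in> U"
      and Us: "\<And>a v. v \<in> U \<Longrightarrow> a \<cdot>\<^sub>v v \<in> U" and Ug: "\<And>g v. v \<in> U \<Longrightarrow> \<pi> g *\<^sub>v v \<in> U"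
      using U by (auto simp: invariant_subspace_def)
    have inv: "translation_invariant (F ` U)"
      unfolding translation_invariant_def
    proof (intro conjI ballI allI)
      fix a assume "a \<in> F ` U"
      then obtain v where v: "a = F v" "v \<in> U" by blast
      then have vc: "v \<in> carrier_vec d" using Uc by blast
      show "cts a" using v FW translation_invariant_cts[OF W] by simp
      have "(\<lambda>x. s * a x) = F (s \<cdot>\<^sub>v v)" for s
        using vc by (simp add: v F_def fun_eq_iff sum_distrib_left mult.assoc)
      then show "(\<lambda>x. s * a x) \<in> F ` U" for s using Us[OF v(2)] by blast
      have "(\<lambda>x. a (mul x g)) = F (\<pi> g *\<^sub>v v)" for g
      proof
        fix x
        have "a (mul x g) = (\<Sum>j<d. vec_index v j * R g (f j) x)" by (simp add: v F_def R_def)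
        also have "\<dots> = (\<Sum>j<d. \<Sum>i<d. vec_index v j * (m g i j * f i x))"
          by (simp add: Rf sum_distrib_left)
        also have "\<dots> = (\<Sum>i<d. \<Sum>j<d. vec_index v j * (m g i j * f i x))" by (rule sum.swap)
        also have "\<dots> = F (\<pi> g *\<^sub>v v) x"
          unfolding F_def
        proof (intro sum.cong refl)
          fix i assume "i \<in> {..<d}"
          then have "vec_index (\<pi> g *\<^sub>v v) i = (\<Sum>j<d. m g i j * vec_index v j)"
            using index_mult_mat_vec_sum[of "\<pi> g" d d v i] vc by (simp add: \<pi>_def)
          then show "(\<Sum>j<d. vec_index v j * (m g i j * f i x)) = vec_index (\<pi> g *\<^sub>v v) i * f i x"
            by (simp add: sum_distrib_left sum_distrib_right mult_ac)
        qed
        finally show "a (mul x g) = F (\<pi> g *\<^sub>v v) x" .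
      qed
      then show "(\<lambda>x. a (mul x g)) \<in> F ` U" for g using Ug[OF v(2)] by blast
      fix b assume "b \<in> F ` U"
      then obtain w where w: "b = F w" "w \<in> U" by blast
      then have wc: "w \<in> carrier_vec d" using Uc by blast
      have "F (v + w) x = F v x + F w x" for x
      proof -
        have "F (v + w) x = (\<Sum>i<d. vec_index v i * f i x + vec_index w i * f i x)"
          unfolding F_def using vc wc by (intro sum.cong) (auto simp: distrib_right)
        then show ?thesis by (simp add: F_def sum.distrib)
      qed
      then have "(\<lambda>x. a x + b x) = F (v + w)" by (simp add: v(1) w(1) fun_eq_iff)
      then show "(\<lambda>x. a x + b x) \<in> F ` U" using Ua[OF v(2) w(2)] by blast
    next
      have "(\<lambda>x. 0) = F (0\<^sub>v d)" by (simp add: F_def fun_eq_iff)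
      then show "(\<lambda>x. 0) \<in> F ` U" using U0 by blast
    qed
    show "U = {0\<^sub>v d} \<or> U = carrier_vec d"
    proof (cases "\<exists>v\<in>U. \<exists>y. F v y \<noteq> 0")
      case False
      have "v = 0\<^sub>v d" if "v \<in> U" for v
      proof (rule F_inj)
        show "F v = F (0\<^sub>v d)" using False that U0 by (auto simp: fun_eq_iff)
      qed (use that Uc in auto)
      then show ?thesis using U0 by blast
    next
      case True
      then obtain v y where "v \<in> U" "F v y \<noteq> 0" by blast
      then obtain h where h: "orthonormal_in (F ` U) d h"
        using min inv FW by (metis image_subsetI imageI)
      then have hW: "orthonormal_in W d h" using FW by (auto simp: orthonormal_in_def)
      have "carrier_vec d \<subseteq> U"
      proof
        fix w :: "complex Matrix.vec" assume w: "w \<in> carrier_vec d"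
        have "F w = (\<lambda>x. \<Sum>i<d. l2_inner H (F w) (h i) * h i x)"
          by (rule ext) (rule orthonormal_in_spans[OF W hW max FW])
        also have "\<dots> \<in> F ` U"
          by (rule translation_invariant_sum[OF inv]) (use h in \<open>auto simp: orthonormal_in_def\<close>)
        finally obtain u where u: "u \<in> U" "F w = F u" by blast
        then show "w \<in> U" using F_inj[OF u(2) w] Uc by auto
      qed
      then show ?thesis using Uc by blast
    qed
  qed
  show thesis
  proof (rule that)
    show "(d, \<pi>) \<in> irreps mul" using rep irr by (simp add: irreps_def)
    show "\<forall>j<d. \<forall>x g. f j (mul x g) = (\<Sum>i<d. \<pi> g $$ (i,j) * f i x)"
      using Rf by (simp add: R_def \<pi>_def)
  qed
qed

lemma Peter_Weyl_continuous:
  assumes \<phi>: "cts \<phi>" and z: "\<And>c. c \<in> Ghat \<Longrightarrow> conv (char_cls c) \<phi> = (\<lambda>x. 0)"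
  shows "\<phi> x = 0"
proof (rule ccontr)
  assume nz: "\<phi> x \<noteq> 0"
  \<comment> \<open>\<open>\<phi>\<close> is the left factor, so characters acting by left
    convolution still annihilate \<open>k\<close>.\<close>
  define k where "k = conv \<phi> (conv_adj \<phi>)"
  note \<phi>' = continuous_conv_adj[OF \<phi>]
  have k: "cts k" unfolding k_def by (rule continuous_conv[OF \<phi> \<phi>'])
  have invol: "conv_adj (conv_adj \<phi>) = \<phi>" by (simp add: conv_adj_def fun_eq_iff)
  have adj: "conv_adj k = k" unfolding k_def by (simp add: conv_adj_conv[OF \<phi> \<phi>'] invol)
  have "k e = of_real (l2_sq H \<phi>)" by (simp add: k_def conv_at_e invol l2_inner_self)
  then have ke: "k e \<noteq> 0" using l2_sq_zero_continuous[OF \<phi>] nz by auto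
  obtain p where p: "cts p" "conv p p = p" "p e \<noteq> 0"
    "\<And>a. cts a \<Longrightarrow> conv a k = (\<lambda>x. 0) \<Longrightarrow> conv a p = (\<lambda>x. 0)"
    using spectral_idempotent[OF k adj ke] by blast
  have chp: "conv (char_cls c) p = (\<lambda>x. 0)" if c: "c \<in> Ghat" for c
  proof (rule p(4)[OF continuous_char[OF c]])
    show "conv (char_cls c) k = (\<lambda>x. 0)"
      unfolding k_def by (simp add: conv_assoc[symmetric] continuous_char[OF c] \<phi> \<phi>' z[OF c] conv_zero_left)
  qed
  define V where "V = {f. cts f \<and> conv p f = f}"
  have V: "translation_invariant V"
    unfolding translation_invariant_def V_def
    by (auto simp: conv_zero_right conv_scale_right conv_add_right p(1) intro!: continuous_intros)
      (auto simp: conv_def fun_eq_iff mul_assoc intro!: continuous_comp continuous_intros)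
  have rep: "\<And>f. f \<in> V \<Longrightarrow> conv p f = f" by (simp add: V_def)
  have pV: "p \<in> V" using p by (simp add: V_def)
  obtain W d f where W: "W \<subseteq> V" "translation_invariant W" "d > 0" "orthonormal_in W d f"
    "\<not> (\<exists>h. orthonormal_in W (Suc d) h)"
    "\<forall>U u y. U \<subseteq> W \<and> translation_invariant U \<and> u \<in> U \<and> u y \<noteq> 0 \<longrightarrow> (\<exists>h. orthonormal_in U d h)"
    by (rule minimal_invariant_subspace[OF p(1) V rep pV p(3)])
  obtain \<pi> where \<pi>: "(d, \<pi>) \<in> irreps mul"
    "\<forall>j<d. \<forall>x g. f j (mul x g) = (\<Sum>i<d. \<pi> g $$ (i,j) * f i x)"
    by (rule minimal_subspace_irrep[OF W(2-6)])
  obtain c where c: "c \<in> Ghat" "dim_cls c = d" "\<And>g. char_cls c g = mat_trace (\<pi> g)"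
    using irrep_class[OF \<pi>(1)] by metis
  have u: "unitary_rep mul d \<pi>" using \<pi>(1) by (simp add: irreps_def)
  have f0: "f 0 \<in> W" "l2_inner H (f 0) (f 0) = 1" using W(3,4) by (auto simp: orthonormal_in_def)
  then have f0V: "cts (f 0)" "conv p (f 0) = f 0" using W(1) by (auto simp: V_def)
  have "f 0 x = 0" for x
  proof -
    \<comment> \<open>Evaluating the transformation law at \<open>e\<close> displays
      \<open>f 0\<close> as a combination of the matrix coefficients in column 0.\<close>
    have val: "f 0 g = (\<Sum>i<d. f i e * \<pi> g $$ (i,0))" for g
      using \<pi>(2)[rule_format, OF W(3), of e g] by (simp add: mult.commute)
    \<comment> \<open>Since \<open>p\<close> reproduces \<open>f 0\<close>, associativity passes the
      annihilation of \<open>p\<close> on to \<open>f 0\<close>.\<close>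
    have "conv (char_cls c) (f 0) = conv (conv (char_cls c) p) (f 0)"
      by (simp add: conv_assoc[OF continuous_char[OF c(1)] p(1) f0V(1)] f0V(2))
    also have "\<dots> = (\<lambda>x. 0)" by (simp add: chp[OF c(1)] conv_zero_left)
    finally have "0 = of_nat d * conv (char_cls c) (f 0) x" by simp
    also have "conv (char_cls c) (f 0) x
        = (\<integral>h. (\<Sum>i<d. f i e * (mat_trace (\<pi> h) * \<pi> (mul (ginv h) x) $$ (i,0))) \<partial>H)"
      unfolding conv_def by (subst val) (simp add: c(3) sum_distrib_left mult.left_commute)
    also have "\<dots> = (\<Sum>i<d. \<integral>h. f i e * (mat_trace (\<pi> h) * \<pi> (mul (ginv h) x) $$ (i,0)) \<partial>H)"
    proof (rule Bochner_Integration.integral_sum)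
      fix i assume "i \<in> {..<d}"
      then have ci: "cts (\<lambda>g. \<pi> g $$ (i,0))" using unitary_rep_continuous[OF u] W(3) by simp
      have "cts (\<lambda>h. mat_trace (\<pi> h))" using continuous_char[OF c(1)] by (simp add: c(3)[abs_def])
      then show "integrable H (\<lambda>h. f i e * (mat_trace (\<pi> h) * \<pi> (mul (ginv h) x) $$ (i,0)))"
        by (intro continuous_integrable continuous_intros continuous_comp[OF ci])
    qed
    also have "of_nat d * \<dots> = (\<Sum>i<d. f i e * \<pi> x $$ (i,0))"
      using W(3) by (simp add: sum_distrib_left mult.left_commute[of "of_nat d"]
          char_reproduces_coefficients[OF \<pi>(1)])
    also have "\<dots> = f 0 x" by (rule val[symmetric])
    finally show ?thesis by simp
  qed
  then have "f 0 = (\<lambda>x. 0)" by (simp add: fun_eq_iff)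
  with f0(2) show False by (simp add: l2_inner_def)
qed

end

section \<open>Parseval identity for the isotypic components\<close>

context haar_action
begin

text \<open>Both sides equal the inner product of the two components, by the diagonal case of
  \<open>isotypic_orthogonality\<close>.\<close>

lemma isotypic_self_adjoint:
  assumes c: "c \<in> Ghat" and f: "square_integrable M f" and f': "square_integrable M f'"
  shows "l2_inner M (isotypic c f) f' = l2_inner M f (isotypic c f')"
proof -
  have "l2_inner M f (isotypic c f') = cnj (l2_inner M (isotypic c f') f)" by (simp add: l2_inner_cnj)
  also have "\<dots> = cnj (l2_inner M (isotypic c f') (isotypic c f))"
    using isotypic_orthogonality[OF c c f' f] by simp
  also have "\<dots> = l2_inner M (isotypic c f) (isotypic c f')" by (rule l2_inner_cnj)
  also have "\<dots> = l2_inner M (isotypic c f) f'"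
    using isotypic_orthogonality[OF c c f f'] by simp
  finally show ?thesis by simp
qed

text \<open>The right-hand side is the coefficient at \<open>x\<close> of the component of
  \<open>f\<close>, with the translation moved to the second argument.\<close>

lemma isotypic_conv_coef:
  assumes c: "c \<in> Ghat" and f: "square_integrable M f" and f': "square_integrable M f'"
  shows "of_nat (dim_cls c) * conv (char_cls c) (coef f f') x
    = l2_inner M (isotypic c f) (\<lambda>y. f' (act (ginv x) y))"
proof -
  have "coef f f' (mul (ginv h) x) = coef f (\<lambda>y. f' (act (ginv x) y)) (ginv h)" for h
  proof -
    have "coef f f' (mul (ginv h) x) = l2_inner M (\<lambda>y. f (act (ginv h) (act x y))) f'"
      unfolding coef_def by (rule l2_inner_cong) (simp_all add: act_mul)
    also have "\<dots> = coef f (\<lambda>y. f' (act (ginv x) y)) (ginv h)"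
      unfolding coef_def by (rule l2_inner_act_left[OF L2_act[OF f] f'])
    finally show ?thesis .
  qed
  then show ?thesis
    by (simp add: l2_inner_isotypic_left[OF c f L2_act[OF f']] conv_def)
qed

definition isotypic_sum :: "(nat \<times> ('g \<Rightarrow> complex mat)) set set \<Rightarrow> ('x \<Rightarrow> complex) \<Rightarrow> 'x \<Rightarrow> complex" where
  "isotypic_sum F f x = (\<Sum>c\<in>F. isotypic c f x)"

context
  fixes f assumes f: "square_integrable M f"
begin

lemma L2_isotypic_sum:
  "F \<subseteq> Ghat \<Longrightarrow> square_integrable M (isotypic_sum F f)"
  unfolding isotypic_sum_def[abs_def]
  by (intro L2_sum L2_isotypic f) auto

lemma l2_inner_isotypic_self:
  "c \<in> Ghat \<Longrightarrow> l2_inner M (isotypic c f) f = of_real (l2_sq M (isotypic c f))"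
  using isotypic_orthogonality[OF _ _ f f, of c c] by (simp add: l2_inner_self)

lemma l2_inner_isotypic_sum_left:
  assumes F: "F \<subseteq> Ghat" and h: "square_integrable M h"
  shows "l2_inner M (isotypic_sum F f) h = (\<Sum>c\<in>F. l2_inner M (isotypic c f) h)"
  unfolding isotypic_sum_def[abs_def]
  by (rule l2_inner_sum_left) (use F L2_isotypic f h in auto)

lemma l2_sq_isotypic_sum:
  assumes F: "F \<subseteq> Ghat" "finite F"
  shows "l2_sq M (isotypic_sum F f) = (\<Sum>c\<in>F. l2_sq M (isotypic c f))"
proof -
  note iso = L2_isotypic[OF _ f]
  have *: "l2_inner M (isotypic c f) (isotypic_sum F f) = of_real (l2_sq M (isotypic c f))" if c: "c \<in> F" for c
  proof -
    have "l2_inner M (isotypic c f) (isotypic_sum F f) = (\<Sum>c'\<in>F. l2_inner M (isotypic c f) (isotypic c' f))"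
      unfolding isotypic_sum_def[abs_def] by (rule l2_inner_sum_right) (use F c iso in auto)
    also have "\<dots> = (\<Sum>c'\<in>F. if c' = c then of_real (l2_sq M (isotypic c f)) else 0)"
    proof (rule sum.cong[OF refl])
      fix c' assume c': "c' \<in> F"
      have D: "c \<in> Ghat" "c' \<in> Ghat" using c c' F by auto
      show "l2_inner M (isotypic c f) (isotypic c' f) = (if c' = c then of_real (l2_sq M (isotypic c f)) else 0)"
        unfolding isotypic_orthogonality[OF D f f] using l2_inner_isotypic_self[OF D(1)] by auto
    qed
    also have "\<dots> = of_real (l2_sq M (isotypic c f))" using F c by simp
    finally show ?thesis .
  qed
  have "complex_of_real (l2_sq M (isotypic_sum F f)) = (\<Sum>c\<in>F. l2_inner M (isotypic c f) (isotypic_sum F f))"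
    unfolding l2_inner_self[symmetric]
    by (rule l2_inner_isotypic_sum_left[OF F(1) L2_isotypic_sum[OF F(1)]])
  also have "\<dots> = of_real (\<Sum>c\<in>F. l2_sq M (isotypic c f))" by (simp add: *)
  finally show ?thesis by (simp only: of_real_eq_iff)
qed

lemma l2_sq_minus_isotypic_sum:
  assumes F: "F \<subseteq> Ghat" "finite F"
  shows "l2_sq M (\<lambda>x. f x - isotypic_sum F f x) = l2_sq M f - (\<Sum>c\<in>F. l2_sq M (isotypic c f))"
proof -
  have "l2_inner M (isotypic_sum F f) f = of_real (\<Sum>c\<in>F. l2_sq M (isotypic c f))"
    using F by (auto simp: l2_inner_isotypic_sum_left[OF F(1) f] l2_inner_isotypic_self intro!: sum.cong)
  then have "l2_inner M f (isotypic_sum F f) = of_real (\<Sum>c\<in>F. l2_sq M (isotypic c f))"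
    by (metis complex_cnj_complex_of_real l2_inner_cnj)
  then show ?thesis
    using l2_sq_diff_expand[OF f L2_isotypic_sum[OF F(1)]] by (simp add: l2_sq_isotypic_sum[OF F])
qed

lemma isotypic_Parseval: "((\<lambda>c. l2_sq M (isotypic c f)) has_sum l2_sq M f) Ghat"
proof -
  let ?D = "Ghat" and ?n = "\<lambda>c. l2_sq M (isotypic c f)"
  have Bessel: "sum ?n F \<le> l2_sq M f" if "finite F" "F \<subseteq> ?D" for F
    using l2_sq_minus_isotypic_sum[OF that(2,1)] l2_sq_nonneg[of M "\<lambda>x. f x - isotypic_sum F f x"] by simp
  have "?n summable_on ?D"
    by (rule nonneg_bdd_above_summable_on) (auto intro!: bdd_aboveI2[of _ _ "l2_sq M f"] Bessel simp: l2_sq_nonneg)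
  then obtain A where A: "(?n has_sum A) ?D" by (auto simp: summable_on_def)
  \<comment> \<open>A sequence of finite sets is extracted from the net of all finite subsets, so
    that uniform limits can be taken along sequences; the unions \<open>G n\<close> make it
    increasing.\<close>
  have "\<exists>F. finite F \<and> F \<subseteq> ?D \<and> (\<forall>G. finite G \<and> F \<subseteq> G \<and> G \<subseteq> ?D \<longrightarrow> \<bar>sum ?n G - A\<bar> < inverse (real (Suc n)))" for n
  proof -
    have "\<forall>\<^sub>F F in finite_subsets_at_top ?D. dist (sum ?n F) A < inverse (real (Suc n))"
      using A unfolding has_sum_def by (intro tendstoD) auto
    then show ?thesis by (auto simp: eventually_finite_subsets_at_top dist_real_def)
  qed
  then obtain F where F: "\<And>n. finite (F n)" "\<And>n. F n \<subseteq> ?D"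
    "\<And>n G. finite G \<Longrightarrow> F n \<subseteq> G \<Longrightarrow> G \<subseteq> ?D \<Longrightarrow> \<bar>sum ?n G - A\<bar> < inverse (real (Suc n))"
    by metis
  define G where "G n = (\<Union>k\<le>n. F k)" for n
  have G: "finite (G n)" "G n \<subseteq> ?D" for n using F by (auto simp: G_def)
  have G_mono: "G m \<subseteq> G n" if "m \<le> n" for m n using that by (fastforce simp: G_def)
  have FG: "F m \<subseteq> G n" if "m \<le> n" for m n using that by (auto simp: G_def)
  define u where "u n = isotypic_sum (G n) f" for n
  have u: "square_integrable M (u n)" for n unfolding u_def by (rule L2_isotypic_sum[OF G(2)])
  define s where "s n = coef (u n) f" for n
  have s: "cts (s n)" for n unfolding s_def by (rule continuous_coef[OF u f])
  \<comment> \<open>The bound is uniform in \<open>g\<close> because the action is isometric on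
    \<open>L\<^sup>2(M)\<close>.\<close>
  have diff: "(cmod (s n g - s m g))\<^sup>2 \<le> (sum ?n (G n) - sum ?n (G m)) * l2_sq M f" if "m \<le> n" for m n g
  proof -
    let ?w = "isotypic_sum (G n - G m) f"
    have sub: "G n - G m \<subseteq> ?D" "finite (G n - G m)" using G by auto
    note w = L2_isotypic_sum[OF sub(1)]
    have "u n x - u m x = ?w x" for x
      unfolding u_def isotypic_sum_def using G(1) G_mono[OF that] by (simp add: sum_diff)
    then have "s n g - s m g = l2_inner M (\<lambda>x. ?w (act g x)) f"
      unfolding s_def coef_def
      by (subst l2_inner_diff_left[symmetric]) (use u f in \<open>auto intro: L2_act\<close>)
    then have "(cmod (s n g - s m g))\<^sup>2 \<le> l2_sq M ?w * l2_sq M f"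
      using l2_Cauchy_Schwarz[OF L2_act[OF w] f] l2_sq_act[OF w] by simp
    also have "l2_sq M ?w = sum ?n (G n) - sum ?n (G m)"
      unfolding l2_sq_isotypic_sum[OF sub] using G(1) G_mono[OF that] by (simp add: sum_diff)
    finally show ?thesis .
  qed
  have "uniformly_Cauchy_on UNIV s"
  proof (rule uniformly_Cauchy_onI')
    fix \<epsilon> :: real assume e: "\<epsilon> > 0"
    let ?L = "l2_sq M f + 1"
    have L: "?L > 0" using l2_sq_nonneg[of M f] by simp
    \<comment> \<open>Two partial sums within \<open>\<delta>\<close> of \<open>A\<close> differ by
      less than \<open>2 * \<delta>\<close>; the 1 in \<open>?L\<close> keeps the quotient defined
      and the final inequality strict.\<close>
    define \<delta> where "\<delta> = \<epsilon>\<^sup>2 / (2 * ?L)"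
    have \<delta>: "2 * \<delta> = \<epsilon>\<^sup>2 / ?L" using L by (simp add: \<delta>_def field_simps)
    have "\<delta> > 0" using e L by (simp add: \<delta>_def)
    then obtain N where N: "inverse (real (Suc N)) < \<delta>" using reals_Archimedean by blast
    have "dist (s m g) (s n g) < \<epsilon>" if "m \<ge> N" "n > m" for m n g
    proof -
      have "\<bar>sum ?n (G n) - A\<bar> < inverse (real (Suc N))" "\<bar>sum ?n (G m) - A\<bar> < inverse (real (Suc N))"
        by (rule F(3)[OF G(1) FG G(2)], use that in simp)+
      then have "sum ?n (G n) - sum ?n (G m) < \<epsilon>\<^sup>2 / ?L" unfolding \<delta>[symmetric] using N by linarith
      then have "(sum ?n (G n) - sum ?n (G m)) * l2_sq M f \<le> \<epsilon>\<^sup>2 / ?L * l2_sq M f"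
        using l2_sq_nonneg[of M f] by (intro mult_right_mono) auto
      also have "\<dots> < \<epsilon>\<^sup>2" using L e by (simp add: field_simps)
      finally have "(dist (s m g) (s n g))\<^sup>2 < \<epsilon>\<^sup>2"
        using diff[of m n g] that by (simp add: dist_norm norm_minus_commute)
      then show ?thesis using e by (simp add: power_less_imp_less_base)
    qed
    then show "\<exists>N. \<forall>g\<in>UNIV. \<forall>m\<ge>N. \<forall>n>m. dist (s m g) (s n g) < \<epsilon>" by blast
  qed
  then obtain t where lim: "uniform_limit UNIV s t sequentially"
    using Cauchy_uniformly_convergent[of UNIV s] by (auto simp: uniformly_convergent_on_def)
  have t: "cts t" by (rule uniform_limit_theorem[OF _ lim]) (auto simp: s)
  have l2lim: "(\<lambda>n. l2_sq H (\<lambda>x. s n x - t x)) \<longlonglongrightarrow> 0" by (rule uniform_limit_l2[OF t s lim])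
  have cff: "cts (coef f f)" by (rule continuous_coef[OF f f])
  have conv_eq: "conv (char_cls c) (coef f f) x = conv (char_cls c) t x" if c: "c \<in> ?D" for c x
  proof -
    let ?d = "of_nat (dim_cls c) :: complex" and ?fx = "\<lambda>y. f (act (ginv x) y)"
    have d0: "?d \<noteq> 0" using unitary_dual_rep[OF c] by (metis less_irrefl of_nat_eq_0_iff)
    note fx = L2_act[OF f, of "ginv x"]
    \<comment> \<open>Self-adjointness moves the component map off the partial sum, and
      orthogonality leaves at most the summand of class \<open>c\<close>.\<close>
    have sn: "?d * conv (char_cls c) (s n) x = (if c \<in> G n then l2_inner M (isotypic c f) ?fx else 0)" for n
    proof -
      have "?d * conv (char_cls c) (s n) x = l2_inner M (u n) (isotypic c ?fx)"
        unfolding s_def isotypic_conv_coef[OF c u f] by (rule isotypic_self_adjoint[OF c u fx])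
      also have "\<dots> = (\<Sum>c'\<in>G n. l2_inner M (isotypic c' f) (isotypic c ?fx))"
        unfolding u_def by (rule l2_inner_isotypic_sum_left[OF G(2) L2_isotypic[OF c fx]])
      also have "\<dots> = (\<Sum>c'\<in>G n. if c' = c then l2_inner M (isotypic c f) ?fx else 0)"
      proof (rule sum.cong[OF refl])
        fix c' assume "c' \<in> G n"
        then have "c' \<in> ?D" using G(2) by blast
        from isotypic_orthogonality[OF this c f fx]
        show "l2_inner M (isotypic c' f) (isotypic c ?fx) = (if c' = c then l2_inner M (isotypic c f) ?fx else 0)"
          by auto
      qed
      also have "\<dots> = (if c \<in> G n then l2_inner M (isotypic c f) ?fx else 0)" using G(1) by simp
      finally show ?thesis .
    qed
    have tlim: "(\<lambda>n. ?d * conv (char_cls c) (s n) x) \<longlonglongrightarrow> ?d * conv (char_cls c) t x"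
      by (intro tendsto_mult_left conv_tendsto(1)[OF continuous_char[OF c] t s l2lim])
    have "(\<lambda>n. ?d * conv (char_cls c) (s n) x) \<longlonglongrightarrow> l2_inner M (isotypic c f) ?fx"
    proof (cases "\<exists>N. c \<in> G N")
      case True
      then obtain N where "c \<in> G N" by blast
      then have "c \<in> G n" if "n \<ge> N" for n using G_mono[OF that] by blast
      then show ?thesis unfolding sn by (intro tendsto_eventually eventually_sequentiallyI[of N]) simp
    next
      case False
      \<comment> \<open>The sets \<open>G n\<close> need not exhaust the dual. If \<open>c\<close>
        is never reached, adjoining it to \<open>G n\<close> keeps the sum within
        \<open>inverse (real (Suc n))\<close> of \<open>A\<close>, so the component of
        \<open>c\<close> has norm 0.\<close>
      have "?n c \<le> 2 * inverse (real (Suc n))" for n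
      proof -
        have "\<bar>sum ?n (insert c (G n)) - A\<bar> < inverse (real (Suc n))"
          by (rule F(3)) (use c G FG[of n n] in \<open>simp_all add: subset_insertI2\<close>)
        moreover have "\<bar>sum ?n (G n) - A\<bar> < inverse (real (Suc n))"
          by (rule F(3)[OF G(1) FG[OF order_refl] G(2)])
        moreover have "sum ?n (insert c (G n)) = ?n c + sum ?n (G n)" using False G(1) by simp
        ultimately show ?thesis by linarith
      qed
      moreover have "(\<lambda>n. 2 * inverse (real (Suc n))) \<longlonglongrightarrow> 2 * 0"
        by (intro tendsto_mult_left LIMSEQ_inverse_real_of_nat)
      ultimately have "?n c \<le> 0" using LIMSEQ_le_const by fastforce
      then have "l2_inner M (isotypic c f) ?fx = 0"
        using l2_sq_zero_inner[OF L2_isotypic[OF c f] fx] l2_sq_nonneg[of M "isotypic c f"] by simp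
      then show ?thesis unfolding sn using False by simp
    qed
    then have "?d * conv (char_cls c) t x = l2_inner M (isotypic c f) ?fx"
      by (rule LIMSEQ_unique[OF tlim])
    then have "?d * conv (char_cls c) (coef f f) x = ?d * conv (char_cls c) t x"
      by (simp only: isotypic_conv_coef[OF c f f])
    then show ?thesis unfolding mult_left_cancel[OF d0] .
  qed
  have "(\<lambda>x. coef f f x - t x) e = 0"
  proof (rule Peter_Weyl_continuous)
    show "cts (\<lambda>x. coef f f x - t x)" by (intro continuous_intros cff t)
    show "conv (char_cls c) (\<lambda>x. coef f f x - t x) = (\<lambda>x. 0)" if "c \<in> ?D" for c
      using conv_eq[OF that] by (simp add: conv_diff_right[OF continuous_char[OF that] cff t])
  qed
  then have "t e = of_real (l2_sq M f)"
    by (simp add: coef_def l2_inner_act_e_left[OF f f] l2_inner_self)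
  moreover have "s n e = of_real (sum ?n (G n))" for n
  proof -
    have "s n e = l2_inner M (u n) f" unfolding s_def coef_def by (rule l2_inner_act_e_left[OF u f])
    also have "\<dots> = (\<Sum>c\<in>G n. l2_inner M (isotypic c f) f)"
      unfolding u_def by (rule l2_inner_isotypic_sum_left[OF G(2) f])
    also have "\<dots> = (\<Sum>c\<in>G n. of_real (?n c))"
      using G(2)[of n] by (intro sum.cong) (auto simp: l2_inner_isotypic_self)
    finally show ?thesis by simp
  qed
  ultimately have "(\<lambda>n. complex_of_real (sum ?n (G n))) \<longlonglongrightarrow> of_real (l2_sq M f)"
    using tendsto_uniform_limitI[OF lim, of e] by simp
  then have "(\<lambda>n. sum ?n (G n)) \<longlonglongrightarrow> l2_sq M f" by (simp only: tendsto_of_real_iff)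
  moreover have "(\<lambda>n. sum ?n (G n)) \<longlonglongrightarrow> A"
  proof (rule LIM_zero_cancel, rule Lim_null_comparison)
    show "\<forall>\<^sub>F n in sequentially. norm (sum ?n (G n) - A) \<le> inverse (real (Suc n))"
      using F(3)[OF G(1) FG[OF order_refl] G(2)] by (intro always_eventually) (auto intro: less_imp_le)
  qed (rule LIMSEQ_inverse_real_of_nat)
  ultimately have "A = l2_sq M f" by (rule LIMSEQ_unique[rotated])
  with A show ?thesis by simp
qed

lemma isotypic_expansion:
  "((\<lambda>F. l2_sq M (\<lambda>x. f x - (\<Sum>c\<in>F. isotypic c f x))) \<longlongrightarrow> 0) (finite_subsets_at_top Ghat)"
proof -
  have "((\<lambda>F. l2_sq M f - (\<Sum>c\<in>F. l2_sq M (isotypic c f))) \<longlongrightarrow> l2_sq M f - l2_sq M f)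
      (finite_subsets_at_top Ghat)"
    using isotypic_Parseval unfolding has_sum_def by (intro tendsto_intros)
  moreover have "\<forall>\<^sub>F F in finite_subsets_at_top Ghat.
      l2_sq M f - (\<Sum>c\<in>F. l2_sq M (isotypic c f)) = l2_sq M (\<lambda>x. f x - (\<Sum>c\<in>F. isotypic c f x))"
    by (rule eventually_finite_subsets_at_top_weakI)
      (simp add: l2_sq_minus_isotypic_sum[symmetric] isotypic_sum_def)
  ultimately show ?thesis by (simp add: tendsto_cong)
qed

text \<open>By \<open>isotypic_orthogonality\<close> a partial sum equals the inner product of the
  partial sum of \<open>f\<close> with \<open>h\<close> itself, so Cauchy-Schwarz bounds the error
  by the residual of \<open>f\<close>.\<close>

lemma isotypic_inner_has_sum:
  assumes h: "square_integrable M h"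
  shows "((\<lambda>c. l2_inner M (isotypic c f) (isotypic c h)) has_sum l2_inner M f h) Ghat"
  unfolding has_sum_def
proof (rule LIM_zero_cancel, rule Lim_null_comparison)
  let ?r = "\<lambda>F. l2_sq M (\<lambda>x. f x - isotypic_sum F f x)"
  have "(?r \<longlongrightarrow> 0) (finite_subsets_at_top Ghat)"
    using isotypic_expansion by (simp add: isotypic_sum_def)
  then have "((\<lambda>F. sqrt (?r F * l2_sq M h)) \<longlongrightarrow> sqrt (0 * l2_sq M h)) (finite_subsets_at_top Ghat)"
    by (intro tendsto_intros)
  then show "((\<lambda>F. sqrt (?r F * l2_sq M h)) \<longlongrightarrow> 0) (finite_subsets_at_top Ghat)" by simp
  show "\<forall>\<^sub>F F in finite_subsets_at_top Ghat.
      cmod ((\<Sum>c\<in>F. l2_inner M (isotypic c f) (isotypic c h)) - l2_inner M f h) \<le> sqrt (?r F * l2_sq M h)"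
  proof (rule eventually_finite_subsets_at_top_weakI)
    fix F assume F: "finite F" "F \<subseteq> Ghat"
    note Fs = L2_isotypic_sum[OF F(2)]
    have "(\<Sum>c\<in>F. l2_inner M (isotypic c f) (isotypic c h)) = l2_inner M (isotypic_sum F f) h"
      unfolding l2_inner_isotypic_sum_left[OF F(2) h]
      using F(2) by (intro sum.cong) (auto simp: isotypic_orthogonality f h)
    then have "cmod ((\<Sum>c\<in>F. l2_inner M (isotypic c f) (isotypic c h)) - l2_inner M f h)
        = cmod (l2_inner M (\<lambda>x. f x - isotypic_sum F f x) h)"
      by (simp add: l2_inner_diff_left[OF f Fs h] norm_minus_commute)
    also have "\<dots> \<le> sqrt (?r F * l2_sq M h)"
      by (rule l2_Cauchy_Schwarz_sqrt[OF L2_diff[OF f Fs] h])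
    finally show "cmod ((\<Sum>c\<in>F. l2_inner M (isotypic c f) (isotypic c h)) - l2_inner M f h) \<le> sqrt (?r F * l2_sq M h)" .
  qed
qed

end

end

text \<open>Invariance is stated through Bochner integrals, which are \<open>0\<close> for non-integrable functions, so a set
  \<open>A\<close> of finite measure only yields \<open>enn2real (\<mu> (act g -` A)) = enn2real (\<mu> A)\<close>. Infinite preimages of
  null sets are excluded by adjoining a set of positive finite measure.\<close>

lemma invariant_measure_distr:
  assumes sf: "sigma_finite_measure M" and meas[measurable]: "act g \<in> measurable M M"
    and inv: "invariant_measure act M"
  shows "distr M M (act g) = M"
proof -
  interpret sigma_finite_measure M by fact
  let ?N = "distr M M (act g)"
  have eq: "enn2real (emeasure ?N A) = enn2real (emeasure M A)" if A: "A \<in> sets M" "emeasure M A < \<infinity>" for A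
  proof -
    have "integrable M (\<lambda>y. complex_of_real (indicator A y))" using A by simp
    then have "(\<integral>y. complex_of_real (indicator A y) \<partial>M) = (\<integral>y. complex_of_real (indicator A (act g y)) \<partial>M)"
      using inv unfolding invariant_measure_def by blast
    also have "\<dots> = (\<integral>y. complex_of_real (indicator A y) \<partial>?N)" using A by (subst integral_distr) auto
    finally have "measure M A = measure ?N A"
      using A sets.sets_into_space[OF A(1)] by (simp add: Int_absorb2)
    then show ?thesis by (simp add: measure_def)
  qed
  have pos: "emeasure ?N A = emeasure M A" if A: "A \<in> sets M" "emeasure M A < \<infinity>" "emeasure M A > 0" for A
  proof -
    \<comment> \<open>A positive value of \<open>enn2real\<close> certifies finiteness, because
      infinity is sent to 0.\<close>
    have "enn2real (emeasure M A) > 0" using A by (simp add: enn2real_positive_iff)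
    then have "enn2real (emeasure ?N A) > 0" using eq[OF A(1,2)] by simp
    then have "emeasure ?N A < \<infinity>" by (simp add: enn2real_positive_iff)
    then show ?thesis using eq[OF A(1,2)] A(2)
      by (metis ennreal_enn2real infinity_ennreal_def)
  qed
  obtain B :: "nat \<Rightarrow> _" where B: "range B \<subseteq> sets M" "(\<Union>i. B i) = space M" "\<And>i. emeasure M (B i) \<noteq> \<infinity>" "incseq B"
    using sigma_finite_incseq by metis
  have null: "emeasure ?N A = 0" if A: "A \<in> sets M" "emeasure M A = 0" for A
  proof (cases "\<exists>i. emeasure M (B i) > 0")
    case True
    then obtain i where i: "emeasure M (B i) > 0" by blast
    have Bi: "B i \<in> sets M" "emeasure M (B i) < \<infinity>" using B(1,3) by (auto simp: less_top)
    have U: "emeasure M (B i \<union> A) = emeasure M (B i)"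
      using Bi A by (intro emeasure_Un_null_set) (auto simp: null_sets_def)
    have "emeasure ?N A \<le> emeasure ?N (B i \<union> A)" using A Bi by (intro emeasure_mono) auto
    also have "\<dots> = emeasure M (B i)" using pos[of "B i \<union> A"] i U A Bi by simp
    finally have "emeasure ?N A < \<infinity>" using Bi(2) by (rule order_le_less_trans)
    then show ?thesis using eq[of A] A by (auto simp: enn2real_eq_0_iff)
  next
    case False
    \<comment> \<open>In this case \<open>M\<close> is the zero measure, and so is its
      image.\<close>
    then have "emeasure M (\<Union>i. B i) = 0" using B(1) by (intro emeasure_UN_eq_0) auto
    moreover have "act g -` space M \<inter> space M = space M" using measurable_space[OF meas] by auto
    ultimately have "emeasure ?N (space ?N) = 0" by (simp add: B(2) emeasure_distr)
    then show ?thesis using emeasure_space[of ?N A] by simp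
  qed
  show ?thesis
  proof (rule measure_eqI)
    fix A assume "A \<in> sets ?N"
    then have A: "A \<in> sets M" by simp
    have BM: "B i \<in> sets M" for i using B(1) by blast
    have inc: "incseq (\<lambda>i. A \<inter> B i)" using B(4) by (auto simp: incseq_def)
    have U: "(\<Union>i. A \<inter> B i) = A" using B(2) sets.sets_into_space[OF A] by blast
    have "emeasure ?N (A \<inter> B i) = emeasure M (A \<inter> B i)" for i
    proof -
      have "emeasure M (A \<inter> B i) \<le> emeasure M (B i)" by (rule emeasure_mono) (use BM in auto)
      then have "emeasure M (A \<inter> B i) < \<infinity>" using B(3)[of i] by (simp add: less_top order_le_less_trans)
      then show ?thesis
        using pos[of "A \<inter> B i"] null[of "A \<inter> B i"] A BM[of i] by (cases "emeasure M (A \<inter> B i) = 0") (auto simp: zero_less_iff_neq_zero)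
    qed
    moreover have "range (\<lambda>i. A \<inter> B i) \<subseteq> sets M" using A BM by auto
    ultimately show "emeasure ?N A = emeasure M A"
      using SUP_emeasure_incseq[of "\<lambda>i. A \<inter> B i" ?N] SUP_emeasure_incseq[of "\<lambda>i. A \<inter> B i" M] inc U by simp
  qed simp
qed

text \<open>A product of sigma-finite measures is determined on rectangles, and the map pulls
  rectangles back to rectangles.\<close>

lemma distr_pair_act:
  assumes sf: "sigma_finite_measure P" "sigma_finite_measure M"
    and T: "T \<in> measurable M M" "distr M M T = M"
  shows "distr (P \<Otimes>\<^sub>M M) (P \<Otimes>\<^sub>M M) (\<lambda>(w, y). (w, T y)) = P \<Otimes>\<^sub>M M"
proof (rule pair_measure_eqI[symmetric])
  note [measurable] = T(1)
  interpret M: sigma_finite_measure M by fact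
  show "sets (P \<Otimes>\<^sub>M M) = sets (distr (P \<Otimes>\<^sub>M M) (P \<Otimes>\<^sub>M M) (\<lambda>(w, y). (w, T y)))" by simp
  fix A B assume AB: "A \<in> sets P" "B \<in> sets M"
  have "(\<lambda>(w, y). (w, T y)) -` (A \<times> B) \<inter> space (P \<Otimes>\<^sub>M M) = A \<times> (T -` B \<inter> space M)"
    using sets.sets_into_space[OF AB(1)] by (auto simp: space_pair_measure)
  moreover have "emeasure M (T -` B \<inter> space M) = emeasure M B"
    using T AB(2) by (metis emeasure_distr)
  ultimately show "emeasure P A * emeasure M B
      = emeasure (distr (P \<Otimes>\<^sub>M M) (P \<Otimes>\<^sub>M M) (\<lambda>(w, y). (w, T y))) (A \<times> B)"
    using AB by (simp add: emeasure_distr M.emeasure_pair_measure_Times)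
qed (use sf in auto)

theorem theorem5:
  fixes mul :: "'g::{t2_space, second_countable_topology} \<Rightarrow> 'g \<Rightarrow> 'g"
    and ginv :: "'g \<Rightarrow> 'g" and e :: 'g
    and H :: "'g measure"
    and act :: "'g \<Rightarrow> 'y \<Rightarrow> 'y"
    and \<mu> :: "'y measure"
    and P :: "'w measure"
    and S Z :: "'w \<Rightarrow> 'y \<Rightarrow> complex"
  assumes G: "compact_group mul ginv e"
    and haar: "normalized_haar mul H"
    and action: "measurable_action mul H act \<mu>"
    and probP: "prob_space P"
    and singletons: "\<forall>\<omega>\<in>space P. {\<omega>} \<in> sets P"
    and S_meas: "(\<lambda>(\<omega>, y). S \<omega> y) \<in> borel_measurable (P \<Otimes>\<^sub>M \<mu>)"
    and Z_meas: "(\<lambda>(\<omega>, y). Z \<omega> y) \<in> borel_measurable (P \<Otimes>\<^sub>M \<mu>)"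
    and S_L2G: "\<forall>\<omega>\<in>space P. \<forall>y\<in>space \<mu>. square_integrable H (\<lambda>g. S \<omega> (act g y))"
    and Z_L2G: "\<forall>\<omega>\<in>space P. \<forall>y\<in>space \<mu>. square_integrable H (\<lambda>g. Z \<omega> (act g y))"
    and sfin: "sigma_finite_measure \<mu>"
    and inv_mu: "invariant_measure act \<mu>"
    and Z_L2Gmu: "\<forall>\<omega>\<in>space P. square_integrable (H \<Otimes>\<^sub>M \<mu>) (\<lambda>(g, y). Z \<omega> (act g y))"
    and S_L2Gmu: "\<forall>\<omega>\<in>space P. square_integrable (H \<Otimes>\<^sub>M \<mu>) (\<lambda>(g, y). S \<omega> (act g y))"
    and Z_L2mu: "\<forall>\<omega>\<in>space P. \<forall>g. square_integrable \<mu> (\<lambda>y. Z \<omega> (act g y))"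
    and S_L2mu: "\<forall>\<omega>\<in>space P. \<forall>g. square_integrable \<mu> (\<lambda>y. S \<omega> (act g y))"
  shows
    \<comment> \<open>(1) orthogonality of isotypic projections\<close>
    "(\<forall>\<omega>\<in>space P. \<forall>g. \<forall>c1\<in>unitary_dual mul. \<forall>c2\<in>unitary_dual mul. c1 \<noteq> c2 \<longrightarrow>
        integrable \<mu> (\<lambda>y. proj_star mul ginv H act c1 S g \<omega> y * cnj (proj_star mul ginv H act c2 Z g \<omega> y)) \<and>
        (\<integral>y. proj_star mul ginv H act c1 S g \<omega> y * cnj (proj_star mul ginv H act c2 Z g \<omega> y) \<partial>\<mu>) = 0)
   \<and>
    \<comment> \<open>(2) orthogonal L2(mu) expansions and Parseval-type identity\<close>
    (\<forall>\<omega>\<in>space P.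
        (\<forall>c\<in>unitary_dual mul.
            square_integrable \<mu> (\<lambda>y. proj_star mul ginv H act c S e \<omega> y) \<and>
            square_integrable \<mu> (\<lambda>y. proj_star mul ginv H act c Z e \<omega> y)) \<and>
        (\<forall>c1\<in>unitary_dual mul. \<forall>c2\<in>unitary_dual mul. c1 \<noteq> c2 \<longrightarrow>
            (\<integral>y. proj_star mul ginv H act c1 S e \<omega> y * cnj (proj_star mul ginv H act c2 S e \<omega> y) \<partial>\<mu>) = 0 \<and>
            (\<integral>y. proj_star mul ginv H act c1 Z e \<omega> y * cnj (proj_star mul ginv H act c2 Z e \<omega> y) \<partial>\<mu>) = 0) \<and>
        ((\<lambda>F. \<integral>y. (cmod (S \<omega> y - (\<Sum>c\<in>F. proj_star mul ginv H act c S e \<omega> y)))\<^sup>2 \<partial>\<mu>)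
            \<longlongrightarrow> 0) (finite_subsets_at_top (unitary_dual mul)) \<and>
        ((\<lambda>F. \<integral>y. (cmod (Z \<omega> y - (\<Sum>c\<in>F. proj_star mul ginv H act c Z e \<omega> y)))\<^sup>2 \<partial>\<mu>)
            \<longlongrightarrow> 0) (finite_subsets_at_top (unitary_dual mul)) \<and>
        ((\<lambda>c. \<integral>y. proj_star mul ginv H act c S e \<omega> y * cnj (proj_star mul ginv H act c Z e \<omega> y) \<partial>\<mu>)
            has_sum (\<integral>y. S \<omega> y * cnj (Z \<omega> y) \<partial>\<mu>)) (unitary_dual mul))
   \<and>
    \<comment> \<open>(3) expansion in L2(P x mu)\<close>
    (square_integrable (P \<Otimes>\<^sub>M \<mu>) (\<lambda>(\<omega>, y). Z \<omega> y) \<longrightarrow>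
        (\<forall>c\<in>unitary_dual mul.
            square_integrable (P \<Otimes>\<^sub>M \<mu>) (\<lambda>(\<omega>, y). proj_star mul ginv H act c Z e \<omega> y)) \<and>
        (\<forall>c1\<in>unitary_dual mul. \<forall>c2\<in>unitary_dual mul. c1 \<noteq> c2 \<longrightarrow>
            (\<integral>p. (case p of (\<omega>, y) \<Rightarrow> proj_star mul ginv H act c1 Z e \<omega> y * cnj (proj_star mul ginv H act c2 Z e \<omega> y)) \<partial>(P \<Otimes>\<^sub>M \<mu>)) = 0) \<and>
        ((\<lambda>F. \<integral>p. (case p of (\<omega>, y) \<Rightarrow> (cmod (Z \<omega> y - (\<Sum>c\<in>F. proj_star mul ginv H act c Z e \<omega> y)))\<^sup>2) \<partial>(P \<Otimes>\<^sub>M \<mu>))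
            \<longlongrightarrow> 0) (finite_subsets_at_top (unitary_dual mul)))"
proof -
  let ?p = "proj_star mul ginv H act" and ?D = "unitary_dual mul"
  interpret haar_group mul ginv e H using G haar by unfold_locales
  interpret sigma_finite_measure \<mu> by (rule sfin)
  interpret P: prob_space P by (rule probP)
  interpret PM: pair_sigma_finite P \<mu> ..
  have act_meas: "(\<lambda>(g, y). act g y) \<in> measurable (H \<Otimes>\<^sub>M \<mu>) \<mu>"
    and act_mul: "\<And>g h y. y \<in> space \<mu> \<Longrightarrow> act (mul g h) y = act g (act h y)"
    using action by (auto simp: measurable_action_def)
  have act_g[measurable]: "act g \<in> measurable \<mu> \<mu>" for g
    using measurable_compose[OF measurable_Pair1'[of g H \<mu>] act_meas] by simp
  have distr: "distr \<mu> \<mu> (act g) = \<mu>" for g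
    by (rule invariant_measure_distr[OF sfin act_g inv_mu])
  interpret Y: haar_action mul ginv e H act \<mu>
    by unfold_locales (use act_meas act_mul distr in auto)
  let ?X = "P \<Otimes>\<^sub>M \<mu>" and ?act = "\<lambda>g (\<omega>::'w, y). (\<omega>, act g y)"
  interpret X: haar_action mul ginv e H ?act ?X
  proof unfold_locales
    have "(\<lambda>p. (fst (snd p), act (fst p) (snd (snd p)))) \<in> measurable (H \<Otimes>\<^sub>M ?X) ?X"
      using measurable_compose[OF _ act_meas, of "\<lambda>p. (fst p, snd (snd p))" "H \<Otimes>\<^sub>M ?X"] by simp
    then show "(\<lambda>(g, x). case x of (\<omega>, y) \<Rightarrow> (\<omega>, act g y)) \<in> measurable (H \<Otimes>\<^sub>M ?X) ?X"
      by (simp add: case_prod_unfold)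
    show "?act (mul g h) x = ?act g (?act h x)" if "x \<in> space ?X" for g h x
      using that by (auto simp: space_pair_measure act_mul)
    show "distr ?X ?X (?act g) = ?X" for g
      by (rule distr_pair_act[OF P.sigma_finite_measure_axioms sfin act_g distr])
  qed
  have star_e: "?p c f e \<omega> = Y.isotypic c (f \<omega>)" for c f and \<omega> :: 'w
    by (simp add: proj_star_def Y.isotypic_def fun_eq_iff)
  \<comment> \<open>Evaluation at \<open>g\<close> is the component at \<open>act g y\<close>; this
    uses the action law and so holds only for \<open>y\<close> in the space.\<close>
  have star: "?p c f g \<omega> y = Y.isotypic c (f \<omega>) (act g y)"
    if "y \<in> space \<mu>" for c f g y and \<omega> :: 'w
    using that by (simp add: proj_star_def Y.isotypic_act)
  have star_X: "X.isotypic c (\<lambda>(\<omega>, y). f \<omega> y) = (\<lambda>(\<omega>, y). ?p c f e \<omega> y)"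
    for c and f :: "'w \<Rightarrow> 'y \<Rightarrow> complex"
    by (simp add: proj_star_def X.isotypic_def fun_eq_iff)
  \<comment> \<open>The hypothesis at \<open>g = e\<close> concerns the composite with
    \<open>act e\<close>; invariance of the measure under \<open>act e\<close> removes it.\<close>
  have sq: "square_integrable \<mu> (f \<omega>)"
    if f: "(\<lambda>(\<omega>, y). f \<omega> y) \<in> borel_measurable ?X" and \<omega>: "\<omega> \<in> space P"
      and L2: "square_integrable \<mu> (\<lambda>y. f \<omega> (act e y))" for f :: "'w \<Rightarrow> 'y \<Rightarrow> complex" and \<omega>
  proof -
    have [measurable]: "f \<omega> \<in> borel_measurable \<mu>"
      using measurable_compose[OF measurable_Pair1'[OF \<omega>] f] by simp
    have "integrable (distr \<mu> \<mu> (act e)) (\<lambda>y. (cmod (f \<omega> y))\<^sup>2)"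
      by (subst integrable_distr_eq) (use L2 in \<open>auto simp: square_integrable_def\<close>)
    then show ?thesis by (simp add: distr square_integrable_def)
  qed
  have S: "square_integrable \<mu> (S \<omega>)" and Z: "square_integrable \<mu> (Z \<omega>)" if "\<omega> \<in> space P" for \<omega>
    using that sq[OF S_meas] sq[OF Z_meas] S_L2mu Z_L2mu by auto
  note iso = Y.L2_isotypic
  have part1: "integrable \<mu> (\<lambda>y. ?p c1 S g \<omega> y * cnj (?p c2 Z g \<omega> y)) \<and>
      (\<integral>y. ?p c1 S g \<omega> y * cnj (?p c2 Z g \<omega> y) \<partial>\<mu>) = 0"
    if \<omega>: "\<omega> \<in> space P" and c: "c1 \<in> ?D" "c2 \<in> ?D" "c1 \<noteq> c2" for \<omega> g c1 c2
  proof
    \<comment> \<open>The two components are orthogonal before translation, and the isometry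
      \<open>act g\<close> carries this to an arbitrary \<open>g\<close>.\<close>
    note E = iso[OF c(1) S[OF \<omega>]] iso[OF c(2) Z[OF \<omega>]]
    have "integrable \<mu> (\<lambda>y. Y.isotypic c1 (S \<omega>) (act g y) * cnj (Y.isotypic c2 (Z \<omega>) (act g y)))"
      by (rule integrable_l2_inner) (rule Y.L2_act, rule E)+
    then show "integrable \<mu> (\<lambda>y. ?p c1 S g \<omega> y * cnj (?p c2 Z g \<omega> y))"
      by (simp add: star cong: Bochner_Integration.integrable_cong)
    have "(\<integral>y. ?p c1 S g \<omega> y * cnj (?p c2 Z g \<omega> y) \<partial>\<mu>)
        = l2_inner \<mu> (\<lambda>y. Y.isotypic c1 (S \<omega>) (act g y)) (\<lambda>y. Y.isotypic c2 (Z \<omega>) (act g y))"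
      unfolding l2_inner_def by (rule Bochner_Integration.integral_cong) (simp_all add: star)
    also have "\<dots> = 0"
      using c by (simp add: Y.l2_inner_act[OF E] Y.isotypic_orthogonality S[OF \<omega>] Z[OF \<omega>])
    finally show "(\<integral>y. ?p c1 S g \<omega> y * cnj (?p c2 Z g \<omega> y) \<partial>\<mu>) = 0" .
  qed
  have orth: "(\<integral>y. ?p c1 f e \<omega> y * cnj (?p c2 f e \<omega> y) \<partial>\<mu>) = 0"
    if "square_integrable \<mu> (f \<omega>)" "c1 \<in> ?D" "c2 \<in> ?D" "c1 \<noteq> c2" for f c1 c2 and \<omega> :: 'w
    using Y.isotypic_orthogonality[OF that(2,3,1,1)] that(4) by (simp add: l2_inner_def star_e)
  have expand: "((\<lambda>F. \<integral>y. (cmod (f \<omega> y - (\<Sum>c\<in>F. ?p c f e \<omega> y)))\<^sup>2 \<partial>\<mu>) \<longlongrightarrow> 0)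
      (finite_subsets_at_top ?D)"
    if "square_integrable \<mu> (f \<omega>)" for f and \<omega> :: 'w
    using Y.isotypic_expansion[OF that] by (simp add: l2_sq_def star_e)
  have parseval: "((\<lambda>c. \<integral>y. ?p c S e \<omega> y * cnj (?p c Z e \<omega> y) \<partial>\<mu>)
      has_sum (\<integral>y. S \<omega> y * cnj (Z \<omega> y) \<partial>\<mu>)) ?D"
    if "\<omega> \<in> space P" for \<omega>
    using Y.isotypic_inner_has_sum[OF S[OF that] Z[OF that]] by (simp add: l2_inner_def star_e)
  have part3: "(\<forall>c\<in>?D. square_integrable ?X (\<lambda>(\<omega>, y). ?p c Z e \<omega> y)) \<and>
      (\<forall>c1\<in>?D. \<forall>c2\<in>?D. c1 \<noteq> c2 \<longrightarrow>
        (\<integral>p. (case p of (\<omega>, y) \<Rightarrow> ?p c1 Z e \<omega> y * cnj (?p c2 Z e \<omega> y)) \<partial>?X) = 0) \<and>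
      ((\<lambda>F. \<integral>p. (case p of (\<omega>, y) \<Rightarrow> (cmod (Z \<omega> y - (\<Sum>c\<in>F. ?p c Z e \<omega> y)))\<^sup>2) \<partial>?X)
        \<longlongrightarrow> 0) (finite_subsets_at_top ?D)"
    if ZX: "square_integrable ?X (\<lambda>(\<omega>, y). Z \<omega> y)"
  proof (intro conjI ballI impI)
    show "square_integrable ?X (\<lambda>(\<omega>, y). ?p c Z e \<omega> y)" if "c \<in> ?D" for c
      using X.L2_isotypic[OF that ZX] by (simp add: star_X)
    show "(\<integral>p. (case p of (\<omega>, y) \<Rightarrow> ?p c1 Z e \<omega> y * cnj (?p c2 Z e \<omega> y)) \<partial>?X) = 0"
      if "c1 \<in> ?D" "c2 \<in> ?D" "c1 \<noteq> c2" for c1 c2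
      using X.isotypic_orthogonality[OF that(1,2) ZX ZX] that(3)
      unfolding star_X l2_inner_def by (simp add: case_prod_unfold)
    show "((\<lambda>F. \<integral>p. (case p of (\<omega>, y) \<Rightarrow> (cmod (Z \<omega> y - (\<Sum>c\<in>F. ?p c Z e \<omega> y)))\<^sup>2) \<partial>?X)
        \<longlongrightarrow> 0) (finite_subsets_at_top ?D)"
      using X.isotypic_expansion[OF ZX] unfolding star_X l2_sq_def by (simp add: case_prod_unfold)
  qed
  show ?thesis
    by (intro ballI allI impI conjI part3 part1 orth expand parseval S Z iso[folded star_e] | (subst star_e, rule iso) | assumption)+
qed

end
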